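(* For each non-superreflexive Banach space $X$ there exists a separable Banach space $Z$ whose dual $Z^*$ is nonseparable and such that $Z^*$ is crudely finitely representable in $X$.
   Context: Let $d(F,G)$ denote the Banach-Mazur distance between finite-dimensional normed spaces. A Banach space $W$ is finitely representable in a Banach space $Y$ if for every $\varepsilon>0$ and every finite-dimensional subspace $F\subset W$ there exists a finite-dimensional subspace $G\subset Y$ such that $d(F,G)<1+\varepsilon$. A Banach space $W$ is crudely finitely representable in $Y$ if there exists $1\le C<\infty$ such that for every finite-dimensional subspace $F\subset W$ there exists a finite-dimensional subspace $G\subset Y$ such that $d(F,G)\le C$. A Banach space $X$ is superreflexive if every Banach space finitely representable in $X$ is reflexive, and non-superreflexive otherwise. *)

theory Defs
  imports "HOL-Analysis.Analysis" "HOL-Library.Function_Algebras"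
begin

instantiation "fun" :: (type, real_vector) real_vector
begin

definition scaleR_fun :: "real \<Rightarrow> ('a \<Rightarrow> 'b) \<Rightarrow> 'a \<Rightarrow> 'b"
  where "scaleR_fun c f = (\<lambda>x. c *\<^sub>R f x)"

instance
  by standard (simp_all add: scaleR_fun_def fun_eq_iff scaleR_add_right scaleR_add_left)

end

text \<open>
  Existential statements about Banach spaces cannot range over types, so a normed space is
  given here by a linear subspace of an ambient real vector space type together with a
  norm on that subspace. The ambient type contributes only its vector space operations; the values
  of the norm outside the subspace are irrelevant.
  A Banach space in the sense of the type class is the case of \<^term>\<open>UNIV\<close> and \<^term>\<open>norm\<close>.
  For separable Banach spaces the ambient type \<^typ>\<open>nat \<Rightarrow> real\<close> is no restriction: a
  countable norming set of functionals embeds every such space linearly into it.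
\<close>

record 'a nspace =
  vecs :: "'a set"
  nrm :: "'a \<Rightarrow> real"

locale normed_space =
  fixes V :: "'a::real_vector nspace"
  assumes subspace_vecs: "subspace (vecs V)"
    and nrm_eq_0_iff: "x \<in> vecs V \<Longrightarrow> nrm V x = 0 \<longleftrightarrow> x = 0"
    and nrm_triangle: "x \<in> vecs V \<Longrightarrow> y \<in> vecs V \<Longrightarrow> nrm V (x + y) \<le> nrm V x + nrm V y"
    and nrm_scaleR: "x \<in> vecs V \<Longrightarrow> nrm V (c *\<^sub>R x) = \<bar>c\<bar> * nrm V x"

text \<open>
  The locale \<^locale>\<open>Metric_space\<close> requires symmetry and nonnegativity also outside the carrier,
  hence the value 0 there.
\<close>

definition ndist :: "'a::real_vector nspace \<Rightarrow> 'a \<Rightarrow> 'a \<Rightarrow> real"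
  where "ndist V x y = (if x \<in> vecs V \<and> y \<in> vecs V then nrm V (x - y) else 0)"

lemma (in normed_space) Metric_space_ndist: "Metric_space (vecs V) (ndist V)"
proof
  have diff: "x - y \<in> vecs V" if "x \<in> vecs V" "y \<in> vecs V" for x y
    using that subspace_vecs by (rule_tac subspace_diff)
  have neg: "nrm V (- x) = nrm V x" if "x \<in> vecs V" for x
    using nrm_scaleR[OF that, of "- 1"] by simp
  show "0 \<le> ndist V x y" for x y
  proof (cases "x \<in> vecs V \<and> y \<in> vecs V")
    case True
    then have d: "x - y \<in> vecs V" and d': "- (x - y) \<in> vecs V"
      using diff[of x y] diff[of y x] by auto
    have "nrm V 0 = 0"
      using nrm_eq_0_iff[of 0] subspace_vecs subspace_0 by blast
    then show ?thesis
      using nrm_triangle[OF d d'] neg[OF d] True by (simp add: ndist_def)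
  qed (auto simp: ndist_def)
  show "ndist V x y = ndist V y x" for x y
    using neg[OF diff, of x y] by (auto simp: ndist_def)
  show "ndist V x y = 0 \<longleftrightarrow> x = y" if "x \<in> vecs V" "y \<in> vecs V" for x y
    using nrm_eq_0_iff[OF diff[OF that]] that by (simp add: ndist_def)
  show "ndist V x z \<le> ndist V x y + ndist V y z"
    if "x \<in> vecs V" "y \<in> vecs V" "z \<in> vecs V" for x y z
    using nrm_triangle[OF diff[OF that(1,2)] diff[OF that(2,3)]] that by (simp add: ndist_def)
qed

definition banach_space :: "'a::real_vector nspace \<Rightarrow> bool"
  where "banach_space V \<longleftrightarrow> normed_space V \<and> Metric_space.mcomplete (vecs V) (ndist V)"

definition separable :: "'a::real_vector nspace \<Rightarrow> bool"
  where "separable V \<longleftrightarrow> separable_space (Metric_space.mtopology (vecs V) (ndist V))"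

definition lin_on :: "'a::real_vector set \<Rightarrow> ('a \<Rightarrow> 'b::real_vector) \<Rightarrow> bool"
  where "lin_on S T \<longleftrightarrow> (\<forall>x\<in>S. \<forall>y\<in>S. T (x + y) = T x + T y) \<and> (\<forall>c. \<forall>x\<in>S. T (c *\<^sub>R x) = c *\<^sub>R T x)"

text \<open>
  Functionals are made unique as HOL functions by letting them vanish off the carrier. The dual
  then lies in the vector space type \<^typ>\<open>'a \<Rightarrow> real\<close> with pointwise operations.
\<close>

definition dual :: "'a::real_vector nspace \<Rightarrow> ('a \<Rightarrow> real) nspace"
  where "dual V =
    \<lparr>vecs = {f. lin_on (vecs V) f \<and> (\<exists>K. \<forall>x\<in>vecs V. \<bar>f x\<bar> \<le> K * nrm V x) \<and> (\<forall>x. x \<notin> vecs V \<longrightarrow> f x = 0)},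
     nrm = (\<lambda>f. SUP x\<in>{x \<in> vecs V. nrm V x \<le> 1}. \<bar>f x\<bar>)\<rparr>"

definition canonical_embedding :: "'a::real_vector nspace \<Rightarrow> 'a \<Rightarrow> ('a \<Rightarrow> real) \<Rightarrow> real"
  where "canonical_embedding V x = (\<lambda>f. if f \<in> vecs (dual V) then f x else 0)"

definition reflexive :: "'a::real_vector nspace \<Rightarrow> bool"
  where "reflexive V \<longleftrightarrow> canonical_embedding V ` vecs V = vecs (dual (dual V))"

definition op_norm :: "'a::real_vector nspace \<Rightarrow> 'b::real_vector nspace \<Rightarrow> ('a \<Rightarrow> 'b) \<Rightarrow> ereal"
  where "op_norm V W T = (SUP x\<in>{x \<in> vecs V. nrm V x \<le> 1}. ereal (nrm W (T x)))"

definition lin_iso :: "'a::real_vector nspace \<Rightarrow> 'b::real_vector nspace \<Rightarrow> ('a \<Rightarrow> 'b) \<Rightarrow> bool"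
  where "lin_iso V W T \<longleftrightarrow> lin_on (vecs V) T \<and> bij_betw T (vecs V) (vecs W)"

text \<open>
  The multiplicative Banach--Mazur distance of finite-dimensional spaces; it is \<^term>\<open>\<infinity> :: ereal\<close>
  when the dimensions differ (infimum of the empty set).
\<close>

definition banach_mazur :: "'a::real_vector nspace \<Rightarrow> 'b::real_vector nspace \<Rightarrow> ereal"
  where "banach_mazur V W =
    (INF T\<in>{T. lin_iso V W T}. op_norm V W T * op_norm W V (inv_into (vecs V) T))"

definition findim_subspace :: "'a::real_vector nspace \<Rightarrow> 'a nspace \<Rightarrow> bool"
  where "findim_subspace F V \<longleftrightarrow>
    vecs F \<subseteq> vecs V \<and> nrm F = nrm V \<and> (\<exists>B. finite B \<and> vecs F = span B)"

definition finitely_representable :: "'a::real_vector nspace \<Rightarrow> 'b::real_vector nspace \<Rightarrow> bool"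
  where "finitely_representable W Y \<longleftrightarrow>
    (\<forall>\<epsilon>::real. \<epsilon> > 0 \<longrightarrow>
      (\<forall>F. findim_subspace F W \<longrightarrow>
        (\<exists>G. findim_subspace G Y \<and> banach_mazur F G < ereal (1 + \<epsilon>))))"

definition crudely_finitely_representable ::
    "'a::real_vector nspace \<Rightarrow> 'b::real_vector nspace \<Rightarrow> bool"
  where "crudely_finitely_representable W Y \<longleftrightarrow>
    (\<exists>C::real. 1 \<le> C \<and>
      (\<forall>F. findim_subspace F W \<longrightarrow>
        (\<exists>G. findim_subspace G Y \<and> banach_mazur F G \<le> ereal C)))"

text \<open>
  HOL cannot quantify over types inside a definition, so the ambient type \<^typ>\<open>'w\<close> of the spaces
  \<^term>\<open>W\<close> is a parameter. A theorem with the hypothesis \<open>\<not> superreflexive TYPE('w) X\<close> for a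
  type variable \<^typ>\<open>'w\<close> covers nonreflexive witnesses \<^term>\<open>W\<close> in every ambient type.
\<close>

definition superreflexive :: "'w::real_vector itself \<Rightarrow> 'a::real_vector nspace \<Rightarrow> bool"
  where "superreflexive _ X \<longleftrightarrow>
    (\<forall>W::'w nspace. banach_space W \<and> finitely_representable W X \<longrightarrow> reflexive W)"

end

theory Submission
  imports Defs
begin

text \<open>
  Let \<open>W\<close> be a nonreflexive Banach space that is finitely representable in \<open>X\<close>, and let \<open>F\<close> be an
  element of its bidual at distance more than \<open>d > 0\<close> from \<open>W\<close>. By Helly's lemma there is an
  ultrafilter \<open>U\<close> on a ball of \<open>W\<close> along which \<open>f w\<close> tends to \<open>F f\<close> for every functional \<open>f\<close>
  (\<open>nonreflexive_ultrafilter\<close>).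

  Iterated limits of \<open>\<parallel>\<Sum>\<^sub>i a\<^sub>i w\<^sub>i\<parallel>\<close> along \<open>U\<close> depend only on the nonzero coefficients and their
  order: this is the spreading model of Brunel and Sucheston. If every vector is replaced by the
  average over a block of \<open>n\<close> consecutive vectors, with \<open>n\<close> tending to infinity, then the norm \<open>N\<close>
  obtained in the limit has a further property: replacing consecutive vectors by a single one of them
  does not increase it. The reason is that a pattern may slide inside a block without changing
  its norm, and the average over all shifts of a pattern is the average over the block, up to
  boundary terms. The averages over two blocks stay \<open>d\<close> apart: when the first one has been chosen, some
  functional \<open>f\<close> separates it by \<open>d\<close> from all later vectors. Any countable order can serve to index
  the vectors; here it is the order of a sequence \<open>r\<close> that is dense in \<open>[0,1)\<close>. So \<open>N\<close> is a norm on the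
  finitely supported sequences whose unit vectors are bounded and separated, every \<open>r\<close>-monotone map
  of the indices induces a contraction for \<open>N\<close>, and the space is finitely representable in \<open>W\<close>
  (\<open>monotone_contractive_ultrafilter\<close>, \<open>collapsing_norm_ex\<close>).

  Rounding an index down to the nearest of the points \<open>r\<^sub>0, \<dots>, r\<^sub>n\<close> is such a monotone map, hence a
  contractive projection. The functionals that factor through one of these projections are step
  functions of the index; their closure \<open>Z\<close> in the dual norm is separable. For \<open>t\<close> in \<open>[0,1)\<close> the
  value of a step function at \<open>t\<close> is a bounded functional on \<open>Z\<close>. If \<open>s < r\<^sub>k \<le> t\<close>, then the indicator
  of \<open>[r\<^sub>k,1)\<close> has norm at most \<open>2 / d\<close> and takes different values at \<open>s\<close> and \<open>t\<close>; so these uncountably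
  many functionals are separated, and the dual of \<open>Z\<close> is not separable (\<open>not_separable_dual_Z\<close>).

  Finally, the restriction of a functional \<open>\<phi>\<close> on \<open>Z\<close> to the step functions of level \<open>n\<close> is given by a
  finitely supported sequence \<open>coeffs n \<phi>\<close>, and \<open>N (coeffs n \<phi>)\<close> tends to \<open>\<parallel>\<phi>\<parallel>\<close>
  (\<open>coeffs_tendsto\<close>). By compactness the convergence is uniform on the unit sphere of a
  finite-dimensional space (\<open>eventually_equivalent_on_span\<close>). So every finite-dimensional subspace of
  the dual of \<open>Z\<close> embeds into \<open>W\<close>, and from there into \<open>X\<close>, with a uniform constant.
\<close>

section \<open>Ultrafilters and iterated limits\<close>

definition ultra :: "'a filter \<Rightarrow> bool"
  where "ultra F \<longleftrightarrow> F \<noteq> bot \<and> (\<forall>P. eventually P F \<or> eventually (\<lambda>x. \<not> P x) F)"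

lemma ultra_not_bot: "ultra F \<Longrightarrow> F \<noteq> bot"
  by (simp add: ultra_def)

lemma ultra_cases: "ultra F \<Longrightarrow> eventually P F \<or> eventually (\<lambda>x. \<not> P x) F"
  by (simp add: ultra_def)

text \<open>
  Zorn's lemma for the proper filters below \<open>F\<close>: a minimal one is an ultrafilter, because restricting it
  to a set gives either the same filter or the improper one.
\<close>

lemma ultra_ex:
  assumes "F \<noteq> bot"
  shows "\<exists>U. U \<le> F \<and> ultra U"
proof -
  define A where "A = {G. G \<le> F \<and> G \<noteq> bot}"
  define R where "R = {(G, H). G \<in> A \<and> H \<in> A \<and> H \<le> G}"
  have FieldR: "Field R = A"
    by (auto simp: R_def Field_def)
  have "\<exists>m\<in>Field R. \<forall>a\<in>Field R. (m, a) \<in> R \<longrightarrow> a = m"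
  proof (rule Zorns_po_lemma)
    show "Partial_order R"
      unfolding partial_order_on_def preorder_on_def FieldR
      by (auto simp: R_def refl_on_def trans_def antisym_def intro: order_trans)
    fix C assume C: "C \<in> Chains R"
    then have CA: "C \<subseteq> A" and Ctot: "\<And>G H. G \<in> C \<Longrightarrow> H \<in> C \<Longrightarrow> G \<le> H \<or> H \<le> G"
      by (auto simp: Chains_def R_def)
    show "\<exists>u\<in>Field R. \<forall>a\<in>C. (a, u) \<in> R"
    proof (cases "C = {}")
      case True
      then show ?thesis using assms by (auto simp: FieldR A_def)
    next
      case False
      have base: "eventually P (Inf C) \<longleftrightarrow> (\<exists>b\<in>C. eventually P b)" for P
      proof (rule eventually_Inf_base[OF False])
        show "\<exists>x\<in>C. x \<le> inf G H" if "G \<in> C" "H \<in> C" for G H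
          using Ctot[OF that] that by (metis inf.absorb1 inf.absorb2 order_refl)
      qed
      have "Inf C \<noteq> bot"
        using base[of "\<lambda>_. False"] CA by (auto simp: trivial_limit_def A_def)
      moreover have "Inf C \<le> F"
        using False CA by (auto simp: A_def intro: Inf_lower2)
      ultimately have "Inf C \<in> A" by (simp add: A_def)
      then show ?thesis
        using CA unfolding FieldR by (intro bexI[of _ "Inf C"]) (auto simp: R_def Inf_lower)
    qed
  qed
  then obtain U where U: "U \<in> A" and min: "\<And>G. G \<in> A \<Longrightarrow> G \<le> U \<Longrightarrow> G = U"
    unfolding FieldR by (auto simp: R_def)
  have "eventually P U \<or> eventually (\<lambda>x. \<not> P x) U" for P
  proof (rule disjCI)
    assume n: "\<not> eventually (\<lambda>x. \<not> P x) U"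
    let ?G = "inf U (principal {x. P x})"
    have "?G \<noteq> bot"
      using n by (auto simp: trivial_limit_def eventually_inf_principal)
    then have "?G = U"
      using U by (intro min) (auto simp: A_def intro: le_infI1)
    moreover have "eventually P ?G"
      by (simp add: eventually_inf_principal)
    ultimately show "eventually P U" by simp
  qed
  then show ?thesis
    using U by (auto simp: A_def ultra_def)
qed

lemma ultra_tendsto_Lim:
  fixes f :: "'a \<Rightarrow> real"
  assumes U: "ultra U" and b: "eventually (\<lambda>x. \<bar>f x\<bar> \<le> C) U"
  shows "(f \<longlongrightarrow> Lim U f) U"
proof -
  have nb: "filtermap f U \<noteq> bot"
    using U by (simp add: filtermap_bot_iff ultra_def)
  have "eventually (\<lambda>y. y \<in> {-C..C}) (filtermap f U)"
    using b by (auto simp: eventually_filtermap elim!: eventually_mono)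
  then obtain l where l: "inf (nhds l) (filtermap f U) \<noteq> bot"
    using compact_Icc[of "-C" C] nb unfolding compact_filter by metis
  have "(f \<longlongrightarrow> l) U"
  proof (rule topological_tendstoI)
    fix S assume S: "open S" "l \<in> S"
    show "eventually (\<lambda>x. f x \<in> S) U"
    proof (rule ccontr)
      assume "\<not> eventually (\<lambda>x. f x \<in> S) U"
      then have e1: "eventually (\<lambda>y. y \<notin> S) (filtermap f U)"
        using ultra_cases[OF U, of "\<lambda>x. f x \<in> S"] by (auto simp: eventually_filtermap)
      have e2: "eventually (\<lambda>y. y \<in> S) (nhds l)"
        using S by (rule eventually_nhds_in_open)
      have "eventually (\<lambda>_. False) (inf (nhds l) (filtermap f U))"
        unfolding eventually_inf using e1 e2 by blast
      then show False using l by (simp add: trivial_limit_def)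
    qed
  qed
  then show ?thesis
    using tendsto_Lim[of U f l] ultra_not_bot[OF U] by simp
qed

text \<open>
  The filter of the random element that is drawn by choosing \<open>x\<close> along \<open>F\<close> and then \<open>y\<close> along
  \<open>G x\<close>. Limits along it are iterated limits.
\<close>

definition bind_filter :: "'a filter \<Rightarrow> ('a \<Rightarrow> 'b filter) \<Rightarrow> 'b filter"
  where "bind_filter F G = Abs_filter (\<lambda>P. eventually (\<lambda>x. eventually P (G x)) F)"

lemma eventually_bind_filter:
  "eventually P (bind_filter F G) \<longleftrightarrow> eventually (\<lambda>x. eventually P (G x)) F"
  unfolding bind_filter_def
proof (rule eventually_Abs_filter, rule is_filter.intro)
  show "eventually (\<lambda>x. eventually (\<lambda>x. True) (G x)) F" by simp
  fix P Q
  show "eventually (\<lambda>x. eventually (\<lambda>y. P y \<and> Q y) (G x)) F"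
    if "eventually (\<lambda>x. eventually P (G x)) F" "eventually (\<lambda>x. eventually Q (G x)) F"
    using that by eventually_elim (rule eventually_conj)
  show "eventually (\<lambda>x. eventually Q (G x)) F"
    if "\<forall>y. P y \<longrightarrow> Q y" "eventually (\<lambda>x. eventually P (G x)) F"
    using that(2) by eventually_elim (use that(1) in \<open>auto elim!: eventually_mono\<close>)
qed

lemma bind_filter_not_bot:
  assumes "F \<noteq> bot" "\<And>x. G x \<noteq> bot"
  shows "bind_filter F G \<noteq> bot"
  using assms by (simp add: trivial_limit_def eventually_bind_filter)

lemma ultra_bind_filter:
  assumes "ultra F" "\<And>x. ultra (G x)"
  shows "ultra (bind_filter F G)"
  unfolding ultra_def
proof (intro conjI allI)
  show "bind_filter F G \<noteq> bot"
    using assms by (intro bind_filter_not_bot) (auto simp: ultra_def)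
  fix P
  show "eventually P (bind_filter F G) \<or> eventually (\<lambda>x. \<not> P x) (bind_filter F G)"
    using ultra_cases[OF assms(1), of "\<lambda>x. eventually P (G x)"] ultra_cases[OF assms(2), of P]
    unfolding eventually_bind_filter by (metis (mono_tags, lifting) eventually_mono)
qed

lemma ultra_filtermap: "ultra F \<Longrightarrow> ultra (filtermap f F)"
  by (auto simp: ultra_def eventually_filtermap filtermap_bot_iff)

lemma tendsto_bind_filter:
  fixes f :: "'b \<Rightarrow> real"
  assumes "eventually (\<lambda>x. (f \<longlongrightarrow> l x) (G x)) F" and "(l \<longlongrightarrow> L) F"
  shows "(f \<longlongrightarrow> L) (bind_filter F G)"
proof (rule tendstoI)
  fix e :: real assume "e > 0"
  then have "eventually (\<lambda>x. dist (l x) L < e / 2) F"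
    using assms(2) by (intro tendstoD) simp_all
  with assms(1) have "eventually (\<lambda>x. eventually (\<lambda>y. dist (f y) L < e) (G x)) F"
  proof eventually_elim
    case (elim x)
    have "eventually (\<lambda>y. dist (f y) (l x) < e / 2) (G x)"
      using elim(1) \<open>e > 0\<close> by (intro tendstoD) simp_all
    then show ?case
      by eventually_elim (use elim(2) in \<open>metis dist_triangle_half_l dist_commute\<close>)
  qed
  then show "eventually (\<lambda>y. dist (f y) L < e) (bind_filter F G)"
    by (simp add: eventually_bind_filter)
qed

text \<open>
  The first vector of the list is chosen first, so a limit along \<open>upow U k\<close> is the iterated limit over the
  entries of the list, with the first entry outermost.
\<close>

primrec upow :: "'a filter \<Rightarrow> nat \<Rightarrow> 'a list filter"
  where "upow U 0 = principal {[]}"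
  | "upow U (Suc k) = bind_filter U (\<lambda>w. filtermap ((#) w) (upow U k))"

lemma ultra_upow: "ultra U \<Longrightarrow> ultra (upow U k)"
proof (induction k)
  case 0
  show ?case by (auto simp: ultra_def eventually_principal principal_eq_bot_iff)
next
  case (Suc k)
  then show ?case by (auto intro!: ultra_bind_filter ultra_filtermap)
qed

lemma eventually_upow_add:
  "eventually P (upow U (j + k)) \<longleftrightarrow>
    eventually (\<lambda>us. eventually (\<lambda>vs. P (us @ vs)) (upow U k)) (upow U j)"
  by (induction j arbitrary: P)
    (simp_all add: eventually_principal eventually_bind_filter eventually_filtermap)

lemma eventually_upow_all:
  assumes "eventually P U"
  shows "eventually (\<lambda>ws. length ws = k \<and> (\<forall>w\<in>set ws. P w)) (upow U k)"
proof (induction k)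
  case 0
  show ?case by (simp add: eventually_principal)
next
  case (Suc k)
  show ?case
    using assms unfolding upow.simps eventually_bind_filter eventually_filtermap
    by eventually_elim (use Suc in \<open>auto elim: eventually_mono\<close>)
qed

lemma eventually_const_ultra: "ultra U \<Longrightarrow> eventually (\<lambda>_. P) U \<longleftrightarrow> P"
  by (simp add: eventually_const_iff ultra_def)

text \<open>
  Entries of the list that are not looked at can be dropped, since a limit of a constant is that
  constant. So the entries at increasing positions have the same distribution as the first ones.
\<close>

lemma eventually_upow_subsequence:
  assumes U: "ultra U"
  shows "sorted_wrt (<) is \<Longrightarrow> set is \<subseteq> {..<k} \<Longrightarrow>
    eventually (\<lambda>ws. P (map ((!) ws) is)) (upow U k) \<longleftrightarrow> eventually P (upow U (length is))"
proof (induction k arbitrary: "is" P)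
  case 0
  then show ?case by (auto simp: eventually_principal)
next
  case (Suc k)
  note step = eventually_bind_filter eventually_filtermap
  have shift: "\<exists>js. is' = map Suc js \<and> sorted_wrt (<) js \<and> set js \<subseteq> {..<k}"
    if "sorted_wrt (<) is'" "set is' \<subseteq> {..<Suc k}" "0 \<notin> set is'" for is'
  proof -
    define js where "js = map (\<lambda>i. i - 1) is'"
    have "is' = map Suc js"
      unfolding js_def map_map using that(3) by (intro map_idI[symmetric]) (auto, metis Suc_pred gr0I)
    moreover have "sorted_wrt (<) js" "set js \<subseteq> {..<k}"
      using that(1,2) calculation by (auto simp: sorted_wrt_map)
    ultimately show ?thesis by blast
  qed
  show ?case
  proof (cases "0 \<in> set is")
    case True
    then obtain is' where is': "is = 0 # is'"
      using Suc.prems(1) by (cases "is") auto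
    then have "0 \<notin> set is'" using Suc.prems(1) by auto
    then obtain js where js: "is' = map Suc js" "sorted_wrt (<) js" "set js \<subseteq> {..<k}"
      using shift[of is'] Suc.prems is' by auto
    have "map ((!) (w # ws)) is = w # map ((!) ws) js" for w :: 'a and ws
      by (simp add: is' js)
    then have "eventually (\<lambda>ws. P (map ((!) ws) is)) (upow U (Suc k)) \<longleftrightarrow>
      eventually (\<lambda>w. eventually (\<lambda>ws. P (w # map ((!) ws) js)) (upow U k)) U"
      by (simp add: step)
    also have "\<dots> \<longleftrightarrow> eventually P (upow U (length is))"
      using Suc.IH[OF js(2,3), of "\<lambda>us. P (w # us)" for w] by (simp add: step is' js(1))
    finally show ?thesis .
  next
    case False
    then obtain js where js: "is = map Suc js" "sorted_wrt (<) js" "set js \<subseteq> {..<k}"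
      using shift[of "is"] Suc.prems by auto
    have "map ((!) (w # ws)) is = map ((!) ws) js" for w :: 'a and ws
      by (simp add: js)
    then have "eventually (\<lambda>ws. P (map ((!) ws) is)) (upow U (Suc k)) \<longleftrightarrow>
      eventually (\<lambda>w. eventually (\<lambda>ws. P (map ((!) ws) js)) (upow U k)) U"
      by (simp add: step)
    also have "\<dots> \<longleftrightarrow> eventually P (upow U (length is))"
      using Suc.IH[OF js(2,3), of P] by (simp add: eventually_const_ultra[OF U] js(1))
    finally show ?thesis .
  qed
qed

text \<open>
  Invariance under spreading: a family of entries is governed by the order of its positions alone.
\<close>

lemma eventually_upow_spread:
  fixes \<sigma> \<tau> :: "'i \<Rightarrow> nat"
  assumes U: "ultra U" and I: "finite I" "inj_on \<tau> I"
    and ord: "\<And>i j. i \<in> I \<Longrightarrow> j \<in> I \<Longrightarrow> \<tau> i < \<tau> j \<Longrightarrow> \<sigma> i < \<sigma> j"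
    and \<tau>: "\<tau> ` I \<subseteq> {..<k}" and \<sigma>: "\<sigma> ` I \<subseteq> {..<m}"
    and P: "\<And>f g. (\<And>i. i \<in> I \<Longrightarrow> f i = g i) \<Longrightarrow> P f \<longleftrightarrow> P g"
    and ev: "eventually (\<lambda>ws. P (\<lambda>i. ws ! \<tau> i)) (upow U k)"
  shows "eventually (\<lambda>ws. P (\<lambda>i. ws ! \<sigma> i)) (upow U m)"
proof -
  define ts where "ts = sorted_list_of_set (\<tau> ` I)"
  define ss where "ss = map (\<lambda>t. \<sigma> (inv_into I \<tau> t)) ts"
  have ts: "sorted_wrt (<) ts" "set ts = \<tau> ` I"
    using I by (auto simp: ts_def)
  have "\<exists>q. q < length ts \<and> ts ! q = \<tau> i" if "i \<in> I" for i
    using that ts(2) by (metis imageI in_set_conv_nth)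
  then obtain q where q: "\<And>i. i \<in> I \<Longrightarrow> q i < length ts \<and> ts ! q i = \<tau> i"
    by metis
  have sq: "ss ! q i = \<sigma> i" if "i \<in> I" for i
    using q[OF that] that I(2) by (simp add: ss_def)
  have "sorted_wrt (\<lambda>s t. \<sigma> (inv_into I \<tau> s) < \<sigma> (inv_into I \<tau> t)) ts"
    using ts(1) by (rule sorted_wrt_mono_rel[rotated])
      (use ts(2) I(2) in \<open>auto intro!: ord\<close>)
  then have ss: "sorted_wrt (<) ss" "set ss \<subseteq> {..<m}"
    using \<sigma> ts(2) I(2) by (auto simp: ss_def sorted_wrt_map)
  let ?Q = "\<lambda>us. P (\<lambda>i. us ! q i)"
  have "?Q (map ((!) ws) ts) \<longleftrightarrow> P (\<lambda>i. ws ! \<tau> i)" for ws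
    using q by (intro P) simp
  then have "eventually ?Q (upow U (length ts))"
    using ev eventually_upow_subsequence[OF U ts(1), of k ?Q] ts(2) \<tau> by simp
  moreover have "length ss = length ts" by (simp add: ss_def)
  moreover have "?Q (map ((!) ws) ss) \<longleftrightarrow> P (\<lambda>i. ws ! \<sigma> i)" for ws
    using q sq by (intro P) (simp add: ss_def)
  ultimately show ?thesis
    using eventually_upow_subsequence[OF U ss, of ?Q] by simp
qed

section \<open>The Hahn--Banach theorem\<close>

definition sublinear_on :: "'a::real_vector set \<Rightarrow> ('a \<Rightarrow> real) \<Rightarrow> bool"
  where "sublinear_on S p \<longleftrightarrow> (\<forall>x\<in>S. \<forall>y\<in>S. p (x + y) \<le> p x + p y) \<and>
    (\<forall>c\<ge>0. \<forall>x\<in>S. p (c *\<^sub>R x) = c * p x)"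

lemma sublinear_on_zero: "sublinear_on S p \<Longrightarrow> subspace S \<Longrightarrow> p 0 = 0"
  unfolding sublinear_on_def using subspace_0 by (metis mult_zero_left order_refl scaleR_zero_left)

lemma sublinear_on_neg:
  assumes "sublinear_on S p" "subspace S" "x \<in> S"
  shows "- p (- x) \<le> p x"
proof -
  have "p (x + - x) \<le> p x + p (- x)"
    using assms subspace_neg unfolding sublinear_on_def by blast
  then show ?thesis using sublinear_on_zero[OF assms(1,2)] by simp
qed

text \<open>
  The sublinear functional \<open>p\<close> is pushed down until it is linear along the line spanned by \<open>y\<close>: the
  value at \<open>- y\<close> becomes \<open>- p y\<close>.
\<close>

definition linearize :: "('a::real_vector \<Rightarrow> real) \<Rightarrow> 'a \<Rightarrow> 'a \<Rightarrow> real"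
  where "linearize p y x = (INF t\<in>{0..}. p (x + t *\<^sub>R y) - t * p y)"

lemma linearize_le:
  assumes p: "sublinear_on S p" and S: "subspace S" and xy: "x \<in> S" "y \<in> S" and t: "t \<ge> 0"
  shows "linearize p y x \<le> p (x + t *\<^sub>R y) - t * p y"
  unfolding linearize_def
proof (rule cINF_lower)
  have "- p (- x) \<le> p (x + s *\<^sub>R y) - s * p y" if "s \<ge> 0" for s
  proof -
    have "p ((x + s *\<^sub>R y) + - x) \<le> p (x + s *\<^sub>R y) + p (- x)"
      using p S xy unfolding sublinear_on_def
      by (blast intro: subspace_add subspace_scale subspace_neg)
    moreover have "p (s *\<^sub>R y) = s * p y"
      using p xy that unfolding sublinear_on_def by blast
    ultimately show ?thesis by simp
  qed
  then show "bdd_below ((\<lambda>s. p (x + s *\<^sub>R y) - s * p y) ` {0..})"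
    by (intro bdd_belowI2[where m = "- p (- x)"]) auto
qed (use t in auto)

lemma linearize_greatest:
  "(\<And>t. t \<ge> 0 \<Longrightarrow> m \<le> p (x + t *\<^sub>R y) - t * p y) \<Longrightarrow> m \<le> linearize p y x"
  unfolding linearize_def by (rule cINF_greatest) auto

lemma sublinear_on_linearize:
  assumes p: "sublinear_on S p" and S: "subspace S" and y: "y \<in> S"
  shows "sublinear_on S (linearize p y)"
proof -
  note padd = p[unfolded sublinear_on_def, THEN conjunct1, rule_format]
  note pscale = p[unfolded sublinear_on_def, THEN conjunct2, rule_format]
  note le = linearize_le[OF p S _ y]
  have add: "linearize p y (x + x') \<le> linearize p y x + linearize p y x'"
    if "x \<in> S" "x' \<in> S" for x x'
  proof -
    have "linearize p y (x + x') - (p (x + s *\<^sub>R y) - s * p y) \<le> linearize p y x'"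
      if s: "s \<ge> 0" for s
    proof (rule linearize_greatest)
      fix t :: real assume t: "t \<ge> 0"
      have "linearize p y (x + x') \<le> p ((x + x') + (s + t) *\<^sub>R y) - (s + t) * p y"
        using \<open>x \<in> S\<close> \<open>x' \<in> S\<close> s t by (intro le subspace_add[OF S]) auto
      also have "(x + x') + (s + t) *\<^sub>R y = (x + s *\<^sub>R y) + (x' + t *\<^sub>R y)"
        by (simp add: algebra_simps)
      also have "p \<dots> \<le> p (x + s *\<^sub>R y) + p (x' + t *\<^sub>R y)"
        using \<open>x \<in> S\<close> \<open>x' \<in> S\<close> y by (intro padd subspace_add[OF S] subspace_scale[OF S])
      finally show "linearize p y (x + x') - (p (x + s *\<^sub>R y) - s * p y) \<le> p (x' + t *\<^sub>R y) - t * p y"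
        by (simp add: algebra_simps)
    qed
    then have "linearize p y (x + x') - linearize p y x' \<le> linearize p y x"
      by (intro linearize_greatest) (simp add: algebra_simps)
    then show ?thesis by simp
  qed
  have half: "linearize p y (c *\<^sub>R x) \<le> c * linearize p y x" if "c > 0" "x \<in> S" for c x
  proof -
    have "linearize p y (c *\<^sub>R x) / c \<le> linearize p y x"
    proof (rule linearize_greatest)
      fix t :: real assume t: "t \<ge> 0"
      have "linearize p y (c *\<^sub>R x) \<le> p (c *\<^sub>R x + (c * t) *\<^sub>R y) - (c * t) * p y"
        using that t by (intro le subspace_scale[OF S]) auto
      also have "c *\<^sub>R x + (c * t) *\<^sub>R y = c *\<^sub>R (x + t *\<^sub>R y)"
        by (simp add: algebra_simps)
      also have "p \<dots> = c * p (x + t *\<^sub>R y)"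
        using that y by (intro pscale subspace_add[OF S] subspace_scale[OF S]) auto
      finally show "linearize p y (c *\<^sub>R x) / c \<le> p (x + t *\<^sub>R y) - t * p y"
        using that by (simp add: field_simps)
    qed
    then show ?thesis using that by (simp add: field_simps)
  qed
  have "linearize p y (c *\<^sub>R x) = c * linearize p y x" if "c \<ge> 0" "x \<in> S" for c x
  proof (cases "c = 0")
    case True
    have "linearize p y 0 = 0"
    proof (rule antisym)
      show "linearize p y 0 \<le> 0"
        using le[OF subspace_0[OF S], of 0] sublinear_on_zero[OF p S] by simp
      show "0 \<le> linearize p y 0"
        by (rule linearize_greatest) (use pscale y in auto)
    qed
    then show ?thesis using True by simp
  next
    case False
    then have c: "c > 0" using that by simp
    have "linearize p y ((1 / c) *\<^sub>R (c *\<^sub>R x)) \<le> (1 / c) * linearize p y (c *\<^sub>R x)"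
      using c that by (intro half subspace_scale[OF S]) auto
    then have "c * linearize p y x \<le> linearize p y (c *\<^sub>R x)"
      using c by (simp add: field_simps)
    with half[OF c that(2)] show ?thesis by simp
  qed
  with add show ?thesis by (simp add: sublinear_on_def)
qed

text \<open>
  Zorn's lemma for the sublinear functionals below \<open>p\<close>. The infimum of a chain is real-valued, because
  every member is bounded below by \<open>- p (- x)\<close>, and it is subadditive, because of two members of a chain
  one lies below the other.
\<close>

lemma minimal_sublinear_ex:
  assumes p: "sublinear_on S p" and S: "subspace S"
  shows "\<exists>q. sublinear_on S q \<and> (\<forall>x\<in>S. q x \<le> p x) \<and>
    (\<forall>q'. sublinear_on S q' \<and> (\<forall>x\<in>S. q' x \<le> q x) \<longrightarrow> (\<forall>x\<in>S. q' x = q x))"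
proof -
  define A where "A = {q. sublinear_on S q \<and> (\<forall>x\<in>S. q x \<le> p x) \<and> (\<forall>x. x \<notin> S \<longrightarrow> q x = 0)}"
  define R where "R = {(q, q'). q \<in> A \<and> q' \<in> A \<and> (\<forall>x\<in>S. q' x \<le> q x)}"
  \<comment> \<open>members of \<open>A\<close> vanish off \<open>S\<close>, which makes the order on \<open>A\<close> antisymmetric\<close>
  define cut where "cut q = (\<lambda>x. if x \<in> S then q x else 0 :: real)" for q :: "'a \<Rightarrow> real"
  have cutA: "cut q \<in> A" if "sublinear_on S q" "\<forall>x\<in>S. q x \<le> p x" for q
    using that S unfolding A_def cut_def sublinear_on_def
    by (auto intro: subspace_add subspace_scale)
  have FieldR: "Field R = A"
    by (auto simp: R_def Field_def)
  have "\<exists>m\<in>Field R. \<forall>a\<in>Field R. (m, a) \<in> R \<longrightarrow> a = m"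
  proof (rule Zorns_po_lemma)
    have "a = b" if "(a, b) \<in> R" "(b, a) \<in> R" for a b
    proof
      fix x
      show "a x = b x"
        using that by (cases "x \<in> S") (auto simp: R_def A_def intro: antisym)
    qed
    then show "Partial_order R"
      unfolding partial_order_on_def preorder_on_def FieldR
      by (auto simp: refl_on_def trans_def antisym_def) (auto simp: R_def intro: order_trans)
    fix C assume C: "C \<in> Chains R"
    then have CA: "C \<subseteq> A"
      and Ctot: "\<And>q r. q \<in> C \<Longrightarrow> r \<in> C \<Longrightarrow> (\<forall>x\<in>S. q x \<le> r x) \<or> (\<forall>x\<in>S. r x \<le> q x)"
      by (auto simp: Chains_def R_def)
    show "\<exists>u\<in>Field R. \<forall>a\<in>C. (a, u) \<in> R"
    proof (cases "C = {}")
      case True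
      then show ?thesis using cutA[OF p] by (auto simp: FieldR)
    next
      case False
      define u where "u x = (INF q\<in>C. q x)" for x
      have u_le: "u x \<le> q x" if "q \<in> C" "x \<in> S" for q x
        unfolding u_def
      proof (rule cINF_lower[OF _ that(1)])
        have "- p (- x) \<le> r x" if "r \<in> C" for r
        proof -
          have r: "sublinear_on S r" "\<forall>x\<in>S. r x \<le> p x" using that CA by (auto simp: A_def)
          have "- x \<in> S" using \<open>x \<in> S\<close> S by (rule_tac subspace_neg)
          then show ?thesis
            using sublinear_on_neg[OF r(1) S \<open>x \<in> S\<close>] r(2) by force
        qed
        then show "bdd_below ((\<lambda>q. q x) ` C)" by (rule bdd_belowI2)
      qed
      have u_ge: "m \<le> u x" if "\<And>q. q \<in> C \<Longrightarrow> m \<le> q x" for m x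
        unfolding u_def using False that by (rule cINF_greatest)
      have add: "u (x + y) \<le> u x + u y" if xy: "x \<in> S" "y \<in> S" for x y
      proof -
        have *: "u (x + y) \<le> q x + r y" if "q \<in> C" "r \<in> C" for q r
        proof -
          have "\<exists>s\<in>C. s x \<le> q x \<and> s y \<le> r y"
            using Ctot[OF that] that xy by auto
          then obtain s where s: "s \<in> C" "s x \<le> q x" "s y \<le> r y" by blast
          have "u (x + y) \<le> s (x + y)" using s xy by (intro u_le subspace_add[OF S])
          also have "\<dots> \<le> s x + s y" using s(1) xy CA by (auto simp: A_def sublinear_on_def)
          finally show ?thesis using s by simp
        qed
        have "u (x + y) - q x \<le> u y" if "q \<in> C" for q
          using *[OF that] by (intro u_ge) (simp add: algebra_simps)
        then have "u (x + y) - u y \<le> u x"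
          by (intro u_ge) (simp add: algebra_simps)
        then show ?thesis by simp
      qed
      have scl: "q (c *\<^sub>R x) = c * q x" if "q \<in> C" "c \<ge> 0" "x \<in> S" for q c x
        using that CA by (auto simp: A_def sublinear_on_def)
      have "u (c *\<^sub>R x) = c * u x" if "c \<ge> 0" "x \<in> S" for c x
      proof (cases "c = 0")
        case True
        have "(\<lambda>q. q 0) ` C = {0}"
          using False CA sublinear_on_zero[OF _ S] by (force simp: A_def)
        then show ?thesis using True by (simp add: u_def)
      next
        case False
        with that have c: "c > 0" by simp
        have cx: "c *\<^sub>R x \<in> S" using that S by (rule_tac subspace_scale)
        have "u (c *\<^sub>R x) / c \<le> u x"
          using c u_le[OF _ cx] scl[OF _ that] by (intro u_ge) (simp add: field_simps)
        moreover have "c * u x \<le> u (c *\<^sub>R x)"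
          using c u_le[OF _ that(2)] by (intro u_ge) (simp add: scl[OF _ that])
        ultimately show ?thesis using c by (simp add: field_simps)
      qed
      with add have "sublinear_on S u" by (simp add: sublinear_on_def)
      moreover have "\<forall>x\<in>S. u x \<le> p x"
        using False CA u_le by (force simp: A_def)
      ultimately have "cut u \<in> A" by (rule cutA)
      moreover have "(q, cut u) \<in> R" if "q \<in> C" for q
        using that CA u_le calculation by (auto simp: R_def cut_def)
      ultimately show ?thesis by (auto simp: FieldR)
    qed
  qed
  then obtain q where q: "q \<in> A" and min: "\<And>r. r \<in> A \<Longrightarrow> \<forall>x\<in>S. r x \<le> q x \<Longrightarrow> r = q"
    unfolding FieldR by (auto simp: R_def)
  have "r x = q x" if "sublinear_on S r" "\<forall>x\<in>S. r x \<le> q x" "x \<in> S" for r x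
  proof -
    have "\<forall>x\<in>S. r x \<le> p x" using that q by (auto simp: A_def intro: order_trans)
    then have "cut r = q" using that by (intro min cutA) (auto simp: cut_def)
    then show ?thesis using \<open>x \<in> S\<close> by (metis cut_def)
  qed
  then show ?thesis using q by (intro exI[of _ q]) (auto simp: A_def)
qed

text \<open>
  A minimal sublinear functional equals all of its own linearizations and is therefore linear. In
  order to attain \<open>p\<close> at \<open>x0\<close>, one starts below \<open>linearize p x0\<close>, which takes the value \<open>- p x0\<close> at
  \<open>- x0\<close>.
\<close>

theorem hahn_banach_sublinear:
  assumes p: "sublinear_on S p" and S: "subspace S" and x0: "x0 \<in> S"
  shows "\<exists>f. lin_on S f \<and> (\<forall>x\<in>S. f x \<le> p x) \<and> f x0 = p x0"
proof -
  have lin0: "linearize r y x \<le> r x" "linearize r y (- y) \<le> - r y"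
    if "sublinear_on S r" "x \<in> S" "y \<in> S" for r x y
    using linearize_le[OF that(1) S that(2,3), of 0]
      linearize_le[OF that(1) S _ that(3), of "- y" 1] sublinear_on_zero[OF that(1) S]
      subspace_neg[OF S that(3)] by auto
  obtain q where q: "sublinear_on S q" and qle: "\<And>x. x \<in> S \<Longrightarrow> q x \<le> linearize p x0 x"
    and min: "\<And>r x. sublinear_on S r \<Longrightarrow> \<forall>x\<in>S. r x \<le> q x \<Longrightarrow> x \<in> S \<Longrightarrow> r x = q x"
    using minimal_sublinear_ex[OF sublinear_on_linearize[OF p S x0] S] by blast
  have neg: "q (- y) = - q y" if y: "y \<in> S" for y
  proof (rule antisym)
    have my: "- y \<in> S" using S y by (rule subspace_neg)
    have "linearize q y (- y) = q (- y)"
      using my by (intro min sublinear_on_linearize[OF q S y]) (auto intro: lin0[OF q _ y])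
    then show "q (- y) \<le> - q y" using lin0(2)[OF q y y] by simp
    show "- q y \<le> q (- y)" using sublinear_on_neg[OF q S y] by simp
  qed
  note qadd = q[unfolded sublinear_on_def, THEN conjunct1, rule_format]
  note qscale = q[unfolded sublinear_on_def, THEN conjunct2, rule_format]
  have add: "q (x + y) = q x + q y" if "x \<in> S" "y \<in> S" for x y
  proof -
    have "q (- x + - y) \<le> q (- x) + q (- y)"
      using that by (intro qadd subspace_neg[OF S])
    moreover have "- x + - y = - (x + y)" by simp
    ultimately show ?thesis
      using qadd[OF that] neg[OF that(1)] neg[OF that(2)] neg[OF subspace_add[OF S that]] by simp
  qed
  have "q (c *\<^sub>R x) = c * q x" if "x \<in> S" for c x
  proof (cases "c \<ge> 0")
    case True
    then show ?thesis using that by (rule qscale)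
  next
    case False
    have "q (- ((- c) *\<^sub>R x)) = - q ((- c) *\<^sub>R x)"
      using that by (intro neg subspace_scale[OF S])
    then show ?thesis using qscale[of "- c" x] False that by simp
  qed
  with add have "lin_on S q" by (simp add: lin_on_def)
  moreover have "q x \<le> p x" if "x \<in> S" for x
    using qle[OF that] lin0(1)[OF p that x0] by simp
  moreover have "q x0 = p x0"
  proof (rule antisym)
    show "p x0 \<le> q x0"
      using qle[OF subspace_neg[OF S x0]] lin0(2)[OF p x0 x0] neg[OF x0] by simp
  qed (use calculation x0 in auto)
  ultimately show ?thesis by blast
qed

context normed_space
begin

lemma nrm_zero [simp]: "nrm V 0 = 0"
  using nrm_eq_0_iff subspace_0[OF subspace_vecs] by blast

lemma zero_mem: "0 \<in> vecs V"
  using subspace_0[OF subspace_vecs] .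

lemma add_mem: "x \<in> vecs V \<Longrightarrow> y \<in> vecs V \<Longrightarrow> x + y \<in> vecs V"
  using subspace_add[OF subspace_vecs] .

lemma diff_mem: "x \<in> vecs V \<Longrightarrow> y \<in> vecs V \<Longrightarrow> x - y \<in> vecs V"
  using subspace_diff[OF subspace_vecs] .

lemma scaleR_mem: "x \<in> vecs V \<Longrightarrow> c *\<^sub>R x \<in> vecs V"
  using subspace_scale[OF subspace_vecs] .

lemma sum_mem: "(\<And>i. i \<in> I \<Longrightarrow> g i \<in> vecs V) \<Longrightarrow> sum g I \<in> vecs V"
  using subspace_sum[OF subspace_vecs] .

lemma nrm_minus: "x \<in> vecs V \<Longrightarrow> nrm V (- x) = nrm V x"
  using nrm_scaleR[of x "- 1"] by simp

lemma nrm_nonneg: "x \<in> vecs V \<Longrightarrow> 0 \<le> nrm V x"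
  using nrm_triangle[of x "- x"] subspace_neg[OF subspace_vecs, of x] nrm_minus[of x] by simp

lemma nrm_diff_triangle: "x \<in> vecs V \<Longrightarrow> y \<in> vecs V \<Longrightarrow> nrm V (x - y) \<le> nrm V x + nrm V y"
  using nrm_triangle[of x "- y"] subspace_neg[OF subspace_vecs, of y] nrm_minus[of y] by simp

lemma nrm_diff_ge: "x \<in> vecs V \<Longrightarrow> y \<in> vecs V \<Longrightarrow> nrm V x - nrm V y \<le> nrm V (x - y)"
  using nrm_triangle[of "x - y" y] diff_mem[of x y] by simp

lemma nrm_diff_commute: "x \<in> vecs V \<Longrightarrow> y \<in> vecs V \<Longrightarrow> nrm V (x - y) = nrm V (y - x)"
  using nrm_minus[of "x - y"] diff_mem[of x y] by simp

lemma nrm_sum: "(\<And>i. i \<in> I \<Longrightarrow> g i \<in> vecs V) \<Longrightarrow> nrm V (sum g I) \<le> (\<Sum>i\<in>I. nrm V (g i))"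
proof (induction I rule: infinite_finite_induct)
  case (insert i I)
  then have "nrm V (g i + sum g I) \<le> nrm V (g i) + nrm V (sum g I)"
    by (intro nrm_triangle sum_mem) auto
  with insert show ?case by simp
qed auto

lemma nrm_sum_scaleR_le:
  assumes "\<And>i. i \<in> I \<Longrightarrow> g i \<in> vecs V" "\<And>i. i \<in> I \<Longrightarrow> nrm V (g i) \<le> C"
  shows "nrm V (\<Sum>i\<in>I. c i *\<^sub>R g i) \<le> (\<Sum>i\<in>I. \<bar>c i\<bar>) * C"
proof -
  have "nrm V (\<Sum>i\<in>I. c i *\<^sub>R g i) \<le> (\<Sum>i\<in>I. nrm V (c i *\<^sub>R g i))"
    using assms by (intro nrm_sum scaleR_mem)
  also have "\<dots> \<le> (\<Sum>i\<in>I. \<bar>c i\<bar> * C)"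
    using assms by (intro sum_mono) (auto simp: nrm_scaleR intro: mult_left_mono)
  finally show ?thesis by (simp add: sum_distrib_right)
qed

end

lemma lin_on_sum:
  assumes "lin_on S T" "subspace S" "\<And>i. i \<in> I \<Longrightarrow> g i \<in> S"
  shows "T (\<Sum>i\<in>I. g i) = (\<Sum>i\<in>I. T (g i))"
  using assms(3)
proof (induction I rule: infinite_finite_induct)
  case (insert i I)
  then have "g i \<in> S" "sum g I \<in> S" by (auto intro: subspace_sum[OF assms(2)])
  with insert show ?case
    using assms(1) by (simp add: lin_on_def)
next
  case (infinite I)
  have "T (0 *\<^sub>R 0) = 0 *\<^sub>R T 0" using assms(1) subspace_0[OF assms(2)] unfolding lin_on_def by blast
  with infinite show ?case by simp
next
  case empty
  have "T (0 *\<^sub>R 0) = 0 *\<^sub>R T 0" using assms(1) subspace_0[OF assms(2)] unfolding lin_on_def by blast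
  then show ?case by simp
qed

lemma lin_on_add: "lin_on S T \<Longrightarrow> x \<in> S \<Longrightarrow> y \<in> S \<Longrightarrow> T (x + y) = T x + T y"
  by (simp add: lin_on_def)

lemma lin_on_scaleR: "lin_on S T \<Longrightarrow> x \<in> S \<Longrightarrow> T (c *\<^sub>R x) = c *\<^sub>R T x"
  by (simp add: lin_on_def)

lemma lin_on_0: "lin_on S T \<Longrightarrow> subspace S \<Longrightarrow> T 0 = 0"
  using lin_on_scaleR[of S T 0 0] subspace_0 by auto

lemma lin_on_minus: "lin_on S T \<Longrightarrow> x \<in> S \<Longrightarrow> T (- x) = - T x"
  using lin_on_scaleR[of S T x "- 1"] by simp

lemma lin_on_diff: "lin_on S T \<Longrightarrow> subspace S \<Longrightarrow> x \<in> S \<Longrightarrow> y \<in> S \<Longrightarrow> T (x - y) = T x - T y"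
  using lin_on_add[of S T x "- y"] lin_on_minus[of S T y] subspace_neg[of S y] by simp

context normed_space
begin

lemma dual_memI:
  assumes "lin_on (vecs V) f" "\<And>x. x \<in> vecs V \<Longrightarrow> \<bar>f x\<bar> \<le> K * nrm V x" "\<And>x. x \<notin> vecs V \<Longrightarrow> f x = 0"
  shows "f \<in> vecs (dual V)"
  using assms by (auto simp: dual_def)

lemma dual_lin: "f \<in> vecs (dual V) \<Longrightarrow> lin_on (vecs V) f"
  by (simp add: dual_def)

lemma dual_off: "f \<in> vecs (dual V) \<Longrightarrow> x \<notin> vecs V \<Longrightarrow> f x = 0"
  by (simp add: dual_def)

lemma dual_bound:
  assumes f: "f \<in> vecs (dual V)" and x: "x \<in> vecs V"
  shows "\<bar>f x\<bar> \<le> nrm (dual V) f * nrm V x"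
proof -
  obtain K where K: "\<And>x. x \<in> vecs V \<Longrightarrow> \<bar>f x\<bar> \<le> K * nrm V x"
    using f by (auto simp: dual_def)
  show ?thesis
  proof (cases "x = 0")
    case True
    then show ?thesis using lin_on_0[OF dual_lin[OF f] subspace_vecs] by simp
  next
    case False
    then have pos: "nrm V x > 0"
      using nrm_nonneg[OF x] nrm_eq_0_iff[OF x] by simp
    let ?y = "(1 / nrm V x) *\<^sub>R x"
    have y: "?y \<in> vecs V" "nrm V ?y \<le> 1"
      using x pos by (auto simp: scaleR_mem nrm_scaleR)
    have "bdd_above ((\<lambda>x. \<bar>f x\<bar>) ` {x \<in> vecs V. nrm V x \<le> 1})"
    proof (rule bdd_aboveI2)
      fix z assume z: "z \<in> {x \<in> vecs V. nrm V x \<le> 1}"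
      have "\<bar>f z\<bar> \<le> K * nrm V z" using K z by blast
      also have "\<dots> \<le> \<bar>K\<bar> * 1" using z nrm_nonneg by (intro mult_mono) auto
      finally show "\<bar>f z\<bar> \<le> \<bar>K\<bar>" by simp
    qed
    then have "\<bar>f ?y\<bar> \<le> nrm (dual V) f"
      unfolding dual_def using y by (auto intro!: cSUP_upper)
    moreover have "f ?y = f x / nrm V x"
      using lin_on_scaleR[OF dual_lin[OF f] x] by simp
    ultimately show ?thesis using pos by (simp add: field_simps)
  qed
qed

lemma dual_nrm_le:
  assumes "\<And>x. x \<in> vecs V \<Longrightarrow> \<bar>f x\<bar> \<le> K * nrm V x" "K \<ge> 0"
  shows "nrm (dual V) f \<le> K"
proof -
  have "\<bar>f x\<bar> \<le> K" if "x \<in> vecs V" "nrm V x \<le> 1" for x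
    using assms(1)[OF that(1)] mult_left_mono[OF that(2) assms(2)] by simp
  then show ?thesis
    unfolding dual_def using zero_mem by (auto intro!: cSUP_least)
qed

lemma normed_space_dual: "normed_space (dual V)"
proof
  note lin = dual_lin and bound = dual_bound
  show sub: "subspace (vecs (dual V))"
  proof (rule subspaceI)
    show "0 \<in> vecs (dual V)"
      by (rule dual_memI[of _ 0]) (auto simp: lin_on_def)
    fix f g assume f: "f \<in> vecs (dual V)" and g: "g \<in> vecs (dual V)"
    show "f + g \<in> vecs (dual V)"
    proof (rule dual_memI)
      show "lin_on (vecs V) (f + g)"
        using lin[OF f] lin[OF g] by (auto simp: lin_on_def algebra_simps)
      show "\<bar>(f + g) x\<bar> \<le> (nrm (dual V) f + nrm (dual V) g) * nrm V x" if "x \<in> vecs V" for x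
        using bound[OF f that] bound[OF g that] by (simp add: algebra_simps)
      show "(f + g) x = 0" if "x \<notin> vecs V" for x
        using that by (simp add: dual_off[OF f] dual_off[OF g])
    qed
  next
    fix c f assume f: "f \<in> vecs (dual V)"
    show "c *\<^sub>R f \<in> vecs (dual V)"
    proof (rule dual_memI)
      show "lin_on (vecs V) (c *\<^sub>R f)"
        using lin[OF f] by (auto simp: lin_on_def scaleR_fun_def algebra_simps)
      show "\<bar>(c *\<^sub>R f) x\<bar> \<le> (\<bar>c\<bar> * nrm (dual V) f) * nrm V x" if "x \<in> vecs V" for x
        using mult_left_mono[OF bound[OF f that], of "\<bar>c\<bar>"]
        by (simp add: scaleR_fun_def abs_mult algebra_simps)
      show "(c *\<^sub>R f) x = 0" if "x \<notin> vecs V" for x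
        using that dual_off f by (simp add: scaleR_fun_def)
    qed
  qed
  have nonneg: "0 \<le> nrm (dual V) f" if f: "f \<in> vecs (dual V)" for f
  proof (cases "\<exists>x\<in>vecs V. nrm V x \<noteq> 0")
    case True
    then obtain x where x: "x \<in> vecs V" "nrm V x > 0"
      using nrm_nonneg by (metis order_le_less)
    then have "0 \<le> nrm (dual V) f * nrm V x" using bound[OF f x(1)] by simp
    with x(2) show ?thesis by (simp add: zero_le_mult_iff)
  next
    case False
    then have "\<bar>f x\<bar> = 0" if "x \<in> vecs V" for x using bound[OF f that] that by simp
    then have "(\<lambda>x. \<bar>f x\<bar>) ` {x \<in> vecs V. nrm V x \<le> 1} = {0}"
      using zero_mem by (force simp: image_def)
    then show ?thesis by (simp add: dual_def)
  qed
  show "nrm (dual V) f = 0 \<longleftrightarrow> f = 0" if f: "f \<in> vecs (dual V)" for f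
  proof
    assume "nrm (dual V) f = 0"
    then show "f = 0"
      using bound[OF f] dual_off[OF f] by (force simp: fun_eq_iff)
  next
    assume "f = 0"
    then show "nrm (dual V) f = 0"
      using dual_nrm_le[of 0 0] nonneg[OF f] by simp
  qed
  show "nrm (dual V) (f + g) \<le> nrm (dual V) f + nrm (dual V) g"
    if f: "f \<in> vecs (dual V)" and g: "g \<in> vecs (dual V)" for f g
  proof (rule dual_nrm_le)
    show "\<bar>(f + g) x\<bar> \<le> (nrm (dual V) f + nrm (dual V) g) * nrm V x" if "x \<in> vecs V" for x
      using bound[OF f that] bound[OF g that] by (simp add: algebra_simps)
  qed (use nonneg f g in auto)
  have scale: "nrm (dual V) (c *\<^sub>R f) \<le> \<bar>c\<bar> * nrm (dual V) f" if f: "f \<in> vecs (dual V)" for c f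
  proof (rule dual_nrm_le)
    show "\<bar>(c *\<^sub>R f) x\<bar> \<le> (\<bar>c\<bar> * nrm (dual V) f) * nrm V x" if "x \<in> vecs V" for x
      using mult_left_mono[OF bound[OF f that], of "\<bar>c\<bar>"]
      by (simp add: scaleR_fun_def abs_mult algebra_simps)
  qed (use nonneg f in auto)
  show "nrm (dual V) (c *\<^sub>R f) = \<bar>c\<bar> * nrm (dual V) f" if f: "f \<in> vecs (dual V)" for c f
  proof (cases "c = 0")
    case True
    then show ?thesis using dual_nrm_le[of 0 0] nonneg[OF subspace_0[OF sub]] by simp
  next
    case False
    have "nrm (dual V) ((1 / c) *\<^sub>R (c *\<^sub>R f)) \<le> \<bar>1 / c\<bar> * nrm (dual V) (c *\<^sub>R f)"
      using f by (intro scale subspace_scale[OF sub])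
    then have "\<bar>c\<bar> * nrm (dual V) f \<le> nrm (dual V) (c *\<^sub>R f)"
      using False by (simp add: field_simps)
    with scale[OF f, of c] show ?thesis by simp
  qed
qed

lemma norming_functional:
  assumes x: "x \<in> vecs V"
  shows "\<exists>f\<in>vecs (dual V). (\<forall>y\<in>vecs V. \<bar>f y\<bar> \<le> nrm V y) \<and> f x = nrm V x"
proof -
  have "sublinear_on (vecs V) (nrm V)"
    using nrm_triangle nrm_scaleR by (auto simp: sublinear_on_def)
  from hahn_banach_sublinear[OF this subspace_vecs x]
  obtain f where f: "lin_on (vecs V) f" "\<And>y. y \<in> vecs V \<Longrightarrow> f y \<le> nrm V y" "f x = nrm V x"
    by blast
  define g where "g y = (if y \<in> vecs V then f y else 0)" for y
  have "\<bar>f y\<bar> \<le> nrm V y" if "y \<in> vecs V" for y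
    using f(2)[OF that] f(2)[of "- y"] that subspace_neg[OF subspace_vecs that]
      nrm_minus[OF that] lin_on_minus[OF f(1) that] by simp
  moreover have "g \<in> vecs (dual V)"
    using f(1) add_mem scaleR_mem calculation
    by (intro dual_memI[of _ 1]) (auto simp: g_def lin_on_def)
  ultimately show ?thesis
    using x f(3) by (intro bexI[of _ g]) (auto simp: g_def)
qed

end

section \<open>Nonreflexivity and weak-star limits of points\<close>

lemma (in normed_space) mcomplete_iff:
  "Metric_space.mcomplete (vecs V) (ndist V) \<longleftrightarrow>
    (\<forall>\<sigma> :: nat \<Rightarrow> 'a. (\<forall>n. \<sigma> n \<in> vecs V) \<and> (\<forall>e>0. \<exists>N. \<forall>m\<ge>N. \<forall>n\<ge>N. nrm V (\<sigma> m - \<sigma> n) < e) \<longrightarrow>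
      (\<exists>x\<in>vecs V. \<forall>e>0. \<exists>N. \<forall>n\<ge>N. nrm V (\<sigma> n - x) < e))"
proof -
  interpret M: Metric_space "vecs V" "ndist V" by (rule Metric_space_ndist)
  have 1: "M.MCauchy \<sigma> \<longleftrightarrow>
      (\<forall>n. \<sigma> n \<in> vecs V) \<and> (\<forall>e>0. \<exists>N. \<forall>m\<ge>N. \<forall>n\<ge>N. nrm V (\<sigma> m - \<sigma> n) < e)" for \<sigma>
    unfolding M.MCauchy_def by (auto simp: ndist_def image_subset_iff)
  have 2: "limitin M.mtopology \<sigma> x sequentially \<longleftrightarrow>
      x \<in> vecs V \<and> (\<forall>e>0. \<exists>N. \<forall>n\<ge>N. nrm V (\<sigma> n - x) < e)" if "\<forall>n. \<sigma> n \<in> vecs V" for \<sigma> x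
    unfolding M.limit_metric_sequentially using that by (auto simp: ndist_def)
  have 3: "(\<exists>x. limitin M.mtopology \<sigma> x sequentially) \<longleftrightarrow>
      (\<exists>x\<in>vecs V. \<forall>e>0. \<exists>N. \<forall>n\<ge>N. nrm V (\<sigma> n - x) < e)" if "\<forall>n. \<sigma> n \<in> vecs V" for \<sigma>
    using 2[OF that] by auto
  show ?thesis
    unfolding M.mcomplete_def 1 Bex_def
    by (rule iff_allI, rule imp_cong[OF refl]) (simp add: 2)
qed

lemma (in normed_space) separable_iff:
  "separable V \<longleftrightarrow> (\<exists>Q. countable Q \<and> Q \<subseteq> vecs V \<and> (\<forall>x\<in>vecs V. \<forall>e>0. \<exists>q\<in>Q. nrm V (x - q) < e))"
proof -
  interpret M: Metric_space "vecs V" "ndist V" by (rule Metric_space_ndist)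
  have "M.mtopology closure_of Q = vecs V \<longleftrightarrow> (\<forall>x\<in>vecs V. \<forall>e>0. \<exists>q\<in>Q. nrm V (x - q) < e)"
    if "Q \<subseteq> vecs V" for Q
  proof -
    have "(\<exists>q\<in>Q. q \<in> M.mball x e) \<longleftrightarrow> (\<exists>q\<in>Q. nrm V (x - q) < e)" if "x \<in> vecs V" for x e
      using that \<open>Q \<subseteq> vecs V\<close> by (intro bex_cong refl) (auto simp: M.in_mball ndist_def)
    then have "M.mtopology closure_of Q = {x \<in> vecs V. \<forall>e>0. \<exists>q\<in>Q. nrm V (x - q) < e}"
      unfolding M.metric_closure_of by (intro Collect_cong conj_cong refl) simp
    then show ?thesis unfolding set_eq_iff mem_Collect_eq by metis
  qed
  then show ?thesis
    unfolding separable_def separable_space_def M.topspace_mtopology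
    by (intro ex_cong1 conj_cong refl) simp
qed

lemma (in normed_space) mcomplete_dual:
  "Metric_space.mcomplete (vecs (dual V)) (ndist (dual V))"
proof -
  interpret D: normed_space "dual V" by (rule normed_space_dual)
  show ?thesis
  proof (rule D.mcomplete_iff[THEN iffD2], intro allI impI, elim conjE)
    fix \<sigma> :: "nat \<Rightarrow> 'a \<Rightarrow> real"
    assume \<sigma>: "\<forall>n. \<sigma> n \<in> vecs (dual V)"
      and C: "\<forall>e>0. \<exists>N. \<forall>m\<ge>N. \<forall>n\<ge>N. nrm (dual V) (\<sigma> m - \<sigma> n) < e"
    have ptw: "\<bar>\<sigma> m x - \<sigma> n x\<bar> \<le> nrm (dual V) (\<sigma> m - \<sigma> n) * nrm V x" if "x \<in> vecs V" for m n x
      using dual_bound[OF D.diff_mem that, of "\<sigma> m" "\<sigma> n"] \<sigma> by simp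
    have conv: "convergent (\<lambda>n. \<sigma> n x)" for x
    proof (cases "x \<in> vecs V")
      case True
      have "Cauchy (\<lambda>n. \<sigma> n x)"
      proof (rule metric_CauchyI)
        fix e :: real assume e: "e > 0"
        define k where "k = nrm V x + 1"
        have k: "k > 0" "nrm V x \<le> k" using nrm_nonneg[OF True] by (auto simp: k_def)
        then obtain N where N: "\<And>m n. m \<ge> N \<Longrightarrow> n \<ge> N \<Longrightarrow> nrm (dual V) (\<sigma> m - \<sigma> n) < e / k"
          using C e by (metis divide_pos_pos)
        have "dist (\<sigma> m x) (\<sigma> n x) < e" if "m \<ge> N" "n \<ge> N" for m n
        proof -
          have "\<bar>\<sigma> m x - \<sigma> n x\<bar> \<le> nrm (dual V) (\<sigma> m - \<sigma> n) * k"
            using ptw[OF True, of m n] k \<sigma> D.nrm_nonneg[OF D.diff_mem]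
            by (meson mult_left_mono order_trans)
          also have "\<dots> < e" using N[OF that] k by (simp add: field_simps)
          finally show ?thesis by (simp add: dist_real_def)
        qed
        then show "\<exists>M. \<forall>m\<ge>M. \<forall>n\<ge>M. dist (\<sigma> m x) (\<sigma> n x) < e" by blast
      qed
      then show ?thesis by (simp add: Cauchy_convergent_iff)
    next
      case False
      then have "(\<lambda>n. \<sigma> n x) = (\<lambda>n. 0)" using \<sigma> dual_off by blast
      then show ?thesis by (simp add: convergent_const)
    qed
    define g where "g x = lim (\<lambda>n. \<sigma> n x)" for x
    have g: "(\<lambda>n. \<sigma> n x) \<longlonglongrightarrow> g x" for x
      using conv[of x] by (simp add: g_def convergent_LIMSEQ_iff)
    have close: "\<bar>(\<sigma> m - g) x\<bar> \<le> e * nrm V x"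
      if N: "\<forall>m\<ge>N. \<forall>n\<ge>N. nrm (dual V) (\<sigma> m - \<sigma> n) < e" and m: "m \<ge> N" and x: "x \<in> vecs V" for N m x e
    proof (rule tendsto_upperbound)
      show "(\<lambda>n. \<bar>\<sigma> m x - \<sigma> n x\<bar>) \<longlonglongrightarrow> \<bar>(\<sigma> m - g) x\<bar>"
        by (auto intro!: tendsto_intros g)
      have "\<bar>\<sigma> m x - \<sigma> n x\<bar> \<le> e * nrm V x" if "n \<ge> N" for n
      proof -
        have "nrm (dual V) (\<sigma> m - \<sigma> n) \<le> e" using N m that by (simp add: less_imp_le)
        then show ?thesis
          using ptw[OF x, of m n] nrm_nonneg[OF x] by (meson mult_right_mono order_trans)
      qed
      then show "eventually (\<lambda>n. \<bar>\<sigma> m x - \<sigma> n x\<bar> \<le> e * nrm V x) sequentially"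
        by (auto simp: eventually_sequentially)
    qed simp
    have glin: "lin_on (vecs V) g"
      unfolding lin_on_def
    proof (intro conjI ballI allI)
      fix x y assume xy: "x \<in> vecs V" "y \<in> vecs V"
      have "(\<lambda>n. \<sigma> n x + \<sigma> n y) \<longlonglongrightarrow> g x + g y" by (intro tendsto_intros g)
      moreover have "\<sigma> n x + \<sigma> n y = \<sigma> n (x + y)" for n
        using lin_on_add[OF dual_lin xy] \<sigma> by simp
      ultimately have "(\<lambda>n. \<sigma> n (x + y)) \<longlonglongrightarrow> g x + g y" by simp
      then show "g (x + y) = g x + g y" by (rule LIMSEQ_unique[OF g])
    next
      fix c x assume x: "x \<in> vecs V"
      have "(\<lambda>n. c *\<^sub>R \<sigma> n x) \<longlonglongrightarrow> c *\<^sub>R g x" by (intro tendsto_intros g)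
      moreover have "c *\<^sub>R \<sigma> n x = \<sigma> n (c *\<^sub>R x)" for n
        using lin_on_scaleR[OF dual_lin x] \<sigma> by simp
      ultimately have "(\<lambda>n. \<sigma> n (c *\<^sub>R x)) \<longlonglongrightarrow> c *\<^sub>R g x" by simp
      then show "g (c *\<^sub>R x) = c *\<^sub>R g x" by (rule LIMSEQ_unique[OF g])
    qed
    have goff: "g x = 0" if "x \<notin> vecs V" for x
    proof -
      have "(\<lambda>n. \<sigma> n x) = (\<lambda>n. 0)" using \<sigma> dual_off that by blast
      then show ?thesis using g[of x] by (simp add: LIMSEQ_const_iff)
    qed
    obtain N1 where N1: "\<forall>m\<ge>N1. \<forall>n\<ge>N1. nrm (dual V) (\<sigma> m - \<sigma> n) < 1"
      using C zero_less_one by blast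
    have gmem: "g \<in> vecs (dual V)"
    proof (rule dual_memI[OF glin _ goff])
      fix x assume x: "x \<in> vecs V"
      have "\<bar>\<sigma> N1 x - g x\<bar> \<le> 1 * nrm V x" using close[OF N1 order_refl x] by simp
      moreover have "\<bar>\<sigma> N1 x\<bar> \<le> nrm (dual V) (\<sigma> N1) * nrm V x" using dual_bound[OF _ x] \<sigma> by blast
      ultimately show "\<bar>g x\<bar> \<le> (nrm (dual V) (\<sigma> N1) + 1) * nrm V x"
        by (simp add: algebra_simps abs_le_iff)
    qed
    show "\<exists>x\<in>vecs (dual V). \<forall>e>0. \<exists>N. \<forall>n\<ge>N. nrm (dual V) (\<sigma> n - x) < e"
    proof (intro bexI[OF _ gmem] allI impI)
      fix e :: real assume e: "e > 0"
      then obtain N where N: "\<forall>m\<ge>N. \<forall>n\<ge>N. nrm (dual V) (\<sigma> m - \<sigma> n) < e / 2"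
        using C half_gt_zero by blast
      have "nrm (dual V) (\<sigma> n - g) \<le> e / 2" if "n \<ge> N" for n
        using close[OF N that] e by (intro dual_nrm_le) auto
      then have "\<forall>n\<ge>N. nrm (dual V) (\<sigma> n - g) < e" using e by force
      then show "\<exists>N. \<forall>n\<ge>N. nrm (dual V) (\<sigma> n - g) < e" by blast
    qed
  qed
qed

context normed_space
begin

lemma dual_nrm_le_1_bound:
  "f \<in> vecs (dual V) \<Longrightarrow> nrm (dual V) f \<le> 1 \<Longrightarrow> x \<in> vecs V \<Longrightarrow> \<bar>f x\<bar> \<le> nrm V x"
  using dual_bound[of f x] mult_right_mono[of "nrm (dual V) f" 1 "nrm V x"] nrm_nonneg[of x] by simp

lemma canonical_embedding_mem:
  assumes x: "x \<in> vecs V"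
  shows "canonical_embedding V x \<in> vecs (dual (dual V))"
proof -
  interpret D: normed_space "dual V" by (rule normed_space_dual)
  show ?thesis
    using D.add_mem D.scaleR_mem dual_bound[OF _ x]
    by (intro D.dual_memI[of _ "nrm V x"])
      (auto simp: canonical_embedding_def lin_on_def scaleR_fun_def mult.commute)
qed

text \<open>
  If \<open>F\<close> could be approximated by points of the space, uniformly on the dual ball, then these
  points would form a Cauchy sequence, and \<open>F\<close> would be the evaluation at its limit.
\<close>

lemma nonreflexive_gap:
  assumes compl: "Metric_space.mcomplete (vecs V) (ndist V)" and nr: "\<not> reflexive V"
  shows "\<exists>F\<in>vecs (dual (dual V)). \<exists>d>0. \<forall>x\<in>vecs V. \<exists>f\<in>vecs (dual V).
    nrm (dual V) f \<le> 1 \<and> f x + d < F f"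
proof -
  interpret D: normed_space "dual V" by (rule normed_space_dual)
  obtain F where F: "F \<in> vecs (dual (dual V))" and nF: "F \<notin> canonical_embedding V ` vecs V"
    using nr canonical_embedding_mem unfolding reflexive_def by blast
  note Flin = D.dual_lin[OF F]
  have "\<exists>d>0. \<forall>x\<in>vecs V. \<exists>f\<in>vecs (dual V). nrm (dual V) f \<le> 1 \<and> f x + d < F f"
  proof (rule ccontr)
    assume neg: "\<not> ?thesis"
    have "\<exists>x\<in>vecs V. \<forall>f\<in>vecs (dual V). nrm (dual V) f \<le> 1 \<longrightarrow> F f \<le> f x + inverse (Suc n)" for n
    proof (rule ccontr)
      assume "\<not> ?thesis"
      then have "\<forall>x\<in>vecs V. \<exists>f\<in>vecs (dual V). nrm (dual V) f \<le> 1 \<and> f x + inverse (Suc n) < F f"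
        by (simp add: not_le)
      moreover have "inverse (real (Suc n)) > 0" by simp
      ultimately show False using neg by blast
    qed
    then obtain x where x: "\<And>n. x n \<in> vecs V"
      and xF: "\<And>n f. f \<in> vecs (dual V) \<Longrightarrow> nrm (dual V) f \<le> 1 \<Longrightarrow> F f \<le> f (x n) + inverse (Suc n)"
      by metis
    have xabs: "\<bar>F f - f (x n)\<bar> \<le> inverse (Suc n)" if f: "f \<in> vecs (dual V)" "nrm (dual V) f \<le> 1" for f n
    proof -
      have "- f \<in> vecs (dual V)" "nrm (dual V) (- f) \<le> 1"
        using f D.nrm_minus subspace_neg[OF D.subspace_vecs] by auto
      from xF[OF this, of n] xF[OF f, of n] show ?thesis
        using lin_on_minus[OF Flin f(1)] by simp
    qed
    have diff: "nrm V (x m - x n) \<le> inverse (Suc m) + inverse (Suc n)" for m n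
    proof -
      obtain f where f: "f \<in> vecs (dual V)" "\<And>y. y \<in> vecs V \<Longrightarrow> \<bar>f y\<bar> \<le> nrm V y"
        "f (x m - x n) = nrm V (x m - x n)"
        using norming_functional[OF diff_mem[OF x x]] by blast
      have n1: "nrm (dual V) f \<le> 1" using f(2) by (intro dual_nrm_le) auto
      have "f (x m - x n) = f (x m) - f (x n)"
        using lin_on_diff[OF dual_lin[OF f(1)] subspace_vecs x x] .
      then show ?thesis
        using xabs[OF f(1) n1, of m] xabs[OF f(1) n1, of n] f(3) by simp
    qed
    have "\<exists>N. \<forall>m\<ge>N. \<forall>n\<ge>N. nrm V (x m - x n) < e" if "e > 0" for e
    proof -
      obtain N where N: "inverse (real (Suc N)) < e / 2"
        using reals_Archimedean[of "e / 2"] \<open>e > 0\<close> by auto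
      have "nrm V (x m - x n) < e" if "m \<ge> N" "n \<ge> N" for m n
      proof -
        have "inverse (real (Suc m)) \<le> inverse (Suc N)" "inverse (real (Suc n)) \<le> inverse (Suc N)"
          using that by (auto intro!: le_imp_inverse_le)
        with diff[of m n] N show ?thesis by linarith
      qed
      then show ?thesis by blast
    qed
    then obtain y where y: "y \<in> vecs V" "\<forall>e>0. \<exists>N. \<forall>n\<ge>N. nrm V (x n - y) < e"
      using compl x unfolding mcomplete_iff by blast
    have ylim: "(\<lambda>n. nrm V (x n - y)) \<longlonglongrightarrow> 0"
      unfolding LIMSEQ_iff using y(2) nrm_nonneg[OF diff_mem[OF x y(1)]] by simp
    have "F f = f y" if f: "f \<in> vecs (dual V)" "nrm (dual V) f \<le> 1" for f
    proof -
      have "\<bar>F f - f y\<bar> \<le> inverse (Suc n) + nrm V (x n - y)" for n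
        using xabs[OF f, of n] dual_nrm_le_1_bound[OF f diff_mem[OF x y(1)], of n]
          lin_on_diff[OF dual_lin[OF f(1)] subspace_vecs x y(1), of n] by linarith
      moreover have "(\<lambda>n. inverse (real (Suc n)) + nrm V (x n - y)) \<longlonglongrightarrow> 0 + 0"
        by (intro tendsto_intros ylim LIMSEQ_inverse_real_of_nat)
      ultimately have "\<bar>F f - f y\<bar> \<le> 0"
        by (intro tendsto_lowerbound[of _ "0 + 0 :: real", simplified]) auto
      then show ?thesis by simp
    qed
    note ball = this
    have "F f = f y" if f: "f \<in> vecs (dual V)" for f
    proof (cases "nrm (dual V) f \<le> 1")
      case False
      let ?c = "1 / nrm (dual V) f"
      have "?c *\<^sub>R f \<in> vecs (dual V)" "nrm (dual V) (?c *\<^sub>R f) \<le> 1"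
        using False f D.scaleR_mem D.nrm_scaleR[OF f, of ?c] by auto
      from ball[OF this] show ?thesis
        using lin_on_scaleR[OF Flin f, of ?c] False by (simp add: scaleR_fun_def)
    qed (use f ball in blast)
    then have "F = canonical_embedding V y"
      using D.dual_off[OF F] by (auto simp: canonical_embedding_def fun_eq_iff)
    with nF y show False by blast
  qed
  with F show ?thesis by blast
qed

text \<open>
  Here the usual separation argument in a finite-dimensional space is an application of the Hahn--Banach
  theorem to the seminorm \<open>p u\<close>, the infimum over \<open>w\<close> of \<open>\<parallel>w\<parallel> + M * \<Sum>\<^sub>f \<bar>u\<^sub>f - f w\<bar>\<close>, on families
  \<open>u\<close> of reals. A linear functional below \<open>p\<close> that agrees with \<open>p\<close> at the family \<open>v\<close> of the values
  \<open>F f\<close> is a combination \<open>h\<close> of the functionals in \<open>A\<close> with norm at most 1. So \<open>p v = F h \<le> \<parallel>F\<parallel>\<close>,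
  and any \<open>w\<close> that nearly attains the infimum is as required if \<open>M\<close> is large.
\<close>

lemma helly:
  assumes F: "F \<in> vecs (dual (dual V))" and A: "finite A" "A \<subseteq> vecs (dual V)" and e: "e > 0"
  shows "\<exists>w\<in>vecs V. nrm V w \<le> nrm (dual (dual V)) F + 1 \<and> (\<forall>f\<in>A. \<bar>f w - F f\<bar> < e)"
proof -
  interpret D: normed_space "dual V" by (rule normed_space_dual)
  interpret DD: normed_space "dual (dual V)" by (rule D.normed_space_dual)
  define M where "M = (nrm (dual (dual V)) F + 2) / e"
  have Mpos: "M > 0" using DD.nrm_nonneg[OF F] e by (simp add: M_def)
  define cost where "cost u w = nrm V w + M * (\<Sum>f\<in>A. \<bar>u f - f w\<bar>)" for u w
  define p where "p u = (INF w\<in>vecs V. cost u w)" for u :: "('a \<Rightarrow> real) \<Rightarrow> real"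
  have cost_nonneg: "0 \<le> cost u w" if "w \<in> vecs V" for u w
    using nrm_nonneg[OF that] Mpos by (auto simp: cost_def intro!: add_nonneg_nonneg mult_nonneg_nonneg sum_nonneg)
  have p_le: "p u \<le> cost u w" if "w \<in> vecs V" for u w
    unfolding p_def by (rule cINF_lower[OF bdd_belowI2[of _ 0] that]) (rule cost_nonneg)
  have p_ge: "m \<le> p u" if "\<And>w. w \<in> vecs V \<Longrightarrow> m \<le> cost u w" for m u
    unfolding p_def using zero_mem that by (intro cINF_greatest) auto
  have cost_add: "cost (u + u') (w + w') \<le> cost u w + cost u' w'"
    if "w \<in> vecs V" "w' \<in> vecs V" for u u' w w'
  proof -
    have "(\<Sum>f\<in>A. \<bar>(u + u') f - f (w + w')\<bar>) \<le> (\<Sum>f\<in>A. \<bar>u f - f w\<bar> + \<bar>u' f - f w'\<bar>)"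
      using A lin_on_add[OF dual_lin that] by (intro sum_mono) force
    then show ?thesis
      using nrm_triangle[OF that] mult_left_mono[of _ _ M] Mpos
      by (fastforce simp: cost_def sum.distrib algebra_simps)
  qed
  have cost_scale: "cost (c *\<^sub>R u) (c *\<^sub>R w) = c * cost u w" if "w \<in> vecs V" "c \<ge> 0" for c u w
  proof -
    have "(\<Sum>f\<in>A. \<bar>(c *\<^sub>R u) f - f (c *\<^sub>R w)\<bar>) = (\<Sum>f\<in>A. c * \<bar>u f - f w\<bar>)"
    proof (rule sum.cong)
      fix f assume "f \<in> A"
      then have "f (c *\<^sub>R w) = c * f w"
        using A lin_on_scaleR[OF dual_lin that(1)] by auto
      then show "\<bar>(c *\<^sub>R u) f - f (c *\<^sub>R w)\<bar> = c * \<bar>u f - f w\<bar>"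
        using that(2) by (simp add: scaleR_fun_def abs_mult flip: right_diff_distrib)
    qed simp
    then show ?thesis
      using that nrm_scaleR[OF that(1), of c] by (simp add: cost_def algebra_simps flip: sum_distrib_left)
  qed
  have p_add: "p (u + u') \<le> p u + p u'" for u u'
  proof -
    have "p (u + u') - cost u w \<le> p u'" if "w \<in> vecs V" for w
      using p_le[OF add_mem] cost_add that by (intro p_ge) (smt (verit))
    then have "p (u + u') - p u' \<le> p u"
      by (intro p_ge) (simp add: algebra_simps)
    then show ?thesis by simp
  qed
  have p_half: "c * p u \<le> p (c *\<^sub>R u)" if "c > 0" for c u
  proof (rule p_ge)
    fix w assume w: "w \<in> vecs V"
    have "c * p u \<le> c * cost u ((1 / c) *\<^sub>R w)"
      using that w by (intro mult_left_mono p_le scaleR_mem) auto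
    also have "\<dots> = cost (c *\<^sub>R u) w"
      using cost_scale[OF scaleR_mem[OF w], of c u "1 / c"] that by simp
    finally show "c * p u \<le> cost (c *\<^sub>R u) w" .
  qed
  have p_scale: "p (c *\<^sub>R u) = c * p u" if "c \<ge> 0" for c u
  proof (cases "c = 0")
    case True
    have "cost 0 0 = 0"
      using A lin_on_0[OF dual_lin subspace_vecs] by (auto simp: cost_def intro!: sum.neutral)
    then have "p 0 = 0"
      using p_le[OF zero_mem, of 0] p_ge[of 0 0] cost_nonneg by force
    then show ?thesis using True by simp
  next
    case False
    with that have c: "c > 0" by simp
    have "(1 / c) * p (c *\<^sub>R u) \<le> p ((1 / c) *\<^sub>R (c *\<^sub>R u))" using c by (intro p_half) simp
    then have "p (c *\<^sub>R u) \<le> c * p u" using c by (simp add: field_simps)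
    with p_half[OF c, of u] show ?thesis by simp
  qed
  have psub: "sublinear_on UNIV p" using p_add p_scale by (simp add: sublinear_on_def)
  define v where "v f = (if f \<in> A then F f else 0)" for f
  define e1 where "e1 f = (\<lambda>g. if g = f then 1 else 0 :: real)" for f :: "'a \<Rightarrow> real"
  from hahn_banach_sublinear[OF psub subspace_UNIV UNIV_I, of v]
  obtain g where g: "lin_on UNIV g" "\<And>u. g u \<le> p u" "g v = p v" by auto
  have expand: "g u = (\<Sum>f\<in>A. u f * g (e1 f))" if "\<And>f. f \<notin> A \<Longrightarrow> u f = 0" for u
  proof -
    have "u = (\<Sum>f\<in>A. u f *\<^sub>R e1 f)"
    proof
      fix h
      have "(\<Sum>f\<in>A. u f *\<^sub>R e1 f) h = (\<Sum>f\<in>A. u f * e1 f h)"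
        using A(1) by (induction A rule: finite_induct) (auto simp: scaleR_fun_def)
      also have "\<dots> = (\<Sum>f\<in>A. if h = f then u f else 0)"
        by (rule sum.cong) (auto simp: e1_def)
      also have "\<dots> = u h" using A(1) that by (simp add: sum.delta)
      finally show "u h = (\<Sum>f\<in>A. u f *\<^sub>R e1 f) h" by simp
    qed
    then have "g u = g (\<Sum>f\<in>A. u f *\<^sub>R e1 f)" by simp
    also have "\<dots> = (\<Sum>f\<in>A. g (u f *\<^sub>R e1 f))"
      by (rule lin_on_sum[OF g(1)]) auto
    finally show ?thesis using lin_on_scaleR[OF g(1)] by simp
  qed
  define h where "h = (\<Sum>f\<in>A. g (e1 f) *\<^sub>R f)"
  have happ: "h w = (\<Sum>f\<in>A. f w * g (e1 f))" for w
    unfolding h_def using A(1) by (induction A rule: finite_induct) (auto simp: scaleR_fun_def)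
  have hmem: "h \<in> vecs (dual V)"
    unfolding h_def using A(2) by (intro D.sum_mem D.scaleR_mem) auto
  have hle: "h w \<le> nrm V w" if w: "w \<in> vecs V" for w
  proof -
    define u where "u f = (if f \<in> A then f w else 0)" for f
    have "h w = (\<Sum>f\<in>A. u f * g (e1 f))" by (simp add: happ u_def)
    also have "\<dots> = g u" by (rule expand[symmetric]) (simp add: u_def)
    also have "\<dots> \<le> cost u w" using g(2) p_le[OF w] by (rule order_trans)
    also have "\<dots> = nrm V w" by (simp add: cost_def u_def)
    finally show ?thesis .
  qed
  have "\<bar>h w\<bar> \<le> nrm V w" if w: "w \<in> vecs V" for w
    using hle[OF w] hle[of "- w"] nrm_minus[OF w] subspace_neg[OF subspace_vecs w]
      lin_on_minus[OF dual_lin[OF hmem] w] by simp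
  then have "nrm (dual V) h \<le> 1" by (intro dual_nrm_le) auto
  then have "\<bar>F h\<bar> \<le> nrm (dual (dual V)) F"
    using D.dual_bound[OF F hmem] mult_left_mono[of "nrm (dual V) h" 1] DD.nrm_nonneg[OF F] by fastforce
  moreover have "F h = p v"
  proof -
    have "F h = (\<Sum>f\<in>A. F (g (e1 f) *\<^sub>R f))"
      unfolding h_def using A(2)
      by (intro lin_on_sum[OF D.dual_lin[OF F] D.subspace_vecs] D.scaleR_mem) auto
    also have "\<dots> = (\<Sum>f\<in>A. v f * g (e1 f))"
      using A(2) lin_on_scaleR[OF D.dual_lin[OF F]] by (intro sum.cong) (auto simp: v_def)
    also have "\<dots> = g v" by (rule expand[symmetric]) (simp add: v_def)
    finally show ?thesis using g(3) by simp
  qed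
  ultimately have "p v < nrm (dual (dual V)) F + 1" by simp
  then obtain w where w: "w \<in> vecs V" "cost v w < nrm (dual (dual V)) F + 1"
    using p_ge[of "nrm (dual (dual V)) F + 1" v] by (meson not_less)
  have s: "0 \<le> (\<Sum>f\<in>A. \<bar>v f - f w\<bar>)" by (intro sum_nonneg) auto
  have "nrm V w \<le> nrm (dual (dual V)) F + 1"
    using w(2) s Mpos mult_nonneg_nonneg[of M] unfolding cost_def by (smt (verit))
  moreover have "\<bar>f w - F f\<bar> < e" if f: "f \<in> A" for f
  proof -
    have "\<bar>v f - f w\<bar> \<le> (\<Sum>f\<in>A. \<bar>v f - f w\<bar>)"
      by (rule member_le_sum[OF f _ A(1)]) auto
    then have "M * \<bar>v f - f w\<bar> \<le> M * (\<Sum>f\<in>A. \<bar>v f - f w\<bar>)"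
      using Mpos by simp
    also have "\<dots> < nrm (dual (dual V)) F + 2"
      using w nrm_nonneg[OF w(1)] by (simp add: cost_def)
    also have "\<dots> = M * e" using e by (simp add: M_def)
    finally have "\<bar>v f - f w\<bar> < e" using Mpos by simp
    then show ?thesis using f by (simp add: v_def abs_minus_commute)
  qed
  ultimately show ?thesis using w(1) by blast
qed

text \<open>
  Helly's lemma says that the sets of points of a ball that are close to \<open>F\<close> on finitely many
  functionals form a filter base; \<open>U\<close> is an ultrafilter that contains it.
\<close>

lemma nonreflexive_ultrafilter:
  assumes "Metric_space.mcomplete (vecs V) (ndist V)" "\<not> reflexive V"
  shows "\<exists>U C d. ultra U \<and> d > 0 \<and> eventually (\<lambda>w. w \<in> vecs V \<and> nrm V w \<le> C) U \<and>
    (\<forall>x\<in>vecs V. \<exists>f. lin_on (vecs V) f \<and> (\<forall>y\<in>vecs V. \<bar>f y\<bar> \<le> nrm V y) \<and>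
      eventually (\<lambda>w. f x + d < f w) U)"
proof -
  obtain F d where F: "F \<in> vecs (dual (dual V))" and d: "d > 0"
    and gap: "\<And>x. x \<in> vecs V \<Longrightarrow> \<exists>f\<in>vecs (dual V). nrm (dual V) f \<le> 1 \<and> f x + d < F f"
    using nonreflexive_gap[OF assms] by blast
  define C where "C = nrm (dual (dual V)) F + 1"
  define S where "S = (\<lambda>(A, e). {w \<in> vecs V. nrm V w \<le> C \<and> (\<forall>f\<in>A. \<bar>f w - F f\<bar> < e)})"
  define I where "I = {(A, e :: real). finite A \<and> A \<subseteq> vecs (dual V) \<and> e > 0}"
  define B where "B = (\<lambda>i. principal (S i)) ` I"
  have base: "eventually P (Inf B) \<longleftrightarrow> (\<exists>b\<in>B. eventually P b)" for P
  proof (rule eventually_Inf_base)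
    show "B \<noteq> {}" by (auto simp: B_def I_def intro!: exI[of _ 1] exI[of _ "{}"])
    fix G H assume "G \<in> B" "H \<in> B"
    then obtain A e A' e' where GH: "(A, e) \<in> I" "G = principal (S (A, e))"
      "(A', e') \<in> I" "H = principal (S (A', e'))" by (auto simp: B_def)
    have "(A \<union> A', min e e') \<in> I" using GH by (auto simp: I_def)
    moreover have "S (A \<union> A', min e e') \<subseteq> S (A, e) \<inter> S (A', e')" by (auto simp: S_def)
    ultimately show "\<exists>x\<in>B. x \<le> inf G H"
      using GH by (auto simp: B_def intro!: bexI[of _ "(A \<union> A', min e e')"])
  qed
  have "S i \<noteq> {}" if "i \<in> I" for i
    using that helly[OF F, of "fst i" "snd i"] by (force simp: I_def S_def C_def)
  then have "\<not> (\<exists>b\<in>B. eventually (\<lambda>_. False) b)"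
    by (auto simp: B_def eventually_principal)
  then have "Inf B \<noteq> bot"
    unfolding trivial_limit_def base .
  then obtain U where U: "U \<le> Inf B" "ultra U" using ultra_ex by blast
  have ev: "eventually (\<lambda>w. w \<in> S i) U" if "i \<in> I" for i
  proof (rule filter_leD[OF U(1)])
    have "eventually (\<lambda>w. w \<in> S i) (principal (S i))" by (simp add: eventually_principal)
    then show "eventually (\<lambda>w. w \<in> S i) (Inf B)" unfolding base using that by (auto simp: B_def)
  qed
  have "eventually (\<lambda>w. w \<in> vecs V \<and> nrm V w \<le> C) U"
    using ev[of "({}, 1)"] by (auto simp: I_def S_def)
  moreover have "\<exists>f. lin_on (vecs V) f \<and> (\<forall>y\<in>vecs V. \<bar>f y\<bar> \<le> nrm V y) \<and>
      eventually (\<lambda>w. f x + d < f w) U" if x: "x \<in> vecs V" for x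
  proof -
    obtain f where f: "f \<in> vecs (dual V)" "nrm (dual V) f \<le> 1" "f x + d < F f"
      using gap[OF x] by blast
    have "eventually (\<lambda>w. w \<in> S ({f}, F f - (f x + d))) U"
      using f by (intro ev) (auto simp: I_def)
    then have "eventually (\<lambda>w. f x + d < f w) U"
      by eventually_elim (auto simp: S_def)
    then show ?thesis
      using dual_lin[OF f(1)] dual_nrm_le_1_bound[OF f(1,2)] by blast
  qed
  ultimately show ?thesis using U(2) d by blast
qed

end

section \<open>Averages along an ultrafilter and order-preserving maps of the indices\<close>

text \<open>
  The place of the index \<open>i\<close> among the first \<open>n\<close> indices, when these are ordered by \<open>r\<close>.
\<close>

definition position :: "(nat \<Rightarrow> real) \<Rightarrow> nat \<Rightarrow> nat \<Rightarrow> nat"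
  where "position r n i = card {j. j < n \<and> r j < r i}"

lemma position_mono: "r i \<le> r j \<Longrightarrow> position r n i \<le> position r n j"
  unfolding position_def by (rule card_mono) auto

lemma position_strict: "i < n \<Longrightarrow> r i < r j \<Longrightarrow> position r n i < position r n j"
  unfolding position_def by (rule psubset_card_mono) auto

lemma position_less: "i < n \<Longrightarrow> position r n i < n"
proof -
  assume "i < n"
  then have "card {j. j < n \<and> r j < r i} < card {..<n}"
    by (intro psubset_card_mono) auto
  then show ?thesis by (simp add: position_def)
qed

lemma position_block: "i < n \<Longrightarrow> (position r n i + 1) * n \<le> n * n"
  using position_less[of i n r] by (intro mult_le_mono1) simp

definition block_avg :: "nat \<Rightarrow> 'a::real_vector list \<Rightarrow> nat \<Rightarrow> 'a"
  where "block_avg n ws h = (1 / real n) *\<^sub>R (\<Sum>p<n. ws ! (h * n + p))"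

text \<open>
  The gap condition says that no point of the space is a weak limit of \<open>U\<close>, with a uniform bound: a point
  that has already been chosen is separated by \<open>d\<close> from almost all points of \<open>U\<close> at once.
\<close>

locale gap_ultrafilter = normed_space V for V :: "'a::real_vector nspace" +
  fixes U :: "'a filter" and C d :: real
  assumes ultraU: "ultra U"
    and bounded: "eventually (\<lambda>w. w \<in> vecs V \<and> nrm V w \<le> C) U"
    and gap: "x \<in> vecs V \<Longrightarrow> \<exists>f. lin_on (vecs V) f \<and> (\<forall>y\<in>vecs V. \<bar>f y\<bar> \<le> nrm V y) \<and>
      eventually (\<lambda>w. f x + d < f w) U"
begin

lemma eventually_upow_bounded:
  "eventually (\<lambda>ws. length ws = M \<and> (\<forall>w\<in>set ws. w \<in> vecs V \<and> nrm V w \<le> C)) (upow U M)"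
  using bounded by (rule eventually_upow_all)

lemma nth_bounded:
  assumes "length ws = M" "\<forall>w\<in>set ws. w \<in> vecs V \<and> nrm V w \<le> C" "k < M"
  shows "ws ! k \<in> vecs V" "nrm V (ws ! k) \<le> C"
  using assms by auto

lemma block_index: "p < n \<Longrightarrow> (h + 1) * n \<le> M \<Longrightarrow> h * n + p < (M :: nat)"
  by simp

lemma block_avg_bounded:
  assumes ws: "length ws = M" "\<forall>w\<in>set ws. w \<in> vecs V \<and> nrm V w \<le> C"
    and n: "n > 0" "(h + 1) * n \<le> M"
  shows "block_avg n ws h \<in> vecs V" "nrm V (block_avg n ws h) \<le> C"
proof -
  note nth = nth_bounded[OF ws block_index[OF _ n(2)]]
  show "block_avg n ws h \<in> vecs V"
    unfolding block_avg_def using nth by (intro scaleR_mem sum_mem) auto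
  have "nrm V (\<Sum>p<n. 1 *\<^sub>R ws ! (h * n + p)) \<le> (\<Sum>p<n. \<bar>1\<bar>) * C"
    using nth by (intro nrm_sum_scaleR_le) auto
  then have "nrm V (\<Sum>p<n. ws ! (h * n + p)) \<le> n * C" by simp
  moreover have "(\<Sum>p<n. ws ! (h * n + p)) \<in> vecs V"
    using nth by (intro sum_mem) auto
  ultimately show "nrm V (block_avg n ws h) \<le> C"
    using n(1) by (simp add: block_avg_def nrm_scaleR field_simps)
qed

text \<open>
  The sliding argument. The hypothesis bounds the norm of a combination of entries at positions
  \<open>\<tau> i < K\<close>. For each shift \<open>p < n - K\<close> the entries at positions \<open>h i * n + \<tau> i + p\<close> have the same
  distribution, since \<open>h\<close> is monotone in \<open>\<tau>\<close>. In the average over the shifts, the \<open>i\<close>-th vector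
  becomes the average over block number \<open>h i\<close>, apart from \<open>K\<close> of the \<open>n\<close> entries of that block. So
  merging the vectors with the same \<open>h i\<close> costs no more than the error term \<open>\<Sum>\<bar>c\<^sub>i\<bar> * C * K / n\<close>.
\<close>

lemma eventually_upow_block_avg:
  fixes \<tau> h :: "'i \<Rightarrow> nat"
  assumes I: "finite I" "inj_on \<tau> I" and \<tau>: "\<tau> ` I \<subseteq> {..<K}"
    and h: "\<And>i j. i \<in> I \<Longrightarrow> j \<in> I \<Longrightarrow> \<tau> i < \<tau> j \<Longrightarrow> h i \<le> h j"
    and Kn: "K < n" and M: "\<And>i. i \<in> I \<Longrightarrow> (h i + 1) * n \<le> M"
    and ev: "eventually (\<lambda>ws. nrm V (\<Sum>i\<in>I. c i *\<^sub>R ws ! \<tau> i) < \<gamma>) (upow U K)"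
  shows "eventually (\<lambda>ws. nrm V (\<Sum>i\<in>I. c i *\<^sub>R block_avg n ws (h i)) <
    \<gamma> + (\<Sum>i\<in>I. \<bar>c i\<bar>) * C * K / n) (upow U M)"
proof -
  define \<sigma> where "\<sigma> p i = h i * n + \<tau> i + p" for p i
  have \<sigma>M: "\<sigma> p i < M" if "i \<in> I" "p < n - K" for p i
    using block_index[of "\<tau> i + p" n "h i" M] M[OF that(1)] that \<tau> by (auto simp: \<sigma>_def)
  have "eventually (\<lambda>ws. nrm V (\<Sum>i\<in>I. c i *\<^sub>R ws ! \<sigma> p i) < \<gamma>) (upow U M)" if p: "p < n - K" for p
  proof (rule eventually_upow_spread[OF ultraU I, where P = "\<lambda>f. nrm V (\<Sum>i\<in>I. c i *\<^sub>R f i) < \<gamma>"])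
    show "\<sigma> p i < \<sigma> p j" if "i \<in> I" "j \<in> I" "\<tau> i < \<tau> j" for i j
      unfolding \<sigma>_def using h[OF that] that(3) by (simp add: add_le_less_mono)
    show "\<sigma> p ` I \<subseteq> {..<M}" using \<sigma>M p by auto
  qed (use \<tau> ev in \<open>auto cong: sum.cong\<close>)
  then have "eventually (\<lambda>ws. \<forall>p\<in>{..<n - K}. nrm V (\<Sum>i\<in>I. c i *\<^sub>R ws ! \<sigma> p i) < \<gamma>) (upow U M)"
    by (intro eventually_ball_finite) auto
  with eventually_upow_bounded[of M] show ?thesis
  proof eventually_elim
    case (elim ws)
    then have small: "nrm V (\<Sum>i\<in>I. c i *\<^sub>R ws ! \<sigma> p i) < \<gamma>" if "p < n - K" for p
      using that by blast
    note nth = nth_bounded[OF elim(1)[THEN conjunct1] elim(1)[THEN conjunct2]]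
    \<comment> \<open>the contribution of the shifts; for each \<open>i\<close> it leaves over \<open>K\<close> entries of block \<open>h i\<close>\<close>
    define main where "main = (1 / real n) *\<^sub>R (\<Sum>p<n - K. \<Sum>i\<in>I. c i *\<^sub>R ws ! \<sigma> p i)"
    define Q where "Q i = {..<n} - {\<tau> i..<\<tau> i + (n - K)}" for i
    define rest where "rest i = (1 / real n) *\<^sub>R (\<Sum>q\<in>Q i. ws ! (h i * n + q))" for i
    have restC: "nrm V (rest i) \<le> C * K / n" and restV: "rest i \<in> vecs V" if i: "i \<in> I" for i
    proof -
      have "\<tau> i < K" using i \<tau> by auto
      then have "{\<tau> i..<\<tau> i + (n - K)} \<subseteq> {..<n}" using Kn by auto
      then have card: "card (Q i) = K" using Kn by (simp add: Q_def card_Diff_subset)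
      have m: "ws ! (h i * n + q) \<in> vecs V" "nrm V (ws ! (h i * n + q)) \<le> C" if "q \<in> Q i" for q
        using nth[OF block_index[OF _ M[OF i]], of q] that by (auto simp: Q_def)
      have "nrm V (\<Sum>q\<in>Q i. 1 *\<^sub>R ws ! (h i * n + q)) \<le> (\<Sum>q\<in>Q i. \<bar>1\<bar>) * C"
        using m by (intro nrm_sum_scaleR_le)
      moreover have mem: "(\<Sum>q\<in>Q i. ws ! (h i * n + q)) \<in> vecs V" using m by (intro sum_mem)
      ultimately show "nrm V (rest i) \<le> C * K / n"
        using Kn by (simp add: rest_def nrm_scaleR card field_simps)
      show "rest i \<in> vecs V" unfolding rest_def using mem by (rule scaleR_mem)
    qed
    have split: "block_avg n ws (h i) = (1 / real n) *\<^sub>R (\<Sum>p<n - K. ws ! \<sigma> p i) + rest i"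
      if i: "i \<in> I" for i
    proof -
      have "\<tau> i < K" using i \<tau> by auto
      then have sub: "{\<tau> i..<\<tau> i + (n - K)} \<subseteq> {..<n}" using Kn by auto
      have "(\<Sum>q<n. ws ! (h i * n + q)) =
          (\<Sum>q\<in>Q i. ws ! (h i * n + q)) + (\<Sum>q\<in>{\<tau> i..<\<tau> i + (n - K)}. ws ! (h i * n + q))"
        unfolding Q_def using sum.subset_diff[OF sub] by auto
      also have "(\<Sum>q\<in>{\<tau> i..<\<tau> i + (n - K)}. ws ! (h i * n + q)) = (\<Sum>p<n - K. ws ! \<sigma> p i)"
        unfolding \<sigma>_def
        by (rule sum.reindex_bij_witness[of _ "\<lambda>p. \<tau> i + p" "\<lambda>q. q - \<tau> i"]) (auto simp: add.assoc)
      finally show ?thesis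
        by (simp add: block_avg_def rest_def scaleR_add_right add.commute)
    qed
    have "(\<Sum>i\<in>I. c i *\<^sub>R block_avg n ws (h i)) =
        (\<Sum>i\<in>I. (1 / real n) *\<^sub>R (\<Sum>p<n - K. c i *\<^sub>R ws ! \<sigma> p i)) + (\<Sum>i\<in>I. c i *\<^sub>R rest i)"
      unfolding sum.distrib[symmetric]
      by (rule sum.cong) (simp_all add: split scaleR_add_right scaleR_sum_right)
    also have "(\<Sum>i\<in>I. (1 / real n) *\<^sub>R (\<Sum>p<n - K. c i *\<^sub>R ws ! \<sigma> p i)) = main"
      unfolding main_def by (subst sum.swap) (simp add: scaleR_sum_right)
    finally have eq: "(\<Sum>i\<in>I. c i *\<^sub>R block_avg n ws (h i)) = main + (\<Sum>i\<in>I. c i *\<^sub>R rest i)" .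
    have memp: "(\<Sum>i\<in>I. c i *\<^sub>R ws ! \<sigma> p i) \<in> vecs V" if "p < n - K" for p
      using nth(1)[OF \<sigma>M[OF _ that]] by (intro sum_mem scaleR_mem)
    have sumV: "(\<Sum>p<n - K. \<Sum>i\<in>I. c i *\<^sub>R ws ! \<sigma> p i) \<in> vecs V"
      by (rule sum_mem, rule memp) simp
    then have mainV: "main \<in> vecs V" unfolding main_def by (rule scaleR_mem)
    have \<gamma>: "\<gamma> > 0" using small[of 0] nrm_nonneg[OF memp[of 0]] Kn by simp
    have "nrm V (\<Sum>p<n - K. \<Sum>i\<in>I. c i *\<^sub>R ws ! \<sigma> p i) \<le>
        (\<Sum>p<n - K. nrm V (\<Sum>i\<in>I. c i *\<^sub>R ws ! \<sigma> p i))"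
      using memp by (intro nrm_sum) auto
    also have "\<dots> < (\<Sum>p<n - K. \<gamma>)" using small Kn by (intro sum_strict_mono) (auto simp: lessThan_empty_iff)
    also have "\<dots> \<le> n * \<gamma>" using \<gamma> by (auto intro!: mult_right_mono)
    finally have "nrm V main < \<gamma>"
      using Kn by (simp add: main_def nrm_scaleR[OF sumV] field_simps)
    moreover have "nrm V (\<Sum>i\<in>I. c i *\<^sub>R rest i) \<le> (\<Sum>i\<in>I. \<bar>c i\<bar>) * (C * K / n)"
      using restC restV by (intro nrm_sum_scaleR_le)
    moreover have "nrm V (main + (\<Sum>i\<in>I. c i *\<^sub>R rest i)) \<le> nrm V main + nrm V (\<Sum>i\<in>I. c i *\<^sub>R rest i)"
      using mainV restV by (intro nrm_triangle sum_mem scaleR_mem)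
    ultimately show ?case by (simp add: eq mult.assoc)
  qed
qed

text \<open>
  Block \<open>h\<close> is complete before the first vector of block \<open>h'\<close> is drawn. The gap condition for the
  average over block \<open>h\<close> bounds every later vector away from it by one and the same functional, hence
  also the average of such vectors.
\<close>

lemma block_avg_separated:
  assumes n: "n > 0" and h: "h < h'" "(h' + 1) * n \<le> M"
  shows "eventually (\<lambda>ws. d \<le> nrm V (block_avg n ws h - block_avg n ws h')) (upow U M)"
proof -
  define K where "K = (h + 1) * n"
  have KM: "K \<le> h' * n" using h(1) by (simp add: K_def del: mult_Suc)
  have h'M: "h' * n + n \<le> M" using h(2) by simp
  have "eventually (\<lambda>ws. d \<le> nrm V (block_avg n ws h - block_avg n ws h')) (upow U (K + (M - K)))"
    unfolding eventually_upow_add using eventually_upow_bounded[of K]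
  proof eventually_elim
    case (elim us)
    let ?x = "block_avg n us h"
    have x: "?x \<in> vecs V"
      using elim n by (intro block_avg_bounded(1)[of _ K]) (auto simp: K_def)
    obtain f where f: "lin_on (vecs V) f" "\<And>y. y \<in> vecs V \<Longrightarrow> \<bar>f y\<bar> \<le> nrm V y"
      "eventually (\<lambda>w. f ?x + d < f w) U"
      using gap[OF x] by blast
    have "eventually (\<lambda>w. (w \<in> vecs V \<and> nrm V w \<le> C) \<and> f ?x + d < f w) U"
      using bounded f(3) by (rule eventually_conj)
    from eventually_upow_all[OF this, of "M - K"] show ?case
    proof eventually_elim
      case (elim vs)
      let ?y = "block_avg n (us @ vs) h'"
      have us: "length us = K" using \<open>length us = K \<and> _\<close> by simp
      have e1: "block_avg n (us @ vs) h = ?x"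
        unfolding block_avg_def using us by (auto simp: K_def nth_append intro!: sum.cong)
      have nth: "(us @ vs) ! (h' * n + p) \<in> vecs V" "f ?x + d < f ((us @ vs) ! (h' * n + p))"
        if "p < n" for p
      proof -
        have "(us @ vs) ! (h' * n + p) = vs ! (h' * n + p - K)" "h' * n + p - K < length vs"
          using us KM that elim h'M by (auto simp: nth_append)
        then have "(us @ vs) ! (h' * n + p) \<in> set vs" by simp
        with elim show "(us @ vs) ! (h' * n + p) \<in> vecs V" "f ?x + d < f ((us @ vs) ! (h' * n + p))"
          by auto
      qed
      have s: "(\<Sum>p<n. (us @ vs) ! (h' * n + p)) \<in> vecs V" using nth by (intro sum_mem) auto
      then have y: "?y \<in> vecs V" unfolding block_avg_def by (rule scaleR_mem)
      have "f ?y = (1 / real n) * (\<Sum>p<n. f ((us @ vs) ! (h' * n + p)))"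
        using nth(1) lin_on_scaleR[OF f(1) s, of "1 / real n"]
          lin_on_sum[OF f(1) subspace_vecs, of "{..<n}" "\<lambda>p. (us @ vs) ! (h' * n + p)"]
        by (simp add: block_avg_def)
      moreover have "(\<Sum>p<n. f ?x + d) \<le> (\<Sum>p<n. f ((us @ vs) ! (h' * n + p)))"
        using nth(2) by (intro sum_mono) (auto intro: less_imp_le)
      ultimately have "real n * (f ?x + d) \<le> real n * f ?y"
        using n by simp
      then have "f ?x + d \<le> f ?y"
        using n by simp
      moreover have "\<bar>f (?x - ?y)\<bar> \<le> nrm V (?x - ?y)" using x y by (intro f(2) diff_mem)
      moreover have "f (?x - ?y) = f ?x - f ?y" using lin_on_diff[OF f(1) subspace_vecs x y] .
      ultimately show ?case unfolding e1 by linarith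
    qed
  qed
  moreover have "K + (M - K) = M" using KM h'M by simp
  ultimately show ?thesis by simp
qed

text \<open>
  Stage \<open>n\<close> of the construction draws \<open>n * n\<close> vectors and assigns to index \<open>i < n\<close> the average over block
  number \<open>position r n i\<close>; \<open>H\<close> is the limit of these distributions along a free ultrafilter on the
  naturals. Contractivity compares two stages: the combination \<open>\<Sum>\<^sub>i a\<^sub>i w\<^sub>i\<close> at a fixed stage \<open>m\<close> is a
  combination of \<open>m * m\<close> entries, to which the sliding argument applies with the blocks of a much
  later stage \<open>n\<close>.
\<close>

theorem monotone_contractive_ultrafilter:
  fixes r :: "nat \<Rightarrow> real"
  assumes r: "inj r"
  shows "\<exists>H. ultra H \<and>
    (\<forall>i. eventually (\<lambda>w. w i \<in> vecs V \<and> nrm V (w i) \<le> C) H) \<and>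
    (\<forall>i j. r i < r j \<longrightarrow> eventually (\<lambda>w. d \<le> nrm V (w i - w j)) H) \<and>
    (\<forall>S g a \<gamma> e. finite S \<and> (\<forall>i\<in>S. \<forall>j\<in>S. r i \<le> r j \<longrightarrow> r (g i) \<le> r (g j)) \<and> e > 0 \<and>
      eventually (\<lambda>w. nrm V (\<Sum>i\<in>S. a i *\<^sub>R w i) < \<gamma>) H \<longrightarrow>
      eventually (\<lambda>w. nrm V (\<Sum>i\<in>S. a i *\<^sub>R w (g i)) < \<gamma> + e) H)"
proof -
  obtain N where N: "N \<le> sequentially" "ultra N"
    using ultra_ex[OF sequentially_bot] by blast
  define seq where "seq n ws i = block_avg n ws (position r n i)" for n and ws :: "'a list" and i
  define H where "H = bind_filter N (\<lambda>n. filtermap (seq n) (upow U (n * n)))"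
  have evH: "eventually P H \<longleftrightarrow> eventually (\<lambda>n. eventually (\<lambda>ws. P (seq n ws)) (upow U (n * n))) N" for P
    by (simp add: H_def eventually_bind_filter eventually_filtermap)
  have large: "eventually (\<lambda>n. n > k) N" for k :: nat
    using N(1) eventually_gt_at_top[of k] by (rule filter_leD)
  have "ultra H"
    unfolding H_def by (intro ultra_bind_filter ultra_filtermap ultra_upow N ultraU)
  moreover have "eventually (\<lambda>w. w i \<in> vecs V \<and> nrm V (w i) \<le> C) H" for i
    unfolding evH using large[of i]
  proof eventually_elim
    case (elim n)
    show ?case
      using eventually_upow_bounded[of "n * n"]
    proof eventually_elim
      case (elim ws)
      show ?case
        unfolding seq_def using elim \<open>i < n\<close> position_block[OF \<open>i < n\<close>]
        by (intro conjI block_avg_bounded[of _ "n * n"]) auto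
    qed
  qed
  moreover have "eventually (\<lambda>w. d \<le> nrm V (w i - w j)) H" if "r i < r j" for i j
    unfolding evH using large[of "max i j"]
  proof eventually_elim
    case (elim n)
    then show ?case
      unfolding seq_def using that
      by (intro block_avg_separated position_strict position_block) auto
  qed
  moreover have "eventually (\<lambda>w. nrm V (\<Sum>i\<in>S. a i *\<^sub>R w (g i)) < \<gamma> + e) H"
    if S: "finite S" and g: "\<forall>i\<in>S. \<forall>j\<in>S. r i \<le> r j \<longrightarrow> r (g i) \<le> r (g j)" and e: "e > 0"
      and ev: "eventually (\<lambda>w. nrm V (\<Sum>i\<in>S. a i *\<^sub>R w i) < \<gamma>) H" for S g a \<gamma> e
  proof -
    define L where "L = Max (insert 0 (S \<union> g ` S))"
    have L: "i \<le> L" if "i \<in> S \<union> g ` S" for i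
      unfolding L_def using S that by (intro Max_ge) auto
    have "eventually (\<lambda>m. L < m \<and>
        eventually (\<lambda>ws. nrm V (\<Sum>i\<in>S. a i *\<^sub>R seq m ws i) < \<gamma>) (upow U (m * m))) N"
      using large[of L] ev unfolding evH by (rule eventually_conj)
    then obtain m where mL: "L < m"
      and m: "eventually (\<lambda>ws. nrm V (\<Sum>i\<in>S. a i *\<^sub>R seq m ws i) < \<gamma>) (upow U (m * m))"
      using eventually_happens'[OF ultra_not_bot[OF N(2)]] by blast
    have Sm: "i < m" if "i \<in> S" for i using L[of i] that mL by simp
    \<comment> \<open>one term for each entry of a block of stage \<open>m\<close>\<close>
    define I where "I = S \<times> {..<m}"
    define \<tau> where "\<tau> = (\<lambda>(i, p). position r m i * m + p)"
    define c where "c = (\<lambda>(i, p :: nat). a i / real m)"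
    have split\<tau>: "\<tau> (i, p) div m = position r m i" "\<tau> (i, p) mod m = p" if "p < m" for i p
      using that by (auto simp: \<tau>_def)
    have position_le: "r i \<le> r j" if "i \<in> S" "j \<in> S" "position r m i \<le> position r m j" for i j
      using position_strict[OF Sm[OF that(2)], of r i] that(3) by (meson leD not_le_imp_less)
    have inj: "inj_on \<tau> I"
    proof (rule inj_onI, clarify)
      fix i p j q assume a: "(i, p) \<in> I" "(j, q) \<in> I" "\<tau> (i, p) = \<tau> (j, q)"
      then have "position r m i = position r m j" "p = q"
        using split\<tau>[of p i] split\<tau>[of q j] by (auto simp: I_def)
      moreover from this have "r i = r j" using position_le[of i j] position_le[of j i] a by (simp add: I_def)
      ultimately show "i = j \<and> p = q" using r by (simp add: inj_eq)
    qed
    have fI: "finite I" using S by (simp add: I_def)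
    have \<tau>m: "\<tau> ` I \<subseteq> {..<m * m}"
      using block_index[OF _ position_block[OF Sm]] by (auto simp: I_def \<tau>_def)
    have "(\<Sum>x\<in>I. c x *\<^sub>R ws ! \<tau> x) = (\<Sum>i\<in>S. a i *\<^sub>R seq m ws i)" for ws
      by (simp add: I_def c_def \<tau>_def seq_def block_avg_def scaleR_sum_right sum.cartesian_product
          case_prod_unfold)
    then have ev1: "eventually (\<lambda>ws. nrm V (\<Sum>x\<in>I. c x *\<^sub>R ws ! \<tau> x) < \<gamma>) (upow U (m * m))"
      using m by simp
    define B where "B = (\<Sum>x\<in>I. \<bar>c x\<bar>) * C * (m * m)"
    have "eventually (\<lambda>n. n > max (m * m) (max L (nat \<lceil>B / e\<rceil>))) N" by (rule large)
    then show ?thesis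
      unfolding evH
    proof eventually_elim
      case (elim n)
      then have n: "n > m * m" "n > L" "n > B / e" by (auto simp: nat_less_iff ceiling_less_iff) linarith
      have "eventually (\<lambda>ws. nrm V (\<Sum>x\<in>I. c x *\<^sub>R block_avg n ws (position r n (g (fst x)))) <
          \<gamma> + (\<Sum>x\<in>I. \<bar>c x\<bar>) * C * (m * m) / n) (upow U (n * n))"
      proof (rule eventually_upow_block_avg[OF fI inj \<tau>m _ n(1) _ ev1])
        show "position r n (g (fst x)) \<le> position r n (g (fst y))" if "x \<in> I" "y \<in> I" "\<tau> x < \<tau> y" for x y
        proof -
          have "position r m (fst x) \<le> position r m (fst y)"
            using that split\<tau>[of "snd x" "fst x"] split\<tau>[of "snd y" "fst y"]
              div_le_mono[of "\<tau> x" "\<tau> y" m] by (auto simp: I_def)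
          then show ?thesis using g position_le that by (intro position_mono) (auto simp: I_def)
        qed
        show "(position r n (g (fst x)) + 1) * n \<le> n * n" if "x \<in> I" for x
          using L[of "g (fst x)"] n(2) that by (intro position_block) (auto simp: I_def)
      qed
      moreover have "(\<Sum>x\<in>I. c x *\<^sub>R block_avg n ws (position r n (g (fst x)))) =
          (\<Sum>i\<in>S. a i *\<^sub>R seq n ws (g i))" for ws
      proof -
        have "(\<Sum>p<m. (a i / real m) *\<^sub>R x) = a i *\<^sub>R x" for i and x :: 'a
          using mL by (simp add: sum_constant_scaleR)
        then show ?thesis
          by (simp add: I_def c_def seq_def case_prod_unfold sum.cartesian_product' )
      qed
      moreover have "B / n < e" using n(3) e elim by (simp add: field_simps)
      ultimately show ?case
        by (auto simp: B_def elim!: eventually_mono)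
    qed
  qed
  ultimately show ?thesis by blast
qed

end

section \<open>A separable space of step functions\<close>

definition fin_supp :: "(nat \<Rightarrow> real) set"
  where "fin_supp = {a. finite {i. a i \<noteq> 0}}"

definition lincomb :: "(nat \<Rightarrow> real) \<Rightarrow> (nat \<Rightarrow> 'a) \<Rightarrow> 'a::real_vector"
  where "lincomb a w = (\<Sum>i | a i \<noteq> 0. a i *\<^sub>R w i)"

definition unit_vec :: "nat \<Rightarrow> nat \<Rightarrow> real"
  where "unit_vec i = (\<lambda>j. if j = i then 1 else 0)"

text \<open>
  The action of a map of the indices on coefficients: unit vector \<open>i\<close> goes to unit vector \<open>g i\<close>.
\<close>

definition push :: "(nat \<Rightarrow> nat) \<Rightarrow> (nat \<Rightarrow> real) \<Rightarrow> nat \<Rightarrow> real"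
  where "push g a = (\<lambda>j. \<Sum>i | a i \<noteq> 0 \<and> g i = j. a i)"

lemma fin_suppD: "a \<in> fin_supp \<Longrightarrow> finite {i. a i \<noteq> 0}"
  by (simp add: fin_supp_def)

lemma fin_suppI: "finite S \<Longrightarrow> (\<And>i. i \<notin> S \<Longrightarrow> a i = 0) \<Longrightarrow> a \<in> fin_supp"
  unfolding fin_supp_def by (auto elim!: finite_subset[rotated])

lemma lincomb_superset: "finite S \<Longrightarrow> (\<And>i. i \<notin> S \<Longrightarrow> a i = 0) \<Longrightarrow> lincomb a w = (\<Sum>i\<in>S. a i *\<^sub>R w i)"
  unfolding lincomb_def by (rule sum.mono_neutral_left) auto

lemma subspace_fin_supp: "subspace fin_supp"
proof (rule subspaceI)
  show "0 \<in> fin_supp" by (rule fin_suppI[of "{}"]) auto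
  show "a + b \<in> fin_supp" if "a \<in> fin_supp" "b \<in> fin_supp" for a b
    by (rule fin_suppI[of "{i. a i \<noteq> 0} \<union> {i. b i \<noteq> 0}"]) (use that in \<open>auto simp: fin_supp_def\<close>)
  show "c *\<^sub>R a \<in> fin_supp" if "a \<in> fin_supp" for c a
    by (rule fin_suppI[of "{i. a i \<noteq> 0}"]) (use that in \<open>auto simp: fin_supp_def scaleR_fun_def\<close>)
qed

lemma lincomb_add:
  assumes "a \<in> fin_supp" "b \<in> fin_supp"
  shows "lincomb (a + b) w = lincomb a w + lincomb b w"
proof -
  let ?S = "{i. a i \<noteq> 0} \<union> {i. b i \<noteq> 0}"
  have S: "finite ?S" using assms by (simp add: fin_supp_def)
  show ?thesis
    by (subst (1 2 3) lincomb_superset[OF S]) (auto simp: scaleR_add_left sum.distrib)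
qed

lemma lincomb_scale:
  assumes "a \<in> fin_supp"
  shows "lincomb (c *\<^sub>R a) w = c *\<^sub>R lincomb a w"
  by (subst (1 2) lincomb_superset[OF fin_suppD[OF assms]])
    (auto simp: scaleR_fun_def scaleR_sum_right)

lemma lincomb_diff:
  assumes "a \<in> fin_supp" "b \<in> fin_supp"
  shows "lincomb (a - b) w = lincomb a w - lincomb b w"
proof -
  have "lincomb (a + (- 1) *\<^sub>R b) w = lincomb a w + (- 1) *\<^sub>R lincomb b w"
    using assms by (simp only: lincomb_add lincomb_scale subspace_scale[OF subspace_fin_supp])
  then show ?thesis by simp
qed

lemma lincomb_add_right: "lincomb a (v + w) = lincomb a v + lincomb a w"
  by (simp add: lincomb_def scaleR_add_right sum.distrib)

lemma lincomb_diff_right: "lincomb a (v - w) = lincomb a v - lincomb a w"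
  by (simp add: lincomb_def scaleR_diff_right sum_subtractf)

lemma lincomb_scale_right: "lincomb a (c *\<^sub>R w) = c *\<^sub>R lincomb a w"
  by (simp add: lincomb_def scaleR_fun_def scaleR_sum_right mult.commute)

lemma lincomb_cong: "(\<And>i. a i \<noteq> 0 \<Longrightarrow> v i = w i) \<Longrightarrow> lincomb a v = lincomb a w"
  unfolding lincomb_def by (rule sum.cong) auto

lemma unit_mem: "unit_vec i \<in> fin_supp"
  by (rule fin_suppI[of "{i}"]) (auto simp: unit_vec_def)

lemma lincomb_unit [simp]: "lincomb (unit_vec i) w = w i"
  by (subst lincomb_superset[of "{i}"]) (auto simp: unit_vec_def)

lemma sum_fun_apply: "(\<Sum>i\<in>I. f i) x = (\<Sum>i\<in>I. f i x)"
  by (induction I rule: infinite_finite_induct) auto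

lemma lincomb_units:
  assumes "a \<in> fin_supp"
  shows "a = (\<Sum>i | a i \<noteq> 0. a i *\<^sub>R unit_vec i)"
proof
  fix j
  have "(\<Sum>i | a i \<noteq> 0. a i *\<^sub>R unit_vec i) j = (\<Sum>i | a i \<noteq> 0. if j = i then a i else 0)"
    by (auto simp: sum_fun_apply scaleR_fun_def unit_vec_def intro!: sum.cong)
  also have "\<dots> = a j" using fin_suppD[OF assms] by (simp add: sum.delta)
  finally show "a j = (\<Sum>i | a i \<noteq> 0. a i *\<^sub>R unit_vec i) j" by simp
qed

lemma push_zero: "j \<notin> g ` {i. a i \<noteq> 0} \<Longrightarrow> push g a j = 0"
proof -
  assume "j \<notin> g ` {i. a i \<noteq> 0}"
  then have "{i. a i \<noteq> 0 \<and> g i = j} = {}" by auto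
  then show ?thesis unfolding push_def by (metis sum.empty)
qed

lemma push_mem: "a \<in> fin_supp \<Longrightarrow> push g a \<in> fin_supp"
  using push_zero by (intro fin_suppI[of "g ` {i. a i \<noteq> 0}"]) (auto simp: fin_supp_def)

lemma lincomb_push:
  assumes "a \<in> fin_supp"
  shows "lincomb (push g a) w = lincomb a (\<lambda>i. w (g i))"
proof -
  let ?S = "{i. a i \<noteq> 0}"
  have S: "finite ?S" using assms by (rule fin_suppD)
  have "lincomb (push g a) w = (\<Sum>j\<in>g ` ?S. push g a j *\<^sub>R w j)"
    using S by (intro lincomb_superset push_zero) auto
  also have "\<dots> = (\<Sum>j\<in>g ` ?S. \<Sum>i\<in>{i \<in> ?S. g i = j}. a i *\<^sub>R w (g i))"
    unfolding push_def scaleR_sum_left by (intro sum.cong) auto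
  also have "\<dots> = (\<Sum>i\<in>?S. a i *\<^sub>R w (g i))"
    using S by (rule sum.image_gen[symmetric])
  finally show ?thesis by (simp add: lincomb_def)
qed

text \<open>
  For example, the summing norm \<open>a \<mapsto> sup\<^sub>t \<bar>\<Sum>{a\<^sub>i | r\<^sub>i \<ge> t}\<bar>\<close> is such a norm. The point \<open>r 0 = 0\<close> is
  the least one, so that every index can be rounded down to one of the first points.
\<close>

locale collapsing_norm =
  fixes N :: "(nat \<Rightarrow> real) \<Rightarrow> real" and r :: "nat \<Rightarrow> real" and C d :: real
  assumes N_add: "a \<in> fin_supp \<Longrightarrow> b \<in> fin_supp \<Longrightarrow> N (a + b) \<le> N a + N b"
    and N_scale: "a \<in> fin_supp \<Longrightarrow> N (c *\<^sub>R a) = \<bar>c\<bar> * N a"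
    and N_unit: "N (unit_vec i) \<le> C"
    and N_sep: "r i < r j \<Longrightarrow> d \<le> N (unit_vec i - unit_vec j)"
    and d_pos: "d > 0"
    and N_push: "a \<in> fin_supp \<Longrightarrow> (\<And>i j. r i \<le> r j \<Longrightarrow> r (g i) \<le> r (g j)) \<Longrightarrow> N (push g a) \<le> N a"
    and inj_r: "inj r"
    and r_0: "r 0 = 0"
    and r_nonneg: "0 \<le> r i"
    and r_dense: "0 \<le> s \<Longrightarrow> s < t \<Longrightarrow> t < 1 \<Longrightarrow> \<exists>k. s < r k \<and> r k \<le> t"
begin

lemma N_diff: "a \<in> fin_supp \<Longrightarrow> b \<in> fin_supp \<Longrightarrow> N (a - b) \<le> N a + N b"
  using N_add[of a "(- 1) *\<^sub>R b"] N_scale[of b "- 1"] subspace_scale[OF subspace_fin_supp, of b "- 1"]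
  by simp

lemma N_zero: "N 0 = 0"
  using N_scale[OF subspace_0[OF subspace_fin_supp], of 0] by simp

lemma N_nonneg: "a \<in> fin_supp \<Longrightarrow> 0 \<le> N a"
  using N_diff[of a a] N_zero by simp

lemma C_nonneg: "0 \<le> C"
  using N_nonneg[OF unit_mem] N_unit by (rule order_trans)

text \<open>
  Up to the factor \<open>2 / d\<close>, every such norm dominates the summing norm. With total sum \<open>s\<close> and sum \<open>B\<close> over the up-set, collapsing
  the up-set to index 1 and its complement to index 0 gives \<open>s e\<^sub>0 - B (e\<^sub>0 - e\<^sub>1)\<close>, and collapsing
  everything to index 0 gives \<open>s e\<^sub>0\<close>. Both have norm at most \<open>N a\<close>, so that
  \<open>\<bar>B\<bar> * d \<le> \<bar>B\<bar> * N (e\<^sub>0 - e\<^sub>1) \<le> 2 * N a\<close>.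
\<close>

lemma up_set_sum_le:
  assumes a: "a \<in> fin_supp" and up: "\<And>i j. i \<in> A \<Longrightarrow> r i \<le> r j \<Longrightarrow> j \<in> A"
  shows "\<bar>lincomb a (\<lambda>i. of_bool (i \<in> A))\<bar> \<le> 2 / d * N a"
proof -
  define B where "B = lincomb a (\<lambda>i. of_bool (i \<in> A) :: real)"
  define s where "s = lincomb a (\<lambda>i. 1 :: real)"
  define g where "g i = (if i \<in> A then 1 else 0 :: nat)" for i
  have r01: "r 0 < r 1" using r_0 r_nonneg[of 1] inj_r by (metis injD less_eq_real_def zero_neq_one)
  have sN: "N (s *\<^sub>R unit_vec 0) \<le> N a"
  proof -
    have "push (\<lambda>_. 0) a = s *\<^sub>R unit_vec 0"
      by (auto simp: push_def s_def lincomb_def scaleR_fun_def unit_vec_def)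
    then show ?thesis using N_push[OF a, of "\<lambda>_. 0"] by simp
  qed
  have "push g a = s *\<^sub>R unit_vec 0 - B *\<^sub>R (unit_vec 0 - unit_vec 1)"
  proof
    fix j
    have fin: "finite {i. a i \<noteq> 0}" using a by (rule fin_suppD)
    have "push g a j = (\<Sum>i | a i \<noteq> 0. a i * of_bool (g i = j))"
      unfolding push_def by (rule sum.mono_neutral_cong_left) (use fin in auto)
    also have "\<dots> = (s *\<^sub>R unit_vec 0 - B *\<^sub>R (unit_vec 0 - unit_vec 1)) j"
    proof (cases "j = 0")
      case True
      have "s - B = (\<Sum>i | a i \<noteq> 0. a i - a i * of_bool (i \<in> A))"
        unfolding s_def B_def lincomb_def by (simp add: sum_subtractf)
      also have "\<dots> = (\<Sum>i | a i \<noteq> 0. a i * of_bool (g i = 0))"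
        by (rule sum.cong) (auto simp: g_def)
      finally show ?thesis using True by (simp add: scaleR_fun_def unit_vec_def)
    next
      case False
      then show ?thesis
        by (auto simp: scaleR_fun_def unit_vec_def g_def B_def lincomb_def intro!: sum.cong sum.neutral)
    qed
    finally show "push g a j = (s *\<^sub>R unit_vec 0 - B *\<^sub>R (unit_vec 0 - unit_vec 1)) j" .
  qed
  then have eq: "B *\<^sub>R (unit_vec 0 - unit_vec 1) = s *\<^sub>R unit_vec 0 - push g a" by simp
  have "\<bar>B\<bar> * d \<le> \<bar>B\<bar> * N (unit_vec 0 - unit_vec 1)"
    using N_sep[OF r01] by (intro mult_left_mono) auto
  also have "\<dots> = N (B *\<^sub>R (unit_vec 0 - unit_vec 1))"
    by (intro N_scale[symmetric] subspace_diff[OF subspace_fin_supp] unit_mem)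
  also have "\<dots> \<le> N (s *\<^sub>R unit_vec 0) + N (push g a)"
    unfolding eq using push_mem[OF a] unit_mem
    by (intro N_diff subspace_scale[OF subspace_fin_supp])
  also have "N (push g a) \<le> N a"
    using r01 up by (intro N_push[OF a]) (auto simp: g_def)
  finally have "\<bar>B\<bar> * d \<le> 2 * N a" using sN by simp
  then show ?thesis using d_pos by (simp add: B_def field_simps)
qed

lemma coordinate_le:
  assumes a: "a \<in> fin_supp"
  shows "\<bar>a i\<bar> \<le> 4 / d * N a"
proof -
  let ?A = "{j. r i \<le> r j}" and ?B = "{j. r i < r j}"
  have eq: "of_bool (r i \<le> r j) - of_bool (r i < r j) = (of_bool (j = i) :: real)" for j
  proof (cases "j = i")
    case False
    then have "r i \<noteq> r j" using inj_r by (metis injD)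
    with False show ?thesis by auto
  qed simp
  have "lincomb a (\<lambda>j. of_bool (j \<in> ?A)) - lincomb a (\<lambda>j. of_bool (j \<in> ?B)) =
      lincomb a (\<lambda>j. of_bool (j = i) :: real)"
    unfolding lincomb_def sum_subtractf[symmetric]
    by (rule sum.cong) (simp_all add: eq flip: right_diff_distrib)
  also have "\<dots> = a i"
    using fin_suppD[OF a] by (subst lincomb_superset[of "insert i {j. a j \<noteq> 0}"]) (auto simp: if_distrib of_bool_def cong: if_cong)
  finally show ?thesis
    using up_set_sum_le[OF a, of ?A] up_set_sum_le[OF a, of ?B] by force
qed

definition E :: "(nat \<Rightarrow> real) nspace"
  where "E = \<lparr>vecs = fin_supp, nrm = N\<rparr>"

lemma E_simps [simp]: "vecs E = fin_supp" "nrm E = N"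
  by (simp_all add: E_def)

sublocale E: normed_space E
proof
  fix a assume a: "a \<in> vecs E"
  show "nrm E a = 0 \<longleftrightarrow> a = 0"
    using coordinate_le[of a] a N_zero by (auto intro!: ext)
qed (use N_add N_scale subspace_fin_supp in auto)

sublocale DE: normed_space "dual E"
  by (rule E.normed_space_dual)

text \<open>
  A functional on \<open>E\<close> is determined by its values on the unit vectors. The elements of the dual are
  represented by these sequences of values, because the predual sought is a space of sequences.
\<close>

definition functional :: "(nat \<Rightarrow> real) \<Rightarrow> (nat \<Rightarrow> real) \<Rightarrow> real"
  where "functional f = (\<lambda>a. if a \<in> fin_supp then lincomb a f else 0)"

definition bdd_seqs :: "(nat \<Rightarrow> real) set"
  where "bdd_seqs = {f. functional f \<in> vecs (dual E)}"

definition D :: "(nat \<Rightarrow> real) \<Rightarrow> real"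
  where "D f = nrm (dual E) (functional f)"

lemma functional_add: "functional (f + g) = functional f + functional g"
  by (auto simp: functional_def fun_eq_iff lincomb_add_right)

lemma functional_scale: "functional (c *\<^sub>R f) = c *\<^sub>R functional f"
  by (auto simp: functional_def fun_eq_iff lincomb_scale_right scaleR_fun_def[of c "\<lambda>a. if a \<in> fin_supp then lincomb a f else 0"])

lemma functional_diff: "functional (f - g) = functional f - functional g"
  by (auto simp: functional_def fun_eq_iff lincomb_diff_right)

lemma functional_unit: "functional f (unit_vec i) = f i"
  by (simp add: functional_def unit_mem)

lemma functional_eq_0: "functional f = 0 \<longleftrightarrow> f = 0"
proof
  assume "functional f = 0"
  then have "f i = 0" for i using functional_unit[of f i] by simp
  then show "f = 0" by (simp add: fun_eq_iff)
qed (simp add: functional_def lincomb_def fun_eq_iff)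

lemma bdd_seqsI:
  assumes "\<And>a. a \<in> fin_supp \<Longrightarrow> \<bar>lincomb a f\<bar> \<le> K * N a"
  shows "f \<in> bdd_seqs"
  unfolding bdd_seqs_def
proof (clarify, rule E.dual_memI[of _ K])
  show "lin_on (vecs E) (functional f)"
    using subspace_add[OF subspace_fin_supp] subspace_scale[OF subspace_fin_supp]
    by (auto simp: lin_on_def functional_def lincomb_add lincomb_scale)
qed (use assms in \<open>auto simp: functional_def\<close>)

lemma D_le:
  assumes "\<And>a. a \<in> fin_supp \<Longrightarrow> \<bar>lincomb a f\<bar> \<le> K * N a" "K \<ge> 0"
  shows "D f \<le> K"
  unfolding D_def using assms by (intro E.dual_nrm_le) (auto simp: functional_def)

lemma D_bound: "f \<in> bdd_seqs \<Longrightarrow> a \<in> fin_supp \<Longrightarrow> \<bar>lincomb a f\<bar> \<le> D f * N a"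
  using E.dual_bound[of "functional f" a] by (simp add: bdd_seqs_def D_def functional_def)

lemma functional_surj:
  assumes "\<phi> \<in> vecs (dual E)"
  shows "\<phi> = functional (\<lambda>i. \<phi> (unit_vec i))"
proof
  fix a
  show "\<phi> a = functional (\<lambda>i. \<phi> (unit_vec i)) a"
  proof (cases "a \<in> fin_supp")
    case True
    have lin: "lin_on fin_supp \<phi>" using E.dual_lin[OF assms] by simp
    have "\<phi> a = \<phi> (\<Sum>i | a i \<noteq> 0. a i *\<^sub>R unit_vec i)"
      using lincomb_units[OF True] by simp
    also have "\<dots> = (\<Sum>i | a i \<noteq> 0. \<phi> (a i *\<^sub>R unit_vec i))"
      by (intro lin_on_sum[OF lin subspace_fin_supp] subspace_scale[OF subspace_fin_supp] unit_mem)
    finally show ?thesis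
      using True lin_on_scaleR[OF lin unit_mem] by (simp add: functional_def lincomb_def)
  next
    case False
    then show ?thesis using E.dual_off[OF assms] by (simp add: functional_def)
  qed
qed

lemma subspace_bdd_seqs: "subspace bdd_seqs"
  using DE.zero_mem functional_eq_0[of 0]
  by (intro subspaceI) (auto simp: bdd_seqs_def functional_add functional_scale DE.add_mem DE.scaleR_mem)

lemma D_eq_0: "f \<in> bdd_seqs \<Longrightarrow> D f = 0 \<longleftrightarrow> f = 0"
  using DE.nrm_eq_0_iff[of "functional f"] by (simp add: bdd_seqs_def D_def functional_eq_0)

lemma D_nonneg: "f \<in> bdd_seqs \<Longrightarrow> 0 \<le> D f"
  using DE.nrm_nonneg[of "functional f"] by (simp add: bdd_seqs_def D_def)

lemma D_add: "f \<in> bdd_seqs \<Longrightarrow> g \<in> bdd_seqs \<Longrightarrow> D (f + g) \<le> D f + D g"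
  using DE.nrm_triangle by (simp add: bdd_seqs_def D_def functional_add)

lemma D_scale: "f \<in> bdd_seqs \<Longrightarrow> D (c *\<^sub>R f) = \<bar>c\<bar> * D f"
  using DE.nrm_scaleR by (simp add: bdd_seqs_def D_def functional_scale)

lemma D_coordinate: "f \<in> bdd_seqs \<Longrightarrow> \<bar>f i\<bar> \<le> C * D f"
  using D_bound[OF _ unit_mem, of f i] N_unit[of i] mult_left_mono[OF N_unit, of "D f" i] D_nonneg[of f]
  by (simp add: mult.commute)

text \<open>
  The index of the largest of the points \<open>r 0, \<dots>, r n\<close> that do not exceed \<open>t\<close>.
\<close>

definition floor_index :: "nat \<Rightarrow> real \<Rightarrow> nat"
  where "floor_index n t = (SOME j. j \<le> n \<and> r j \<le> t \<and> (\<forall>k\<le>n. r k \<le> t \<longrightarrow> r k \<le> r j))"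

lemma floor_index:
  assumes "t \<ge> 0"
  shows "floor_index n t \<le> n \<and> r (floor_index n t) \<le> t \<and>
    (\<forall>k\<le>n. r k \<le> t \<longrightarrow> r k \<le> r (floor_index n t))"
proof -
  let ?S = "r ` {k. k \<le> n \<and> r k \<le> t}"
  have fin: "finite ?S" and ne: "?S \<noteq> {}" using r_0 assms by auto
  obtain j where "Max ?S = r j" "j \<in> {k. k \<le> n \<and> r k \<le> t}"
    by (rule imageE[OF Max_in[OF fin ne]])
  then have "j \<le> n" "r j \<le> t" "r j = Max ?S" by simp_all
  moreover have "\<forall>k\<le>n. r k \<le> t \<longrightarrow> r k \<le> r j"
    unfolding \<open>r j = Max ?S\<close> using fin by (intro allI impI Max_ge) auto
  ultimately show ?thesis
    unfolding floor_index_def by (intro someI[of "\<lambda>j. j \<le> n \<and> r j \<le> t \<and> (\<forall>k\<le>n. r k \<le> t \<longrightarrow> r k \<le> r j)" j]) blast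
qed

lemma floor_index_eqI:
  assumes "t \<ge> 0" "j \<le> n" "r j \<le> t" "\<And>k. k \<le> n \<Longrightarrow> r k \<le> t \<Longrightarrow> r k \<le> r j"
  shows "floor_index n t = j"
proof (rule injD[OF inj_r], rule antisym)
  show "r (floor_index n t) \<le> r j" "r j \<le> r (floor_index n t)"
    using floor_index[OF assms(1), of n] assms by auto
qed

lemma floor_index_mono: "0 \<le> s \<Longrightarrow> s \<le> t \<Longrightarrow> r (floor_index n s) \<le> r (floor_index n t)"
  using floor_index[of s n] floor_index[of t n] by simp

text \<open>
  Rounding to a coarser set of points may be preceded by rounding to a finer one. This makes the
  spaces of step functions increase with the level.
\<close>

lemma floor_index_floor_index:
  assumes "n \<le> m" "t \<ge> 0"
  shows "floor_index n (r (floor_index m t)) = floor_index n t"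
  using floor_index[OF assms(2), of n] floor_index[OF assms(2), of m] assms r_nonneg
  by (intro floor_index_eqI) auto

definition ret :: "nat \<Rightarrow> nat \<Rightarrow> nat"
  where "ret n i = floor_index n (r i)"

lemma ret_le: "ret n i \<le> n"
  using floor_index r_nonneg by (simp add: ret_def)

lemma ret_mono: "r i \<le> r j \<Longrightarrow> r (ret n i) \<le> r (ret n j)"
  using floor_index_mono r_nonneg by (simp add: ret_def)

lemma ret_self: "i \<le> n \<Longrightarrow> ret n i = i"
  unfolding ret_def using r_nonneg by (intro floor_index_eqI) auto

lemma ret_ret: "n \<le> m \<Longrightarrow> ret n (ret m i) = ret n i"
  unfolding ret_def using r_nonneg by (intro floor_index_floor_index) auto

lemma N_push_ret: "a \<in> fin_supp \<Longrightarrow> N (push (ret n) a) \<le> N a"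
  by (intro N_push ret_mono)

definition steps :: "nat \<Rightarrow> (nat \<Rightarrow> real) set"
  where "steps n = {f. \<forall>i. f (ret n i) = f i}"

lemma steps_mono:
  assumes "n \<le> m" "f \<in> steps n" shows "f \<in> steps m"
proof -
  have "f (ret m i) = f i" for i
  proof -
    have "f (ret m i) = f (ret n (ret m i))" "f (ret n i) = f i" using assms(2) by (simp_all add: steps_def)
    then show ?thesis using ret_ret[OF assms(1), of i] by simp
  qed
  then show ?thesis by (simp add: steps_def)
qed

lemma steps_compose_ret: "(\<lambda>i. f (ret n i)) \<in> steps n"
  using ret_ret[of n n] by (simp add: steps_def)

lemma steps_add: "f \<in> steps n \<Longrightarrow> g \<in> steps n \<Longrightarrow> f + g \<in> steps n"
  by (simp add: steps_def)

lemma steps_diff: "f \<in> steps n \<Longrightarrow> g \<in> steps n \<Longrightarrow> f - g \<in> steps n"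
  by (simp add: steps_def)

lemma steps_scale: "f \<in> steps n \<Longrightarrow> c *\<^sub>R f \<in> steps n"
  by (simp add: steps_def scaleR_fun_def)

lemma steps_bound:
  assumes f: "f \<in> steps n" and b: "\<And>j. j \<le> n \<Longrightarrow> \<bar>f j\<bar> \<le> h" and a: "a \<in> fin_supp"
  shows "\<bar>lincomb a f\<bar> \<le> (real (Suc n) * h * (4 / d)) * N a"
proof -
  have h: "h \<ge> 0" using b[of 0] by simp
  have "lincomb a f = lincomb (push (ret n) a) f"
    using f by (subst lincomb_push[OF a]) (simp add: steps_def)
  also have "\<dots> = (\<Sum>j\<le>n. push (ret n) a j * f j)"
    using ret_le[of n] by (subst lincomb_superset[of "{..n}"]) (auto intro!: push_zero)
  finally have "\<bar>lincomb a f\<bar> \<le> (\<Sum>j\<le>n. \<bar>push (ret n) a j\<bar> * \<bar>f j\<bar>)"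
    using sum_abs[of "\<lambda>j. push (ret n) a j * f j" "{..n}"] by (simp add: abs_mult)
  also have "\<dots> \<le> (\<Sum>j\<le>n. (4 / d * N a) * h)"
  proof (rule sum_mono, rule mult_mono)
    fix j assume j: "j \<in> {..n}"
    have "\<bar>push (ret n) a j\<bar> \<le> 4 / d * N (push (ret n) a)" by (rule coordinate_le[OF push_mem[OF a]])
    also have "\<dots> \<le> 4 / d * N a" using N_push_ret[OF a] d_pos by (intro mult_left_mono) auto
    finally show "\<bar>push (ret n) a j\<bar> \<le> 4 / d * N a" .
    show "\<bar>f j\<bar> \<le> h" using b j by simp
    show "0 \<le> 4 / d * N a" using N_nonneg[OF a] d_pos by simp
  qed simp
  finally show ?thesis by (simp add: algebra_simps)
qed

lemma steps_bdd:
  assumes "f \<in> steps n"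
  shows "f \<in> bdd_seqs"
proof (rule bdd_seqsI, rule steps_bound[OF assms])
  show "\<bar>f j\<bar> \<le> (\<Sum>j\<le>n. \<bar>f j\<bar>)" if "j \<le> n" for j
    using that by (intro member_le_sum) auto
qed

text \<open>
  The adjoint of the contractive projection induced by \<open>ret n\<close> is composition with \<open>ret n\<close>.
\<close>

lemma D_compose_ret:
  assumes "f \<in> bdd_seqs"
  shows "D (\<lambda>i. f (ret n i)) \<le> D f"
proof (rule D_le)
  fix a assume a: "a \<in> fin_supp"
  have "\<bar>lincomb (push (ret n) a) f\<bar> \<le> D f * N (push (ret n) a)"
    by (rule D_bound[OF assms push_mem[OF a]])
  also have "\<dots> \<le> D f * N a" using D_nonneg[OF assms] N_push_ret[OF a] by (intro mult_left_mono)
  finally show "\<bar>lincomb a (\<lambda>i. f (ret n i))\<bar> \<le> D f * N a" by (simp add: lincomb_push[OF a])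
qed (rule D_nonneg[OF assms])

definition Z :: "(nat \<Rightarrow> real) nspace"
  where "Z = \<lparr>vecs = {f \<in> bdd_seqs. \<forall>e>0. \<exists>n. \<exists>g\<in>steps n. D (f - g) < e}, nrm = D\<rparr>"

lemma nrm_Z [simp]: "nrm Z = D"
  by (simp add: Z_def)

lemma Z_bdd: "f \<in> vecs Z \<Longrightarrow> f \<in> bdd_seqs"
  by (simp add: Z_def)

lemma Z_approx: "f \<in> vecs Z \<Longrightarrow> e > 0 \<Longrightarrow> \<exists>n. \<exists>g\<in>steps n. D (f - g) < e"
  by (simp add: Z_def)

lemma Z_memI: "f \<in> bdd_seqs \<Longrightarrow> (\<And>e. e > 0 \<Longrightarrow> \<exists>n. \<exists>g\<in>steps n. D (f - g) < e) \<Longrightarrow> f \<in> vecs Z"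
  by (simp add: Z_def)

lemma D_zero: "D 0 = 0"
  using D_eq_0[OF subspace_0[OF subspace_bdd_seqs]] by simp

lemma steps_Z: "f \<in> steps n \<Longrightarrow> f \<in> vecs Z"
  using steps_bdd D_zero by (intro Z_memI) (auto intro!: exI[of _ n] bexI[of _ f])

sublocale Z: normed_space Z
proof
  note sub = subspace_bdd_seqs
  show "subspace (vecs Z)"
  proof (rule subspaceI)
    show "0 \<in> vecs Z" by (rule steps_Z[of _ 0]) (simp add: steps_def)
    fix f g assume f: "f \<in> vecs Z" and g: "g \<in> vecs Z"
    show "f + g \<in> vecs Z"
    proof (rule Z_memI)
      fix e :: real assume "e > 0"
      then have e2: "e / 2 > 0" by simp
      obtain n f' where f': "f' \<in> steps n" "D (f - f') < e / 2" using Z_approx[OF f e2] by blast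
      obtain m g' where g': "g' \<in> steps m" "D (g - g') < e / 2" using Z_approx[OF g e2] by blast
      have "f' + g' \<in> steps (max n m)"
        using steps_mono[OF _ f'(1)] steps_mono[OF _ g'(1)] by (intro steps_add) auto
      moreover have "D ((f - f') + (g - g')) \<le> D (f - f') + D (g - g')"
        by (intro D_add subspace_diff[OF sub] Z_bdd[OF f] Z_bdd[OF g] steps_bdd[OF f'(1)] steps_bdd[OF g'(1)])
      moreover have "(f - f') + (g - g') = f + g - (f' + g')" by simp
      ultimately have "D (f + g - (f' + g')) < e" using f'(2) g'(2) by simp
      with \<open>f' + g' \<in> steps (max n m)\<close> show "\<exists>n. \<exists>h\<in>steps n. D (f + g - h) < e" by blast
    qed (rule subspace_add[OF sub Z_bdd[OF f] Z_bdd[OF g]])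
  next
    fix c f assume f: "f \<in> vecs Z"
    show "c *\<^sub>R f \<in> vecs Z"
    proof (rule Z_memI)
      fix e :: real assume e: "e > 0"
      then have "e / (\<bar>c\<bar> + 1) > 0" by simp
      then obtain n f' where f': "f' \<in> steps n" "D (f - f') < e / (\<bar>c\<bar> + 1)" using Z_approx[OF f] by blast
      have fb: "f - f' \<in> bdd_seqs" by (intro subspace_diff[OF sub] Z_bdd[OF f] steps_bdd[OF f'(1)])
      have "D (c *\<^sub>R f - c *\<^sub>R f') = \<bar>c\<bar> * D (f - f')"
        using D_scale[OF fb, of c] by (simp add: scaleR_diff_right)
      also have "\<dots> \<le> (\<bar>c\<bar> + 1) * D (f - f')" using D_nonneg[OF fb] by (simp add: distrib_right)
      also have "\<dots> < e" using f'(2) by (simp add: field_simps)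
      finally show "\<exists>n. \<exists>h\<in>steps n. D (c *\<^sub>R f - h) < e"
        using steps_scale[OF f'(1)] by blast
    qed (rule subspace_scale[OF sub Z_bdd[OF f]])
  qed
qed (simp_all add: Z_bdd D_eq_0 D_add D_scale)

lemma banach_space_Z: "banach_space Z"
  unfolding banach_space_def
proof
  show "normed_space Z" by (rule Z.normed_space_axioms)
  show "Metric_space.mcomplete (vecs Z) (ndist Z)"
  proof (rule Z.mcomplete_iff[THEN iffD2], intro allI impI, elim conjE)
    fix \<sigma> :: "nat \<Rightarrow> nat \<Rightarrow> real"
    assume \<sigma>: "\<forall>n. \<sigma> n \<in> vecs Z" and C: "\<forall>e>0. \<exists>N. \<forall>m\<ge>N. \<forall>n\<ge>N. nrm Z (\<sigma> m - \<sigma> n) < e"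
    have \<sigma>b: "functional (\<sigma> n) \<in> vecs (dual E)" for n
      using Z_bdd[OF \<sigma>[rule_format, of n]] by (simp add: bdd_seqs_def)
    have "\<forall>e>0. \<exists>N. \<forall>m\<ge>N. \<forall>n\<ge>N. nrm (dual E) (functional (\<sigma> m) - functional (\<sigma> n)) < e"
      using C unfolding nrm_Z D_def functional_diff .
    then have "\<exists>\<phi>\<in>vecs (dual E). \<forall>e>0. \<exists>N. \<forall>n\<ge>N. nrm (dual E) (functional (\<sigma> n) - \<phi>) < e"
      using DE.mcomplete_iff[THEN iffD1, OF E.mcomplete_dual, THEN spec, of "\<lambda>n. functional (\<sigma> n)"] \<sigma>b
      by simp
    then obtain \<phi> where \<phi>: "\<phi> \<in> vecs (dual E)"
      "\<And>e. e > 0 \<Longrightarrow> \<exists>N. \<forall>n\<ge>N. nrm (dual E) (functional (\<sigma> n) - \<phi>) < e"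
      by blast
    define f where "f = (\<lambda>i. \<phi> (unit_vec i))"
    have \<phi>f: "\<phi> = functional f" unfolding f_def by (rule functional_surj[OF \<phi>(1)])
    have lim: "\<exists>N. \<forall>n\<ge>N. D (\<sigma> n - f) < e" if "e > 0" for e
      using \<phi>(2)[OF that] unfolding D_def functional_diff \<phi>f .
    have fb: "f \<in> bdd_seqs" using \<phi>(1) unfolding \<phi>f bdd_seqs_def by simp
    have "f \<in> vecs Z"
    proof (rule Z_memI[OF fb])
      fix e :: real assume "e > 0"
      then have e2: "e / 2 > 0" by simp
      obtain N where N: "D (\<sigma> N - f) < e / 2" using lim[OF e2] by blast
      obtain n g where g: "g \<in> steps n" "D (\<sigma> N - g) < e / 2"
        using Z_approx[OF _ e2] \<sigma> by blast
      have s: "\<sigma> N \<in> bdd_seqs" "g \<in> bdd_seqs" using \<sigma> Z_bdd steps_bdd[OF g(1)] by auto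
      have "D ((\<sigma> N - g) + (- 1) *\<^sub>R (\<sigma> N - f)) \<le> D (\<sigma> N - g) + D ((- 1) *\<^sub>R (\<sigma> N - f))"
        by (intro D_add subspace_diff[OF subspace_bdd_seqs] subspace_scale[OF subspace_bdd_seqs] s fb)
      moreover have "D ((- 1) *\<^sub>R (\<sigma> N - f)) = D (\<sigma> N - f)"
        using D_scale[OF subspace_diff[OF subspace_bdd_seqs s(1) fb], of "- 1"] by simp
      moreover have "(\<sigma> N - g) + (- 1) *\<^sub>R (\<sigma> N - f) = f - g" by simp
      ultimately have "D (f - g) < e" using N g(2) by simp
      then show "\<exists>n. \<exists>g\<in>steps n. D (f - g) < e" using g(1) by blast
    qed
    then show "\<exists>x\<in>vecs Z. \<forall>e>0. \<exists>N. \<forall>n\<ge>N. nrm Z (\<sigma> n - x) < e"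
      unfolding nrm_Z using lim by (intro bexI[of _ f] allI impI)
  qed
qed

lemma separable_Z: "separable Z"
  unfolding Z.separable_iff
proof (intro exI conjI ballI allI impI)
  \<comment> \<open>step functions with rational values, coded by lists of rationals\<close>
  define q where "q n = (\<lambda>(qs :: rat list) i. if ret n i < length qs then of_rat (qs ! ret n i) else 0 :: real)" for n
  let ?Q = "\<Union>n. range (q n)"
  have qs: "q n l \<in> steps n" for n l
    using steps_compose_ret[of "\<lambda>i. if i < length l then of_rat (l ! i) else 0" n] by (simp add: q_def)
  show "countable ?Q" by auto
  show "?Q \<subseteq> vecs Z" using qs steps_Z by blast
  fix f and e :: real assume f: "f \<in> vecs Z" and "e > 0"
  then have e2: "e / 2 > 0" by simp
  obtain n g where g: "g \<in> steps n" "D (f - g) < e / 2" using Z_approx[OF f e2] by blast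
  define M where "M = real (Suc n) * (4 / d)"
  have M: "M > 0" using d_pos by (simp add: M_def)
  \<comment> \<open>values that agree up to \<open>h\<close> give, by \<open>steps_bound\<close>, functionals at distance at most \<open>e / 4\<close>\<close>
  define h where "h = e / 4 / M"
  have h: "h > 0" using \<open>e > 0\<close> M by (simp add: h_def)
  have "\<exists>x. \<bar>g j - of_rat x\<bar> < h" for j
  proof -
    obtain x where "g j - h < of_rat x" "of_rat x < g j"
      using of_rat_dense[of "g j - h" "g j"] h by auto
    then show ?thesis by (intro exI[of _ x]) simp
  qed
  then obtain x where x: "\<And>j. \<bar>g j - of_rat (x j)\<bar> < h" by metis
  define l where "l = map x [0..<Suc n]"
  have "\<bar>(g - q n l) j\<bar> \<le> h" if "j \<le> n" for j
  proof -
    have "q n l j = of_rat (x j)" using that by (simp add: q_def l_def ret_self del: upt_Suc)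
    then show ?thesis using x[of j] by simp
  qed
  note bound = steps_bound[OF steps_diff[OF g(1) qs] this]
  have "D (g - q n l) \<le> real (Suc n) * h * (4 / d)"
    using h d_pos by (intro D_le bound) auto
  also have "\<dots> = h * M" by (simp add: M_def)
  also have "\<dots> = e / 4" using M by (simp add: h_def)
  finally have "D (g - q n l) < e / 2" using \<open>e > 0\<close> by simp
  moreover have "D ((f - g) + (g - q n l)) \<le> D (f - g) + D (g - q n l)"
    by (intro D_add subspace_diff[OF subspace_bdd_seqs] Z_bdd[OF f] steps_bdd[OF g(1)] steps_bdd[OF qs])
  ultimately have "nrm Z (f - q n l) < e" using g(2) by simp
  then show "\<exists>q\<in>?Q. nrm Z (f - q) < e" by blast
qed

text \<open>
  The evaluation at a point \<open>t\<close>. A step function is constant from some level on along the roundings of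
  \<open>t\<close>, and the elements of \<open>Z\<close> are uniform limits of step functions.
\<close>

definition branch :: "real \<Rightarrow> (nat \<Rightarrow> real) \<Rightarrow> real"
  where "branch t f = (if f \<in> vecs Z then lim (\<lambda>n. f (floor_index n t)) else 0)"

lemma branch_step:
  assumes "f \<in> steps m" "t \<ge> 0" "m \<le> n"
  shows "f (floor_index n t) = f (floor_index m t)"
  using assms floor_index_floor_index[OF assms(3,2)] unfolding steps_def ret_def
  by (metis (mono_tags) mem_Collect_eq)

lemma branch_LIMSEQ:
  assumes f: "f \<in> vecs Z" and t: "t \<ge> 0"
  shows "(\<lambda>n. f (floor_index n t)) \<longlonglongrightarrow> branch t f"
proof -
  have "Cauchy (\<lambda>n. f (floor_index n t))"
  proof (rule metric_CauchyI)
    fix e :: real assume e: "e > 0"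
    then have "e / (2 * (C + 1)) > 0" using C_nonneg by simp
    then obtain m g where g: "g \<in> steps m" "D (f - g) < e / (2 * (C + 1))"
      using Z_approx[OF f] by blast
    have b: "f - g \<in> bdd_seqs" by (intro subspace_diff[OF subspace_bdd_seqs] Z_bdd[OF f] steps_bdd[OF g(1)])
    have "\<bar>f i - g i\<bar> < e / 2" for i
    proof -
      have "\<bar>f i - g i\<bar> \<le> (C + 1) * D (f - g)"
        using D_coordinate[OF b, of i] D_nonneg[OF b] by (simp add: algebra_simps)
      also have "\<dots> < e / 2" using g(2) C_nonneg by (simp add: field_simps)
      finally show ?thesis .
    qed
    note close = this
    have "dist (f (floor_index k t)) (f (floor_index n t)) < e" if "k \<ge> m" "n \<ge> m" for k n
      using close[of "floor_index k t"] close[of "floor_index n t"]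
        branch_step[OF g(1) t that(1)] branch_step[OF g(1) t that(2)]
      unfolding dist_real_def by linarith
    then show "\<exists>M. \<forall>m\<ge>M. \<forall>n\<ge>M. dist (f (floor_index m t)) (f (floor_index n t)) < e" by blast
  qed
  then show ?thesis
    using f by (simp add: branch_def Cauchy_convergent_iff convergent_LIMSEQ_iff)
qed

lemma branch_mem:
  assumes t: "t \<ge> 0"
  shows "branch t \<in> vecs (dual Z)"
proof (rule Z.dual_memI)
  note lim = branch_LIMSEQ[OF _ t]
  show "lin_on (vecs Z) (branch t)"
    unfolding lin_on_def
  proof (intro conjI ballI allI)
    fix f g assume fg: "f \<in> vecs Z" "g \<in> vecs Z"
    have "(\<lambda>n. (f + g) (floor_index n t)) \<longlonglongrightarrow> branch t f + branch t g"
      using tendsto_add[OF lim[OF fg(1)] lim[OF fg(2)]] by simp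
    then show "branch t (f + g) = branch t f + branch t g"
      by (rule LIMSEQ_unique[OF lim[OF Z.add_mem[OF fg]]])
  next
    fix c f assume f: "f \<in> vecs Z"
    have "(\<lambda>n. (c *\<^sub>R f) (floor_index n t)) \<longlonglongrightarrow> c *\<^sub>R branch t f"
      using tendsto_scaleR[OF tendsto_const lim[OF f], of c] by (simp add: scaleR_fun_def)
    then show "branch t (c *\<^sub>R f) = c *\<^sub>R branch t f"
      by (rule LIMSEQ_unique[OF lim[OF Z.scaleR_mem[OF f]]])
  qed
  show "\<bar>branch t f\<bar> \<le> C * nrm Z f" if f: "f \<in> vecs Z" for f
    using D_coordinate[OF Z_bdd[OF f]]
    by (intro tendsto_upperbound[OF tendsto_rabs[OF lim[OF f]]]) auto
qed (simp add: branch_def)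

text \<open>
  The two evaluations differ by 1 on the indicator of \<open>[r k,1)\<close>, whose norm is at most \<open>2 / d\<close> by
  \<open>up_set_sum_le\<close>.
\<close>

lemma branch_separated:
  assumes s: "0 \<le> s" "s < t" "t < 1"
  shows "d / 2 \<le> nrm (dual Z) (branch t - branch s)"
proof -
  obtain k where k: "s < r k" "r k \<le> t" using r_dense[OF s] by blast
  define f where "f i = (of_bool (r k \<le> r i) :: real)" for i
  have ret: "r k \<le> r (ret k i) \<longleftrightarrow> r k \<le> r i" for i
    using floor_index[OF r_nonneg, of k i] by (auto simp: ret_def)
  have fs: "f \<in> steps k" by (simp add: steps_def f_def ret)
  then have fZ: "f \<in> vecs Z" by (rule steps_Z)
  have "D f \<le> 2 / d"
    using up_set_sum_le[of _ "{i. r k \<le> r i}"] d_pos by (intro D_le) (auto simp: f_def[abs_def])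
  have lim: "branch u f = f (floor_index k u)" if u: "u \<ge> 0" for u
  proof (rule LIMSEQ_unique[OF branch_LIMSEQ[OF fZ u]])
    have "eventually (\<lambda>n. f (floor_index n u) = f (floor_index k u)) sequentially"
      using eventually_ge_at_top[of k] by eventually_elim (rule branch_step[OF fs u])
    then show "(\<lambda>n. f (floor_index n u)) \<longlonglongrightarrow> f (floor_index k u)" by (rule tendsto_eventually)
  qed
  have "branch t f = 1" "branch s f = 0"
    using lim[of t] lim[of s] s k floor_index[of t k] floor_index[of s k] by (auto simp: f_def)
  then have "1 = \<bar>(branch t - branch s) f\<bar>" by simp
  also have "\<dots> \<le> nrm (dual Z) (branch t - branch s) * nrm Z f"
  proof (rule Z.dual_bound[OF _ fZ])
    show "branch t - branch s \<in> vecs (dual Z)"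
      using s by (intro normed_space.diff_mem[OF Z.normed_space_dual] branch_mem) auto
  qed
  also have "\<dots> \<le> nrm (dual Z) (branch t - branch s) * (2 / d)"
    unfolding nrm_Z
  proof (rule mult_left_mono[OF \<open>D f \<le> 2 / d\<close>])
    show "0 \<le> nrm (dual Z) (branch t - branch s)"
      using s by (intro normed_space.nrm_nonneg[OF Z.normed_space_dual]
          normed_space.diff_mem[OF Z.normed_space_dual] branch_mem) auto
  qed
  finally show ?thesis using d_pos by (simp add: field_simps)
qed

lemma not_separable_dual_Z: "\<not> separable (dual Z)"
proof
  interpret DZ: normed_space "dual Z" by (rule Z.normed_space_dual)
  assume "separable (dual Z)"
  then obtain Q where Q: "countable Q" "Q \<subseteq> vecs (dual Z)"
    "\<And>x e. x \<in> vecs (dual Z) \<Longrightarrow> e > 0 \<Longrightarrow> \<exists>q\<in>Q. nrm (dual Z) (x - q) < e"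
    unfolding DZ.separable_iff by blast
  have "\<exists>q\<in>Q. nrm (dual Z) (branch t - q) < d / 4" if "t \<in> {0..<1}" for t
    using that d_pos by (intro Q(3) branch_mem) auto
  then obtain q where q: "\<And>t. t \<in> {0..<1} \<Longrightarrow> q t \<in> Q \<and> nrm (dual Z) (branch t - q t) < d / 4"
    by metis
  have ne: "q s \<noteq> q t" if "s \<in> {0..<1}" "t \<in> {0..<1}" "s < t" for s t
  proof
    assume eq: "q s = q t"
    have m: "branch t - q t \<in> vecs (dual Z)" "branch s - q t \<in> vecs (dual Z)"
      using q[OF that(1)] q[OF that(2)] Q(2) that by (auto intro!: DZ.diff_mem branch_mem)
    have "nrm (dual Z) (branch t - branch s) \<le> nrm (dual Z) (branch t - q t) + nrm (dual Z) (branch s - q t)"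
      using DZ.nrm_diff_triangle[OF m] by simp
    then show False
      using branch_separated[of s t] q[OF that(1)] q[OF that(2)] eq that by auto
  qed
  have "inj_on q {0..<1}"
    by (rule linorder_inj_onI') (use ne in auto)
  moreover have "countable (q ` {0..<1})"
    using q by (intro countable_subset[OF _ Q(1)]) auto
  ultimately have "countable {0..<1 :: real}" by (rule countable_image_inj_on[rotated])
  then show False using uncountable_half_open_interval_1[of 0 1] by simp
qed

end

section \<open>Finite-dimensional subspaces of the dual\<close>

text \<open>
  A closed subset of a product of compact intervals, which is compact by Tychonoff's theorem.
\<close>

lemma compact_l1_sphere:
  assumes B: "finite B"
  shows "compact {u :: 'i \<Rightarrow> real. (\<forall>b. b \<notin> B \<longrightarrow> u b = 0) \<and> (\<Sum>b\<in>B. \<bar>u b\<bar>) = 1}"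
proof -
  have "compactin (product_topology (\<lambda>_. euclidean) UNIV)
      (PiE UNIV (\<lambda>b :: 'i. if b \<in> B then {-1..1 :: real} else {0}))"
    unfolding compactin_PiE by simp
  then have "compact (PiE UNIV (\<lambda>b :: 'i. if b \<in> B then {-1..1 :: real} else {0}))"
    by (simp add: euclidean_product_topology)
  moreover have "closed {u :: 'i \<Rightarrow> real. (\<Sum>b\<in>B. \<bar>u b\<bar>) = 1}"
    by (intro closed_Collect_eq continuous_intros continuous_on_product_coordinates)
  ultimately have "compact (PiE UNIV (\<lambda>b :: 'i. if b \<in> B then {-1..1 :: real} else {0}) \<inter>
      {u. (\<Sum>b\<in>B. \<bar>u b\<bar>) = 1})"
    by (rule compact_Int_closed)
  also have "PiE UNIV (\<lambda>b :: 'i. if b \<in> B then {-1..1 :: real} else {0}) \<inter> {u. (\<Sum>b\<in>B. \<bar>u b\<bar>) = 1} =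
      {u. (\<forall>b. b \<notin> B \<longrightarrow> u b = 0) \<and> (\<Sum>b\<in>B. \<bar>u b\<bar>) = 1}"
  proof -
    have "- 1 \<le> u b \<and> u b \<le> 1" if "(\<Sum>b\<in>B. \<bar>u b\<bar>) = 1" "b \<in> B" for u :: "'i \<Rightarrow> real" and b
      using member_le_sum[OF that(2), of "\<lambda>b. \<bar>u b\<bar>"] B that(1) by (simp add: abs_le_iff)
    then show ?thesis
      unfolding set_eq_iff Int_iff mem_Collect_eq by (simp add: PiE_iff) blast
  qed
  finally show ?thesis .
qed

text \<open>
  Pointwise convergence of seminorms to the norm gives uniform estimates on a finite-dimensional
  subspace. In coordinates with respect to a basis, all these seminorms are eventually Lipschitz
  with a common constant \<open>L\<close> for the \<open>\<ell>\<^sub>1\<close>-norm, since they are bounded on the basis. So an estimate at a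
  point of the compact unit sphere extends to a neighbourhood, and finitely many points suffice.
\<close>

lemma (in normed_space) eventually_equivalent_on_span:
  fixes p :: "'s \<Rightarrow> 'a \<Rightarrow> real"
  assumes B: "finite B" "B \<subseteq> vecs V"
    and semi: "eventually (\<lambda>s. (\<forall>x\<in>vecs V. \<forall>y\<in>vecs V. p s (x + y) \<le> p s x + p s y) \<and>
      (\<forall>x\<in>vecs V. \<forall>c. p s (c *\<^sub>R x) = \<bar>c\<bar> * p s x)) F"
    and lim: "\<And>x. x \<in> vecs V \<Longrightarrow> ((\<lambda>s. p s x) \<longlongrightarrow> nrm V x) F"
  shows "eventually (\<lambda>s. \<forall>x\<in>span B. nrm V x / 2 \<le> p s x \<and> p s x \<le> 2 * nrm V x) F"
proof -
  obtain B' where B': "B' \<subseteq> B" "independent B'" "B \<subseteq> span B'"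
    by (rule maximal_independent_subset)
  have spanB: "span B' = span B"
    using span_mono[OF B'(1)] B'(3) span_minimal[OF B'(3) subspace_span] by auto
  have fin: "finite B'" using B'(1) B(1) by (rule finite_subset)
  have BV: "b \<in> vecs V" if "b \<in> B'" for b using that B' B by blast
  define l where "l u = (\<Sum>b\<in>B'. u b *\<^sub>R b)" for u :: "'a \<Rightarrow> real"
  define K where "K = {u :: 'a \<Rightarrow> real. (\<forall>b. b \<notin> B' \<longrightarrow> u b = 0) \<and> (\<Sum>b\<in>B'. \<bar>u b\<bar>) = 1}"
  have lV: "l u \<in> vecs V" for u
    unfolding l_def using BV by (intro sum_mem scaleR_mem)
  have lpos: "nrm V (l u) > 0" if "u \<in> K" for u
  proof -
    have "l u \<noteq> 0"
    proof
      assume "l u = 0"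
      then have "\<forall>b\<in>B'. u b = 0"
        using B'(2) fin unfolding l_def independent_explicit_finite_subsets by (metis order_refl)
      then show False using that by (simp add: K_def)
    qed
    then show ?thesis using nrm_nonneg[OF lV, of u] nrm_eq_0_iff[OF lV, of u] by simp
  qed
  define L where "L = 1 + (\<Sum>b\<in>B'. nrm V b)"
  have L: "L \<ge> 1" using nrm_nonneg BV by (auto simp: L_def intro!: sum_nonneg)
  have bL: "nrm V b \<le> L - 1" if "b \<in> B'" for b
    using member_le_sum[OF that, of "nrm V"] fin nrm_nonneg BV by (simp add: L_def)
  \<comment> \<open>around \<open>u\<close> the norm and the seminorms vary by at most an eighth of \<open>nrm V (l u)\<close>\<close>
  define Nb where "Nb u = {v. (\<Sum>b\<in>B'. \<bar>v b - u b\<bar>) * L < nrm V (l u) / 8}" for u :: "'a \<Rightarrow> real"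
  have "open (Nb u)" for u
    unfolding Nb_def by (intro open_Collect_less continuous_intros continuous_on_product_coordinates)
  moreover have "u \<in> Nb u" if "u \<in> K" for u using lpos[OF that] by (simp add: Nb_def)
  moreover have "compact K" unfolding K_def by (rule compact_l1_sphere[OF fin])
  ultimately obtain T where T: "T \<subseteq> K" "finite T" "K \<subseteq> (\<Union>u\<in>T. Nb u)"
    by (elim compactE_image[of K K Nb]) auto
  have "eventually (\<lambda>s. \<bar>p s (l u) - nrm V (l u)\<bar> < nrm V (l u) / 8) F" if "u \<in> T" for u
    using tendstoD[OF lim[OF lV[of u]], of "nrm V (l u) / 8"] lpos[of u] T(1) that
    by (auto simp: dist_real_def)
  then have e1: "eventually (\<lambda>s. \<forall>u\<in>T. \<bar>p s (l u) - nrm V (l u)\<bar> < nrm V (l u) / 8) F"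
    using T(2) by (intro eventually_ball_finite) auto
  have "eventually (\<lambda>s. p s b < L) F" if "b \<in> B'" for b
    using order_tendstoD(2)[OF lim[OF BV[OF that]], of L] bL[OF that] by simp
  then have e2: "eventually (\<lambda>s. \<forall>b\<in>B'. p s b < L) F"
    using fin by (intro eventually_ball_finite) auto
  show ?thesis
    using semi e1 e2
  proof eventually_elim
    case (elim s)
    have add: "p s (x + y) \<le> p s x + p s y" if "x \<in> vecs V" "y \<in> vecs V" for x y
      using elim that by blast
    have scl: "p s (c *\<^sub>R x) = \<bar>c\<bar> * p s x" if "x \<in> vecs V" for c x
      using elim that by blast
    have p0: "p s 0 = 0" using scl[OF zero_mem, of 0] by simp
    have ps: "p s (\<Sum>b\<in>A. c b *\<^sub>R b) \<le> (\<Sum>b\<in>A. \<bar>c b\<bar>) * L" if "A \<subseteq> B'" for A c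
      using finite_subset[OF that fin] that
    proof (induction A rule: finite_induct)
      case (insert b A)
      have "p s (c b *\<^sub>R b + (\<Sum>b\<in>A. c b *\<^sub>R b)) \<le> p s (c b *\<^sub>R b) + p s (\<Sum>b\<in>A. c b *\<^sub>R b)"
        using insert BV by (intro add sum_mem scaleR_mem) auto
      also have "p s (c b *\<^sub>R b) \<le> \<bar>c b\<bar> * L"
      proof -
        have "p s b \<le> L" "b \<in> vecs V" using insert BV elim by (auto intro: less_imp_le)
        then show ?thesis by (simp add: scl mult_left_mono)
      qed
      finally show ?case using insert by (simp add: algebra_simps)
    qed (simp add: p0)
    have on_K: "nrm V (l v) / 2 \<le> p s (l v) \<and> p s (l v) \<le> 2 * nrm V (l v)" if "v \<in> K" for v
    proof -
      obtain u where u: "u \<in> T" "v \<in> Nb u" using T(3) \<open>v \<in> K\<close> by blast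
      have df: "l v - l u = (\<Sum>b\<in>B'. (v b - u b) *\<^sub>R b)" "l u - l v = (\<Sum>b\<in>B'. (u b - v b) *\<^sub>R b)"
        by (simp_all add: l_def scaleR_diff_left sum_subtractf)
      have small: "(\<Sum>b\<in>B'. \<bar>v b - u b\<bar>) * L < nrm V (l u) / 8" using u(2) by (simp add: Nb_def)
      have sw: "(\<Sum>b\<in>B'. \<bar>u b - v b\<bar>) = (\<Sum>b\<in>B'. \<bar>v b - u b\<bar>)"
        by (rule sum.cong) auto
      have "p s (l v - l u) < nrm V (l u) / 8" "p s (l u - l v) < nrm V (l u) / 8"
        using ps[OF order_refl, of "\<lambda>b. v b - u b"] ps[OF order_refl, of "\<lambda>b. u b - v b"] small
        unfolding df sw by linarith+
      moreover have "p s (l v) \<le> p s (l v - l u) + p s (l u)" "p s (l u) \<le> p s (l u - l v) + p s (l v)"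
        using add[OF diff_mem[OF lV lV] lV, of v u u] add[OF diff_mem[OF lV lV] lV, of u v v] by simp_all
      moreover have "nrm V (l v - l u) < nrm V (l u) / 8"
      proof -
        have "nrm V (l v - l u) \<le> (\<Sum>b\<in>B'. \<bar>v b - u b\<bar>) * L"
          unfolding df using bL BV by (intro nrm_sum_scaleR_le) force+
        with small show ?thesis by simp
      qed
      moreover have "nrm V (l v) - nrm V (l u) \<le> nrm V (l v - l u)"
        "nrm V (l u) - nrm V (l v) \<le> nrm V (l v - l u)"
        using nrm_diff_ge[OF lV lV, of v u] nrm_diff_ge[OF lV lV, of u v] nrm_diff_commute[OF lV lV, of u v]
        by simp_all
      moreover have "\<bar>p s (l u) - nrm V (l u)\<bar> < nrm V (l u) / 8" using elim u(1) by blast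
      ultimately show ?thesis by linarith
    qed
    show ?case
    proof (intro ballI)
      fix x assume "x \<in> span B"
      then obtain u where u: "x = (\<Sum>b\<in>B'. u b *\<^sub>R b)"
        unfolding spanB[symmetric] span_finite[OF fin] by auto
      define v where "v b = (if b \<in> B' then u b else 0)" for b
      have xv: "x = l v" by (auto simp: u v_def l_def intro!: sum.cong)
      define t where "t = (\<Sum>b\<in>B'. \<bar>v b\<bar>)"
      show "nrm V x / 2 \<le> p s x \<and> p s x \<le> 2 * nrm V x"
      proof (cases "t = 0")
        case True
        then have "\<forall>b\<in>B'. v b = 0" using fin by (simp add: t_def sum_nonneg_eq_0_iff)
        then have "x = 0" by (simp add: xv l_def)
        then show ?thesis using p0 by simp
      next
        case False
        moreover have "t \<ge> 0" unfolding t_def by (rule sum_nonneg) simp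
        ultimately have t: "t > 0" by simp
        define v' where "v' b = v b / t" for b
        have "(\<Sum>b\<in>B'. \<bar>v' b\<bar>) = t / t"
          unfolding v'_def abs_divide t_def sum_divide_distrib[symmetric] using t by (simp add: t_def)
        then have "v' \<in> K" using t by (simp add: K_def) (simp add: v'_def v_def)
        note on_K[OF this]
        moreover have xl: "x = t *\<^sub>R l v'"
          using t by (simp add: xv l_def v'_def scaleR_sum_right)
        moreover have "nrm V x = t * nrm V (l v')" "p s x = t * p s (l v')"
          using t nrm_scaleR[OF lV, of t v'] scl[OF lV, of t v'] by (simp_all add: xl)
        ultimately show ?thesis using t by simp
      qed
    qed
  qed
qed

context collapsing_norm
begin

text \<open>
  The restriction of \<open>\<phi>\<close> to the step functions of level \<open>n\<close>, as an element of the span of the unit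
  vectors \<open>0, \<dots>, n\<close>: its coordinates are the values of \<open>\<phi>\<close> on the indicators of the steps.
\<close>

definition coeffs :: "nat \<Rightarrow> ((nat \<Rightarrow> real) \<Rightarrow> real) \<Rightarrow> nat \<Rightarrow> real"
  where "coeffs n \<phi> j = (if j \<le> n then \<phi> (\<lambda>i. of_bool (ret n i = j)) else 0)"

lemma coeffs_mem: "coeffs n \<phi> \<in> fin_supp"
  by (rule fin_suppI[of "{..n}"]) (auto simp: coeffs_def)

lemma coeffs_add: "coeffs n (\<phi> + \<psi>) = coeffs n \<phi> + coeffs n \<psi>"
  by (auto simp: coeffs_def)

lemma coeffs_scale: "coeffs n (c *\<^sub>R \<phi>) = c *\<^sub>R coeffs n \<phi>"
  by (auto simp: coeffs_def scaleR_fun_def)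

lemma coeffs_apply:
  assumes \<phi>: "\<phi> \<in> vecs (dual Z)" and f: "f \<in> steps n"
  shows "\<phi> f = lincomb (coeffs n \<phi>) f"
proof -
  let ?\<chi> = "\<lambda>j i. of_bool (ret n i = j) :: real"
  have \<chi>: "?\<chi> j \<in> vecs Z" for j
    using steps_compose_ret[of "\<lambda>i. of_bool (i = j)" n] steps_Z by blast
  have "f = (\<Sum>j\<le>n. f j *\<^sub>R ?\<chi> j)"
  proof
    fix i
    have "(\<Sum>j\<le>n. f j *\<^sub>R ?\<chi> j) i = (\<Sum>j\<le>n. if ret n i = j then f j else 0)"
      by (auto simp: sum_fun_apply scaleR_fun_def intro!: sum.cong)
    also have "\<dots> = f (ret n i)" using ret_le[of n i] by (simp add: sum.delta')
    also have "\<dots> = f i" using f by (simp add: steps_def)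
    finally show "f i = (\<Sum>j\<le>n. f j *\<^sub>R ?\<chi> j) i" by simp
  qed
  then have "\<phi> f = \<phi> (\<Sum>j\<le>n. f j *\<^sub>R ?\<chi> j)" by simp
  also have "\<dots> = (\<Sum>j\<le>n. \<phi> (f j *\<^sub>R ?\<chi> j))"
    using \<chi> by (intro lin_on_sum[OF Z.dual_lin[OF \<phi>] Z.subspace_vecs] Z.scaleR_mem)
  also have "\<dots> = (\<Sum>j\<le>n. coeffs n \<phi> j *\<^sub>R f j)"
    by (rule sum.cong) (simp_all add: lin_on_scaleR[OF Z.dual_lin[OF \<phi>] \<chi>] coeffs_def)
  also have "\<dots> = lincomb (coeffs n \<phi>) f"
    by (rule lincomb_superset[symmetric]) (auto simp: coeffs_def)
  finally show ?thesis .
qed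

text \<open>
  A norming functional for \<open>coeffs n \<phi>\<close> can be made a step function of level \<open>n\<close> without increasing its
  norm, by composition with \<open>ret n\<close>; this does not affect the first coordinates.
\<close>

lemma coeffs_norming:
  assumes \<phi>: "\<phi> \<in> vecs (dual Z)"
  shows "\<exists>f\<in>steps n. D f \<le> 1 \<and> \<phi> f = N (coeffs n \<phi>)"
proof -
  let ?a = "coeffs n \<phi>"
  have aE: "?a \<in> vecs E" using coeffs_mem by simp
  obtain G where G: "G \<in> vecs (dual E)" "\<And>b. b \<in> vecs E \<Longrightarrow> \<bar>G b\<bar> \<le> nrm E b" "G ?a = nrm E ?a"
    using E.norming_functional[OF aE] by blast
  define g where "g = (\<lambda>i. G (unit_vec i))"
  have Gg: "G = functional g" unfolding g_def by (rule functional_surj[OF G(1)])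
  have gb: "g \<in> bdd_seqs" using G(1) unfolding Gg bdd_seqs_def by simp
  have "D g \<le> 1" unfolding D_def Gg[symmetric] using G(2) by (intro E.dual_nrm_le) auto
  then have "D (\<lambda>i. g (ret n i)) \<le> 1" using D_compose_ret[OF gb, of n] by simp
  moreover have "\<phi> (\<lambda>i. g (ret n i)) = N ?a"
  proof -
    have "\<phi> (\<lambda>i. g (ret n i)) = lincomb ?a (\<lambda>i. g (ret n i))"
      by (rule coeffs_apply[OF \<phi> steps_compose_ret])
    also have "\<dots> = lincomb ?a g"
      by (rule lincomb_cong) (auto simp: coeffs_def intro!: arg_cong[of _ _ g] ret_self split: if_splits)
    also have "\<dots> = N ?a" using G(3) aE by (simp add: Gg functional_def)
    finally show ?thesis .
  qed
  ultimately show ?thesis using steps_compose_ret by blast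
qed

text \<open>
  By \<open>coeffs_norming\<close>, the number \<open>N (coeffs n \<phi>)\<close> is the norm of \<open>\<phi>\<close> on the step functions of level \<open>n\<close>.
  These norms increase to the norm of \<open>\<phi>\<close>, because step functions are dense in \<open>Z\<close>.
\<close>

lemma coeffs_tendsto:
  assumes \<phi>: "\<phi> \<in> vecs (dual Z)"
  shows "(\<lambda>n. N (coeffs n \<phi>)) \<longlonglongrightarrow> nrm (dual Z) \<phi>"
proof -
  interpret DZ: normed_space "dual Z" by (rule Z.normed_space_dual)
  have ex: "\<exists>f\<in>steps n. D f \<le> 1 \<and> \<phi> f = N (coeffs n \<phi>)" for n
    by (rule coeffs_norming[OF \<phi>])
  have le: "\<bar>\<phi> f\<bar> \<le> D f * N (coeffs n \<phi>)" if "f \<in> steps n" for f n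
    using D_bound[OF steps_bdd[OF that] coeffs_mem] coeffs_apply[OF \<phi> that] by simp
  have inc: "incseq (\<lambda>n. N (coeffs n \<phi>))"
    unfolding incseq_def
  proof (intro allI impI)
    fix n m :: nat assume "n \<le> m"
    obtain f where f: "f \<in> steps n" "D f \<le> 1" "\<phi> f = N (coeffs n \<phi>)" using ex by blast
    have "N (coeffs n \<phi>) \<le> D f * N (coeffs m \<phi>)"
      using le[OF steps_mono[OF \<open>n \<le> m\<close> f(1)]] f(3) by simp
    also have "\<dots> \<le> 1 * N (coeffs m \<phi>)"
      using f(2) N_nonneg[OF coeffs_mem] by (intro mult_right_mono)
    finally show "N (coeffs n \<phi>) \<le> N (coeffs m \<phi>)" by simp
  qed
  have ub: "N (coeffs n \<phi>) \<le> nrm (dual Z) \<phi>" for n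
  proof -
    obtain f where f: "f \<in> steps n" "D f \<le> 1" "\<phi> f = N (coeffs n \<phi>)" using ex by blast
    have "N (coeffs n \<phi>) \<le> nrm (dual Z) \<phi> * D f"
      using Z.dual_bound[OF \<phi> steps_Z[OF f(1)]] f(3) by simp
    also have "\<dots> \<le> nrm (dual Z) \<phi> * 1"
      using f(2) DZ.nrm_nonneg[OF \<phi>] by (rule mult_left_mono)
    finally show ?thesis by simp
  qed
  obtain l where l: "(\<lambda>n. N (coeffs n \<phi>)) \<longlonglongrightarrow> l" "\<And>n. N (coeffs n \<phi>) \<le> l"
    using incseq_convergent[OF inc, of "nrm (dual Z) \<phi>"] ub by blast
  have "l \<le> nrm (dual Z) \<phi>" using l(1) ub by (intro LIMSEQ_le_const2[OF l(1)]) auto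
  moreover have "nrm (dual Z) \<phi> \<le> l"
  proof (rule Z.dual_nrm_le)
    have l0: "0 \<le> l" using l(2)[of 0] N_nonneg[OF coeffs_mem, of 0 \<phi>] by simp
    then show "0 \<le> l" .
    fix f assume f: "f \<in> vecs Z"
    have "\<bar>\<phi> f\<bar> \<le> l * D f + e" if e: "e > 0" for e
    proof -
      define k where "k = nrm (dual Z) \<phi> + l + 1"
      have k: "k > 0" using DZ.nrm_nonneg[OF \<phi>] l0 by (simp add: k_def)
      then have "e / k > 0" using e by simp
      then obtain n g where g: "g \<in> steps n" "D (f - g) < e / k" using Z_approx[OF f] by blast
      note gZ = steps_Z[OF g(1)]
      have fg: "f - g \<in> vecs Z" using Z.diff_mem[OF f gZ] .
      have Dg: "D g \<le> D f + D (f - g)"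
        using Z.nrm_diff_triangle[OF f fg] by simp
      have "\<phi> f = \<phi> g + \<phi> (f - g)"
        using lin_on_diff[OF Z.dual_lin[OF \<phi>] Z.subspace_vecs f gZ] by simp
      then have h1: "\<bar>\<phi> f\<bar> \<le> \<bar>\<phi> g\<bar> + \<bar>\<phi> (f - g)\<bar>" by simp
      define \<delta> where "\<delta> = D (f - g)"
      have h2: "\<bar>\<phi> (f - g)\<bar> \<le> nrm (dual Z) \<phi> * \<delta>" using Z.dual_bound[OF \<phi> fg] by (simp add: \<delta>_def)
      have h3: "\<bar>\<phi> g\<bar> \<le> l * D g"
        by (rule order_trans[OF le[OF g(1)]], subst mult.commute,
            rule mult_right_mono[OF l(2) D_nonneg[OF steps_bdd[OF g(1)]]])
      have h4: "l * D g \<le> l * (D f + \<delta>)" using Dg l0 unfolding \<delta>_def by (rule mult_left_mono)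
      have aux: "x \<le> b + (e + c)" if "x \<le> y + z" "y \<le> a" "a \<le> b + c" "z \<le> e"
        for x y z a b c e :: real
        using that by linarith
      have "\<bar>\<phi> f\<bar> \<le> l * D f + (nrm (dual Z) \<phi> + l) * \<delta>"
        unfolding distrib_right by (rule aux[OF h1 h3 h4[unfolded distrib_left] h2])
      moreover have "(nrm (dual Z) \<phi> + l) * \<delta> \<le> k * (e / k)"
      proof (rule mult_mono)
        show "\<delta> \<le> e / k" "0 \<le> \<delta>" using g(2) D_nonneg[OF Z_bdd[OF fg]] by (simp_all add: \<delta>_def)
      qed (use k in \<open>simp_all add: k_def\<close>)
      moreover have "k * (e / k) = e" using k by simp
      ultimately show ?thesis by linarith
    qed
    then show "\<bar>\<phi> f\<bar> \<le> l * nrm Z f" unfolding nrm_Z by (rule field_le_epsilon)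
  qed
  ultimately show ?thesis using l(1) by simp
qed

end

section \<open>Banach--Mazur estimates\<close>

lemma findim_subspace_normed:
  assumes "normed_space V" "findim_subspace F V"
  shows "normed_space F"
proof -
  interpret normed_space V by fact
  obtain B where F: "vecs F \<subseteq> vecs V" "nrm F = nrm V" "vecs F = span B"
    using assms(2) by (auto simp: findim_subspace_def)
  have mem: "x \<in> vecs V" if "x \<in> vecs F" for x using F(1) that by blast
  show ?thesis
  proof
    show "subspace (vecs F)" unfolding F(3) by (rule subspace_span)
  qed (simp_all add: F(2) mem nrm_eq_0_iff nrm_triangle nrm_scaleR)
qed

lemma lin_on_span_image:
  assumes "lin_on (span B) T"
  shows "T ` span B = span (T ` B)"
proof (rule antisym)
  have "subspace {x \<in> span B. T x \<in> span (T ` B)}"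
    using lin_on_0[OF assms subspace_span]
    by (intro subspaceI) (auto simp: lin_on_add[OF assms] lin_on_scaleR[OF assms] span_add span_scale span_zero)
  then have "span B \<subseteq> {x \<in> span B. T x \<in> span (T ` B)}"
    by (rule span_minimal[rotated]) (auto intro: span_base)
  then show "T ` span B \<subseteq> span (T ` B)" by auto
  have "subspace (T ` span B)"
  proof (rule subspaceI)
    show "0 \<in> T ` span B"
      using lin_on_0[OF assms subspace_span] span_zero[of B] by force
    show "x + y \<in> T ` span B" if "x \<in> T ` span B" "y \<in> T ` span B" for x y
      using that by (auto simp flip: lin_on_add[OF assms] intro!: imageI span_add)
    show "c *\<^sub>R x \<in> T ` span B" if "x \<in> T ` span B" for c x
      using that by (auto simp flip: lin_on_scaleR[OF assms] intro!: imageI span_scale)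
  qed
  then show "span (T ` B) \<subseteq> T ` span B"
    by (intro span_minimal) (auto intro: span_base)
qed

lemma findim_subspace_image:
  assumes F: "findim_subspace F V" and T: "lin_on (vecs F) T" "T ` vecs F \<subseteq> vecs X"
  shows "findim_subspace \<lparr>vecs = T ` vecs F, nrm = nrm X\<rparr> X"
proof -
  obtain B where "finite B" "vecs F = span B" using F by (auto simp: findim_subspace_def)
  then show ?thesis
    using T lin_on_span_image[of B T] by (auto simp: findim_subspace_def intro!: exI[of _ "T ` B"])
qed

lemma op_norm_nonneg:
  assumes V: "normed_space V" and T: "lin_on (vecs V) T" and W: "normed_space W"
  shows "0 \<le> op_norm V W T"
proof -
  interpret V: normed_space V by fact
  interpret W: normed_space W by fact
  have "nrm W (T 0) = 0" using lin_on_0[OF T V.subspace_vecs] by simp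
  then show ?thesis
    unfolding op_norm_def using V.zero_mem by (intro SUP_upper2[of 0]) auto
qed

lemma op_norm_le:
  assumes "normed_space V" "\<And>x. x \<in> vecs V \<Longrightarrow> nrm W (T x) \<le> K * nrm V x" "K \<ge> 0"
  shows "op_norm V W T \<le> ereal K"
  unfolding op_norm_def
proof (rule SUP_least)
  fix x assume x: "x \<in> {x \<in> vecs V. nrm V x \<le> 1}"
  then have "nrm W (T x) \<le> K * 1"
    using assms(2)[of x] mult_left_mono[of "nrm V x" 1 K] assms(3) by simp
  then show "ereal (nrm W (T x)) \<le> ereal K" by simp
qed

lemma op_norm_bound:
  assumes V: "normed_space V" and W: "normed_space W" and T: "lin_on (vecs V) T" "T ` vecs V \<subseteq> vecs W"
    and K: "op_norm V W T = ereal K" and x: "x \<in> vecs V"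
  shows "nrm W (T x) \<le> K * nrm V x"
proof (cases "x = 0")
  case True
  interpret V: normed_space V by fact
  interpret W: normed_space W by fact
  show ?thesis using True lin_on_0[OF T(1) V.subspace_vecs] by simp
next
  case False
  interpret V: normed_space V by fact
  interpret W: normed_space W by fact
  have pos: "nrm V x > 0" using V.nrm_nonneg[OF x] V.nrm_eq_0_iff[OF x] False by simp
  let ?y = "(1 / nrm V x) *\<^sub>R x"
  have "ereal (nrm W (T ?y)) \<le> op_norm V W T"
    unfolding op_norm_def using x pos by (intro SUP_upper) (auto simp: V.scaleR_mem V.nrm_scaleR)
  moreover have "nrm W (T ?y) = nrm W (T x) / nrm V x"
    using lin_on_scaleR[OF T(1) x] W.nrm_scaleR[of "T x"] x T(2) pos by (auto simp: image_subset_iff)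
  ultimately show ?thesis using K pos by (simp add: field_simps)
qed

lemma lin_on_inv_into:
  assumes T: "lin_on S T" and S: "subspace S" and inj: "inj_on T S"
  shows "lin_on (T ` S) (inv_into S T)"
proof -
  have "inv_into S T (T x + T y) = x + y" if "x \<in> S" "y \<in> S" for x y
    using inv_into_f_f[OF inj subspace_add[OF S that]] lin_on_add[OF T that] by simp
  moreover have "inv_into S T (c *\<^sub>R T x) = c *\<^sub>R x" if "x \<in> S" for c x
    using inv_into_f_f[OF inj subspace_scale[OF S that, of c]] lin_on_scaleR[OF T that, of c] by simp
  ultimately show ?thesis by (auto simp: lin_on_def inv_into_f_f[OF inj])
qed

lemma banach_mazur_image_le:
  assumes V: "normed_space V" and X: "normed_space X" and F: "findim_subspace F V"
    and T: "lin_on (vecs F) T" "T ` vecs F \<subseteq> vecs X" and m: "m > 0" "M \<ge> 0"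
    and bnd: "\<And>x. x \<in> vecs F \<Longrightarrow> m * nrm F x \<le> nrm X (T x) \<and> nrm X (T x) \<le> M * nrm F x"
  shows "banach_mazur F \<lparr>vecs = T ` vecs F, nrm = nrm X\<rparr> \<le> ereal (M / m)"
proof -
  let ?G = "\<lparr>vecs = T ` vecs F, nrm = nrm X\<rparr>"
  have nF: "normed_space F" by (rule findim_subspace_normed[OF V F])
  have nG: "normed_space ?G" by (rule findim_subspace_normed[OF X findim_subspace_image[OF F T]])
  interpret F: normed_space F by (rule nF)
  interpret X: normed_space X by (rule X)
  have inj: "inj_on T (vecs F)"
  proof (rule inj_onI)
    fix x y assume xy: "x \<in> vecs F" "y \<in> vecs F" "T x = T y"
    have "T (x - y) = 0" using lin_on_diff[OF T(1) F.subspace_vecs xy(1,2)] xy(3) by simp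
    then have "m * nrm F (x - y) \<le> 0" using bnd[OF F.diff_mem[OF xy(1,2)]] by simp
    then have "nrm F (x - y) = 0"
      using m(1) F.nrm_nonneg[OF F.diff_mem[OF xy(1,2)]] by (simp add: mult_le_0_iff)
    then show "x = y" using F.nrm_eq_0_iff[OF F.diff_mem[OF xy(1,2)]] by simp
  qed
  have inv: "inv_into (vecs F) T (T x) = x" if "x \<in> vecs F" for x
    using inj that by simp
  have iso: "lin_iso F ?G T" using T(1) inj by (simp add: lin_iso_def inj_on_imp_bij_betw)
  have lininv: "lin_on (vecs ?G) (inv_into (vecs F) T)"
    using lin_on_inv_into[OF T(1) F.subspace_vecs inj] by simp
  have "op_norm F ?G T \<le> ereal M" using bnd m by (intro op_norm_le[OF nF]) auto
  moreover have "op_norm ?G F (inv_into (vecs F) T) \<le> ereal (1 / m)"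
    using bnd m by (intro op_norm_le[OF nG]) (auto simp: inv field_simps)
  ultimately have "op_norm F ?G T * op_norm ?G F (inv_into (vecs F) T) \<le> ereal M * ereal (1 / m)"
    using m op_norm_nonneg[OF nG lininv nF] by (intro ereal_mult_mono) auto
  then show ?thesis
    unfolding banach_mazur_def using iso by (intro INF_lower2[of T]) auto
qed

text \<open>
  The trivial space has to be treated separately: there both operator norms are 0 and provide no
  constants. On any other space both are positive, and since their product is finite, so are they.
\<close>

lemma banach_mazur_less_imp_embedding:
  assumes F: "normed_space F" and G: "normed_space G" and c: "c \<ge> 1"
    and bm: "banach_mazur F G < ereal c"
  shows "\<exists>T m M. lin_on (vecs F) T \<and> T ` vecs F \<subseteq> vecs G \<and> m > 0 \<and> 0 \<le> M \<and> M \<le> c * m \<and>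
    (\<forall>x\<in>vecs F. m * nrm F x \<le> nrm G (T x) \<and> nrm G (T x) \<le> M * nrm F x)"
proof -
  interpret F: normed_space F by (rule F)
  interpret G: normed_space G by (rule G)
  obtain T where T: "lin_iso F G T" and prod: "op_norm F G T * op_norm G F (inv_into (vecs F) T) < ereal c"
    using bm unfolding banach_mazur_def INF_less_iff by auto
  let ?S = "inv_into (vecs F) T"
  have lin: "lin_on (vecs F) T" and bij: "bij_betw T (vecs F) (vecs G)"
    using T by (auto simp: lin_iso_def)
  have im: "T ` vecs F = vecs G" and inj: "inj_on T (vecs F)"
    using bij by (auto simp: bij_betw_def)
  have inv: "?S (T x) = x" if "x \<in> vecs F" for x using inj that by simp
  have linS: "lin_on (vecs G) ?S"
    using lin_on_inv_into[OF lin F.subspace_vecs inj] im by simp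
  have imS: "?S ` vecs G = vecs F" using bij_betw_imp_surj_on[OF bij_betw_inv_into[OF bij]] .
  show ?thesis
  proof (cases "vecs F = {0}")
    case True
    then show ?thesis
      using lin im c lin_on_0[OF lin F.subspace_vecs]
      by (intro exI[of _ T] exI[of _ 1]) auto
  next
    case False
    then obtain x where x: "x \<in> vecs F" "x \<noteq> 0" using F.zero_mem by blast
    have Tx: "T x \<in> vecs G" "T x \<noteq> 0"
      using im x inj_onD[OF inj _ x(1) F.zero_mem] lin_on_0[OF lin F.subspace_vecs] by auto
    have nx: "nrm F x > 0" "nrm G (T x) > 0"
      using F.nrm_nonneg[OF x(1)] F.nrm_eq_0_iff[OF x(1)] x(2)
        G.nrm_nonneg[OF Tx(1)] G.nrm_eq_0_iff[OF Tx(1)] Tx(2) by auto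
    have n1: "0 \<le> op_norm F G T" and n2: "0 \<le> op_norm G F ?S"
      using op_norm_nonneg[OF F lin G] op_norm_nonneg[OF G linS F] by auto
    have p1: "op_norm F G T \<noteq> 0"
      using op_norm_bound[OF F G lin _ _ x(1), of 0] im nx by (auto simp: zero_ereal_def)
    have p2: "op_norm G F ?S \<noteq> 0"
      using op_norm_bound[OF G F linS _ _ Tx(1), of 0] imS nx inv[OF x(1)] by (auto simp: zero_ereal_def)
    obtain a b where ab: "op_norm F G T = ereal a" "op_norm G F ?S = ereal b" "a > 0" "b > 0" "a * b < c"
      using n1 n2 p1 p2 prod by (cases "op_norm F G T"; cases "op_norm G F ?S") auto
    have "(1 / b) * nrm F y \<le> nrm G (T y) \<and> nrm G (T y) \<le> a * nrm F y" if y: "y \<in> vecs F" for y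
      using op_norm_bound[OF F G lin _ ab(1) y] op_norm_bound[OF G F linS _ ab(2), of "T y"]
        im imS inv[OF y] y ab by (auto simp: field_simps)
    then show ?thesis
      using lin im ab by (intro exI[of _ T] exI[of _ "1 / b"] exI[of _ a]) (auto simp: field_simps)
  qed
qed

lemma dense_sequence_ex:
  "\<exists>r :: nat \<Rightarrow> real. inj r \<and> r 0 = 0 \<and> (\<forall>i. 0 \<le> r i) \<and>
    (\<forall>s t. 0 \<le> s \<longrightarrow> s < t \<longrightarrow> t < 1 \<longrightarrow> (\<exists>k. s < r k \<and> r k \<le> t))"
proof -
  define S where "S = \<rat> \<inter> {0<..<1 :: real}"
  have "infinite S"
  proof
    assume fin: "finite S"
    have ne: "S \<noteq> {}" using Rats_dense_in_real[of 0 1] by (auto simp: S_def)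
    have "Min S \<in> S" using fin ne by (rule Min_in)
    then obtain q where "q \<in> \<rat>" "0 < q" "q < Min S" "Min S < 1"
      using Rats_dense_in_real[of 0 "Min S"] by (auto simp: S_def)
    then have "q \<in> S" by (simp add: S_def)
    then show False using Min_le[OF fin, of q] \<open>q < Min S\<close> by simp
  qed
  moreover have "countable S" unfolding S_def using countable_rat by (rule countable_subset[rotated]) auto
  ultimately have bij: "bij_betw (from_nat_into S) UNIV S" by (intro bij_betw_from_nat_into)
  define r where "r i = (case i of 0 \<Rightarrow> 0 | Suc n \<Rightarrow> from_nat_into S n)" for i
  have mem: "from_nat_into S n \<in> S" for n using bij by (auto simp: bij_betw_def)
  then have pos: "0 < from_nat_into S n" for n by (auto simp: S_def)
  have "inj r"
  proof (rule injI)
    fix i j assume "r i = r j"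
    then show "i = j"
      using bij pos[THEN less_imp_neq] pos[THEN less_imp_neq, THEN not_sym]
      by (cases i; cases j) (auto simp: r_def bij_betw_def inj_eq)
  qed
  moreover have "\<exists>k. s < r k \<and> r k \<le> t" if st: "0 \<le> s" "s < t" "t < 1" for s t
  proof -
    obtain q where "q \<in> \<rat>" "s < q" "q < t" using Rats_dense_in_real[OF st(2)] by blast
    moreover from this have "q \<in> S" using st by (simp add: S_def)
    then obtain n where "from_nat_into S n = q" using bij by (metis bij_betw_def imageE)
    ultimately show ?thesis by (intro exI[of _ "Suc n"]) (simp add: r_def)
  qed
  moreover have "r 0 = 0" "\<forall>i. 0 \<le> r i"
    using pos by (auto simp: r_def less_imp_le split: nat.split)
  ultimately show ?thesis by blast
qed

text \<open>
  Every axiom on \<open>N\<close> is a limit of the corresponding statement about the norms of vectors that are drawn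
  along the ultrafilter of \<open>monotone_contractive_ultrafilter\<close>.
\<close>

lemma (in normed_space) collapsing_norm_ex:
  assumes "Metric_space.mcomplete (vecs V) (ndist V)" "\<not> reflexive V"
  shows "\<exists>H N r C d. H \<noteq> bot \<and> collapsing_norm N r C d \<and>
    (\<forall>i. eventually (\<lambda>w. w i \<in> vecs V) H) \<and>
    (\<forall>a\<in>fin_supp. ((\<lambda>w. nrm V (lincomb a w)) \<longlongrightarrow> N a) H)"
proof -
  obtain U C d where U: "ultra U" "d > 0" "eventually (\<lambda>w. w \<in> vecs V \<and> nrm V w \<le> C) U"
    "\<And>x. x \<in> vecs V \<Longrightarrow> \<exists>f. lin_on (vecs V) f \<and> (\<forall>y\<in>vecs V. \<bar>f y\<bar> \<le> nrm V y) \<and>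
      eventually (\<lambda>w. f x + d < f w) U"
    using nonreflexive_ultrafilter[OF assms] by blast
  interpret gap_ultrafilter V U C d
    by unfold_locales (fact U)+
  obtain r :: "nat \<Rightarrow> real" where r: "inj r" "r 0 = 0" "\<And>i. 0 \<le> r i"
    "\<And>s t. 0 \<le> s \<Longrightarrow> s < t \<Longrightarrow> t < 1 \<Longrightarrow> \<exists>k. s < r k \<and> r k \<le> t"
    using dense_sequence_ex by blast
  obtain H where H: "ultra H" and bH: "\<forall>i. eventually (\<lambda>w. w i \<in> vecs V \<and> nrm V (w i) \<le> C) H"
    and sH: "\<forall>i j. r i < r j \<longrightarrow> eventually (\<lambda>w. d \<le> nrm V (w i - w j)) H"
    and cH: "\<forall>S g a \<gamma> e. finite S \<and> (\<forall>i\<in>S. \<forall>j\<in>S. r i \<le> r j \<longrightarrow> r (g i) \<le> r (g j)) \<and> e > 0 \<and>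
      eventually (\<lambda>w. nrm V (\<Sum>i\<in>S. a i *\<^sub>R w i) < \<gamma>) H \<longrightarrow>
      eventually (\<lambda>w. nrm V (\<Sum>i\<in>S. a i *\<^sub>R w (g i)) < \<gamma> + e) H"
    using monotone_contractive_ultrafilter[OF r(1)] by (elim exE conjE) (rule that)
  have nb: "H \<noteq> bot" using H by (rule ultra_not_bot)
  define N where "N a = Lim H (\<lambda>w. nrm V (lincomb a w))" for a
  have mem: "eventually (\<lambda>w. lincomb a w \<in> vecs V \<and> nrm V (lincomb a w) \<le> (\<Sum>i | a i \<noteq> 0. \<bar>a i\<bar>) * C) H"
    if a: "a \<in> fin_supp" for a
  proof -
    have "eventually (\<lambda>w. \<forall>i\<in>{i. a i \<noteq> 0}. w i \<in> vecs V \<and> nrm V (w i) \<le> C) H"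
      using fin_suppD[OF a] bH by (intro eventually_ball_finite) auto
    then show ?thesis
      unfolding lincomb_def
      by eventually_elim (auto intro!: sum_mem scaleR_mem nrm_sum_scaleR_le)
  qed
  have lim: "((\<lambda>w. nrm V (lincomb a w)) \<longlongrightarrow> N a) H" if a: "a \<in> fin_supp" for a
    unfolding N_def
  proof (rule ultra_tendsto_Lim[OF H])
    show "eventually (\<lambda>w. \<bar>nrm V (lincomb a w)\<bar> \<le> (\<Sum>i | a i \<noteq> 0. \<bar>a i\<bar>) * C) H"
      using mem[OF a] by eventually_elim (simp add: nrm_nonneg)
  qed
  note sub = subspace_fin_supp
  have "collapsing_norm N r C d"
  proof
    fix a b assume a: "a \<in> fin_supp" and b: "b \<in> fin_supp"
    show "N (a + b) \<le> N a + N b"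
    proof (rule tendsto_le[OF nb tendsto_add[OF lim[OF a] lim[OF b]] lim[OF subspace_add[OF sub a b]]])
      show "eventually (\<lambda>w. nrm V (lincomb (a + b) w) \<le> nrm V (lincomb a w) + nrm V (lincomb b w)) H"
        using mem[OF a] mem[OF b] by eventually_elim (simp add: lincomb_add[OF a b] nrm_triangle)
    qed
  next
    fix a c assume a: "a \<in> fin_supp"
    have "((\<lambda>w. nrm V (lincomb (c *\<^sub>R a) w)) \<longlongrightarrow> \<bar>c\<bar> * N a) H"
    proof (rule Lim_transform_eventually[OF tendsto_mult_left[OF lim[OF a]]])
      show "eventually (\<lambda>w. \<bar>c\<bar> * nrm V (lincomb a w) = nrm V (lincomb (c *\<^sub>R a) w)) H"
        using mem[OF a] by eventually_elim (simp add: lincomb_scale[OF a] nrm_scaleR)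
    qed
    then show "N (c *\<^sub>R a) = \<bar>c\<bar> * N a"
      by (rule tendsto_unique[OF nb lim[OF subspace_scale[OF sub a]]])
  next
    fix i
    show "N (unit_vec i) \<le> C"
    proof (rule tendsto_upperbound[OF lim[OF unit_mem] _ nb])
      show "eventually (\<lambda>w. nrm V (lincomb (unit_vec i) w) \<le> C) H"
        using bH[rule_format, of i] by eventually_elim simp
    qed
  next
    fix i j assume ij: "r i < r j"
    show "d \<le> N (unit_vec i - unit_vec j)"
    proof (rule tendsto_lowerbound[OF lim[OF subspace_diff[OF sub unit_mem unit_mem]] _ nb])
      show "eventually (\<lambda>w. d \<le> nrm V (lincomb (unit_vec i - unit_vec j) w)) H"
        using sH[rule_format, OF ij] by eventually_elim (simp add: lincomb_diff unit_mem)
    qed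
  next
    fix a g assume a: "a \<in> fin_supp" and g: "\<And>i j. r i \<le> r j \<Longrightarrow> r (g i) \<le> r (g j)"
    show "N (push g a) \<le> N a"
    proof (rule field_le_epsilon)
      fix e :: real assume e: "e > 0"
      have "eventually (\<lambda>w. nrm V (lincomb a w) < N a + e / 2) H"
        using e by (intro order_tendstoD(2)[OF lim[OF a]]) simp
      then have "eventually (\<lambda>w. nrm V (\<Sum>i | a i \<noteq> 0. a i *\<^sub>R w (g i)) < N a + e / 2 + e / 2) H"
        unfolding lincomb_def using e g fin_suppD[OF a] by (rule_tac cH[rule_format], intro conjI) simp_all
      then have "eventually (\<lambda>w. nrm V (lincomb (push g a) w) \<le> N a + e) H"
        unfolding lincomb_push[OF a] by eventually_elim (simp add: lincomb_def)
      then show "N (push g a) \<le> N a + e"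
        by (intro tendsto_upperbound[OF lim[OF push_mem[OF a]] _ nb])
    qed
  qed (fact U(2) r)+
  moreover have "eventually (\<lambda>w. w i \<in> vecs V) H" for i
    using bH[rule_format, of i] by eventually_elim simp
  ultimately show ?thesis
    using nb lim by blast
qed

text \<open>
  A finite-dimensional subspace \<open>F\<close> of the dual of \<open>Z\<close> is mapped to \<open>W\<close> by \<open>\<phi> \<mapsto> \<Sum>\<^sub>j (coeffs n \<phi>)\<^sub>j w\<^sub>j\<close>.
  The norm of the image tends to \<open>\<parallel>\<phi>\<parallel>\<close> if first \<open>w\<close> runs through the ultrafilter and then \<open>n\<close>
  tends to infinity, so some pair \<open>(n, w)\<close> gives an embedding with distortion at most 4. Finite
  representability of \<open>W\<close> in \<open>X\<close> adds a factor 2.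
\<close>

theorem theorem1p8:
  fixes X :: "'a::real_vector nspace"
  assumes "banach_space X"
    and "\<not> superreflexive TYPE('w::real_vector) X"
  shows "\<exists>Z :: (nat \<Rightarrow> real) nspace.
    banach_space Z \<and> separable Z \<and> \<not> separable (dual Z) \<and>
    crudely_finitely_representable (dual Z) X"
proof -
  interpret X: normed_space X using assms(1) by (simp add: banach_space_def)
  obtain W :: "'w nspace" where W: "banach_space W" "finitely_representable W X" "\<not> reflexive W"
    using assms(2) by (auto simp: superreflexive_def)
  interpret W: normed_space W using W(1) by (simp add: banach_space_def)
  obtain H N r C d where H: "H \<noteq> bot" "\<And>i. eventually (\<lambda>w. w i \<in> vecs W) H"
    "\<And>a. a \<in> fin_supp \<Longrightarrow> ((\<lambda>w. nrm W (lincomb a w)) \<longlongrightarrow> N a) H"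
    and "collapsing_norm N r C d"
    using W.collapsing_norm_ex W(1,3) unfolding banach_space_def by blast
  interpret collapsing_norm N r C d by fact
  interpret DZ: normed_space "dual Z" by (rule Z.normed_space_dual)
  have "\<exists>G. findim_subspace G X \<and> banach_mazur F G \<le> ereal 8" if F: "findim_subspace F (dual Z)" for F
  proof -
    obtain B where B: "finite B" "vecs F = span B" "span B \<subseteq> vecs (dual Z)" "nrm F = nrm (dual Z)"
      using F by (auto simp: findim_subspace_def)
    define S where "S = (\<lambda>(n, w :: nat \<Rightarrow> 'w) \<phi>. lincomb (coeffs n \<phi>) w)"
    define P where "P = bind_filter sequentially (\<lambda>n. filtermap (Pair n) H)"
    have Pbot: "P \<noteq> bot"
      unfolding P_def using H(1) by (intro bind_filter_not_bot) (simp_all add: filtermap_bot_iff)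
    have mem: "eventually (\<lambda>s. \<forall>\<phi>. S s \<phi> \<in> vecs W) P"
      unfolding P_def eventually_bind_filter eventually_filtermap
    proof (rule always_eventually, rule allI)
      fix n
      have "eventually (\<lambda>w. \<forall>i\<in>{..n}. w i \<in> vecs W) H"
        using H(2) by (intro eventually_ball_finite) auto
      then show "eventually (\<lambda>w. \<forall>\<phi>. S (n, w) \<phi> \<in> vecs W) H"
      proof eventually_elim
        case (elim w)
        show ?case
          unfolding S_def lincomb_def using elim
          by (auto intro!: W.sum_mem W.scaleR_mem simp: coeffs_def split: if_splits)
      qed
    qed
    have Sadd: "S s (\<phi> + \<psi>) = S s \<phi> + S s \<psi>" for s \<phi> \<psi>
      by (simp add: S_def case_prod_unfold coeffs_add lincomb_add coeffs_mem)
    have Sscale: "S s (c *\<^sub>R \<phi>) = c *\<^sub>R S s \<phi>" for s c \<phi>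
      by (simp add: S_def case_prod_unfold coeffs_scale lincomb_scale coeffs_mem)
    have "eventually (\<lambda>s. \<forall>\<phi>\<in>span B. nrm (dual Z) \<phi> / 2 \<le> nrm W (S s \<phi>) \<and>
        nrm W (S s \<phi>) \<le> 2 * nrm (dual Z) \<phi>) P"
    proof (rule DZ.eventually_equivalent_on_span[OF B(1)])
      show "B \<subseteq> vecs (dual Z)" using span_superset B(3) by blast
      show "eventually (\<lambda>s. (\<forall>\<phi>\<in>vecs (dual Z). \<forall>\<psi>\<in>vecs (dual Z).
          nrm W (S s (\<phi> + \<psi>)) \<le> nrm W (S s \<phi>) + nrm W (S s \<psi>)) \<and>
          (\<forall>\<phi>\<in>vecs (dual Z). \<forall>c. nrm W (S s (c *\<^sub>R \<phi>)) = \<bar>c\<bar> * nrm W (S s \<phi>))) P"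
        using mem by eventually_elim (simp add: Sadd Sscale W.nrm_triangle W.nrm_scaleR)
      fix \<phi> assume \<phi>: "\<phi> \<in> vecs (dual Z)"
      show "((\<lambda>s. nrm W (S s \<phi>)) \<longlongrightarrow> nrm (dual Z) \<phi>) P"
        unfolding P_def
      proof (rule tendsto_bind_filter[OF _ coeffs_tendsto[OF \<phi>]], rule always_eventually, rule allI)
        fix n
        show "((\<lambda>s. nrm W (S s \<phi>)) \<longlongrightarrow> N (coeffs n \<phi>)) (filtermap (Pair n) H)"
          unfolding tendsto_compose_filtermap[unfolded comp_def] S_def
          using H(3)[OF coeffs_mem, of n \<phi>] by (simp add: filterlim_filtermap)
      qed
    qed
    from eventually_happens'[OF Pbot eventually_conj[OF mem this]] obtain s where
      s: "\<And>\<phi>. S s \<phi> \<in> vecs W" "\<And>\<phi>. \<phi> \<in> vecs F \<Longrightarrow>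
        nrm F \<phi> / 2 \<le> nrm W (S s \<phi>) \<and> nrm W (S s \<phi>) \<le> 2 * nrm F \<phi>"
      unfolding B by blast
    have Slin: "lin_on (vecs F) (S s)" by (simp add: lin_on_def Sadd Sscale)
    define G where "G = \<lparr>vecs = S s ` vecs F, nrm = nrm W\<rparr>"
    have GW: "findim_subspace G W"
      unfolding G_def using s(1) by (intro findim_subspace_image[OF F Slin]) auto
    obtain G' where G': "findim_subspace G' X" "banach_mazur G G' < ereal 2"
      using W(2) GW unfolding finitely_representable_def by (metis one_add_one zero_less_one)
    obtain T m M where T: "lin_on (vecs G) T" "T ` vecs G \<subseteq> vecs G'" and mM: "m > 0" "0 \<le> M" "M \<le> 2 * m"
      and Tb: "\<And>x. x \<in> vecs G \<Longrightarrow> m * nrm G x \<le> nrm G' (T x) \<and> nrm G' (T x) \<le> M * nrm G x"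
      using banach_mazur_less_imp_embedding[OF findim_subspace_normed[OF W.normed_space_axioms GW]
          findim_subspace_normed[OF X.normed_space_axioms G'(1)] _ G'(2)] by force
    define R where "R \<phi> = T (S s \<phi>)" for \<phi>
    have SG: "S s \<phi> \<in> vecs G" if "\<phi> \<in> vecs F" for \<phi> using that by (simp add: G_def)
    have Rlin: "lin_on (vecs F) R"
      unfolding lin_on_def R_def using SG by (simp add: Sadd Sscale lin_on_add[OF T(1)] lin_on_scaleR[OF T(1)])
    have G'X: "vecs G' \<subseteq> vecs X" "nrm G' = nrm X" using G'(1) by (auto simp: findim_subspace_def)
    have RX: "R ` vecs F \<subseteq> vecs X" using SG T(2) G'X(1) unfolding R_def by blast
    have Rb: "(m / 2) * nrm F \<phi> \<le> nrm X (R \<phi>) \<and> nrm X (R \<phi>) \<le> (2 * M) * nrm F \<phi>"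
      if \<phi>: "\<phi> \<in> vecs F" for \<phi>
    proof -
      have "m * nrm W (S s \<phi>) \<le> nrm X (R \<phi>)" "nrm X (R \<phi>) \<le> M * nrm W (S s \<phi>)"
        using Tb[OF SG[OF \<phi>]] by (simp_all add: R_def G'X(2) G_def)
      moreover have "m * (nrm F \<phi> / 2) \<le> m * nrm W (S s \<phi>)" "M * nrm W (S s \<phi>) \<le> M * (2 * nrm F \<phi>)"
        using s(2)[OF \<phi>] mM by (auto intro: mult_left_mono)
      ultimately show ?thesis by simp
    qed
    let ?R = "\<lparr>vecs = R ` vecs F, nrm = nrm X\<rparr>"
    have "banach_mazur F ?R \<le> ereal ((2 * M) / (m / 2))"
      using mM Rb
      by (intro banach_mazur_image_le[OF DZ.normed_space_axioms X.normed_space_axioms F Rlin RX]) auto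
    also have "(2 * M) / (m / 2) \<le> 8" using mM by (simp add: field_simps)
    finally have "banach_mazur F ?R \<le> ereal 8" by simp
    with findim_subspace_image[OF F Rlin RX] show ?thesis by blast
  qed
  then have "crudely_finitely_representable (dual Z) X"
    unfolding crudely_finitely_representable_def by (intro exI[of _ 8]) auto
  then show ?thesis
    using banach_space_Z separable_Z not_separable_dual_Z by blast
qed

end
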